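(* Let $d \geq 1$ and let $\Omega \subset \mathbb{R}^d$ be a bounded open tiling set. Assume that the embedding $W_2^1(\Omega) \subset L_2(\Omega)$ is compact. Let $0 = \mu_1(\Omega) \leq \mu_2(\Omega) \leq \mu_3(\Omega) \leq \dots$ be the eigenvalues, repeated according to multiplicity, of the Laplace operator of the Neumann problem in $\Omega$, and let $N_{\mathcal{N}}(\lambda, \Omega) = \#\{k : \mu_k(\Omega) < \lambda\}$. Then $$ \mu_{k+1}(\Omega) \leq \frac{4\pi^2}{\left(\omega_d |\Omega|\right)^{2/d}}\, k^{2/d} \qquad \text{for all natural numbers } k \geq 1, $$ and $$ N_{\mathcal{N}}(\lambda, \Omega) \geq \frac{\omega_d |\Omega|}{(2\pi)^d}\, \lambda^{d/2} \qquad \text{for all } \lambda > 0. $$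
   Context: Here $|\cdot|$ denotes Lebesgue measure on $\mathbb{R}^d$ and $\omega_d$ is the volume of the unit ball in $\mathbb{R}^d$. $W_2^1(\Omega)$ is the Sobolev space of functions in $L_2(\Omega)$ whose weak first-order derivatives belong to $L_2(\Omega)$, with norm $\|\varphi\|_{W_2^1(\Omega)}^2 = \int_\Omega (|\nabla \varphi|^2 + |\varphi|^2)\,dx$. The Laplace operator of the Neumann problem in $\Omega$ is the self-adjoint operator in $L_2(\Omega)$ defined via the closed quadratic form $\int_\Omega |\nabla \varphi(x)|^2\,dx$ with domain $\varphi \in W_2^1(\Omega)$. Under the assumption that the embedding $W_2^1(\Omega) \subset L_2(\Omega)$ is compact, its spectrum consists of eigenvalues of finite multiplicity $0 = \mu_1 \leq \mu_2 \leq \mu_3 \leq \dots$, $\mu_k \to +\infty$, listed with multiplicity taken into account. An open set $\Omega \subset \mathbb{R}^d$ is called tiling if there exist sets $\Omega_j \subset \mathbb{R}^d$, $j \in \mathbb{N}$, each isometric to $\Omega$ (i.e. the image of $\Omega$ under an isometry of $\mathbb{R}^d$), such that $$ \left| \mathbb{R}^d \setminus \left(\bigcup_{j=1}^\infty \Omega_j\right)\right| = 0, \qquad \Omega_j \cap \Omega_k = \emptyset \ \text{ if } j \neq k. $$ No connectedness of $\Omega$, and no periodicity of the tiling, is assumed. *)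

theory Defs
  imports "HOL-Analysis.Analysis"
begin

text \<open>Functions are complex-valued. Elements of \<open>L\<^sub>2(\<Omega>)\<close> are represented by functions on the
  whole space of which only the values on \<open>\<Omega>\<close> matter; functions that agree almost everywhere
  on \<open>\<Omega>\<close> represent the same element.\<close>

definition L2 :: "(real^'n) set \<Rightarrow> (real^'n \<Rightarrow> complex) set" where
  "L2 \<Omega> = {u. u \<in> borel_measurable (lebesgue_on \<Omega>) \<and>
              integrable (lebesgue_on \<Omega>) (\<lambda>x. (cmod (u x))\<^sup>2)}"

definition L2_norm :: "(real^'n) set \<Rightarrow> (real^'n \<Rightarrow> complex) \<Rightarrow> real" where
  "L2_norm \<Omega> u = sqrt (LINT x|lebesgue_on \<Omega>. (cmod (u x))\<^sup>2)"

definition partial_deriv :: "'n \<Rightarrow> (real^'n \<Rightarrow> complex) \<Rightarrow> real^'n \<Rightarrow> complex" where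
  "partial_deriv i f x = frechet_derivative f (at x) (axis i 1)"

primrec continuously_diff :: "nat \<Rightarrow> (real^'n \<Rightarrow> complex) \<Rightarrow> bool" where
  "continuously_diff 0 f \<longleftrightarrow> continuous_on UNIV f"
| "continuously_diff (Suc m) f \<longleftrightarrow>
     (\<forall>x. f differentiable (at x)) \<and> (\<forall>i. continuously_diff m (partial_deriv i f))"

definition test_functions :: "(real^'n) set \<Rightarrow> (real^'n \<Rightarrow> complex) set" where
  "test_functions \<Omega> = {\<phi>. (\<forall>m. continuously_diff m \<phi>) \<and>
     compact (closure {x. \<phi> x \<noteq> 0}) \<and> closure {x. \<phi> x \<noteq> 0} \<subseteq> \<Omega>}"

definition is_weak_partial ::
    "(real^'n) set \<Rightarrow> 'n \<Rightarrow> (real^'n \<Rightarrow> complex) \<Rightarrow> (real^'n \<Rightarrow> complex) \<Rightarrow> bool" where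
  "is_weak_partial \<Omega> i u g \<longleftrightarrow>
     (\<forall>\<phi>\<in>test_functions \<Omega>.
        (LINT x|lebesgue_on \<Omega>. u x * partial_deriv i \<phi> x) = - (LINT x|lebesgue_on \<Omega>. g x * \<phi> x))"

definition W12 :: "(real^'n) set \<Rightarrow> (real^'n \<Rightarrow> complex) set" where
  "W12 \<Omega> = {u \<in> L2 \<Omega>. \<forall>i. \<exists>g\<in>L2 \<Omega>. is_weak_partial \<Omega> i u g}"

text \<open>For open \<open>\<Omega>\<close> weak derivatives are unique up to almost everywhere equality, so the choice
  below does not affect any integral.\<close>

definition weak_partial :: "(real^'n) set \<Rightarrow> 'n \<Rightarrow> (real^'n \<Rightarrow> complex) \<Rightarrow> real^'n \<Rightarrow> complex" where
  "weak_partial \<Omega> i u = (SOME g. g \<in> L2 \<Omega> \<and> is_weak_partial \<Omega> i u g)"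

definition W12_norm :: "(real^'n) set \<Rightarrow> (real^'n \<Rightarrow> complex) \<Rightarrow> real" where
  "W12_norm \<Omega> u =
     sqrt (LINT x|lebesgue_on \<Omega>. (\<Sum>i\<in>UNIV. (cmod (weak_partial \<Omega> i u x))\<^sup>2) + (cmod (u x))\<^sup>2)"

definition compact_embedding :: "(real^'n) set \<Rightarrow> bool" where
  "compact_embedding \<Omega> \<longleftrightarrow>
     (\<forall>u :: nat \<Rightarrow> real^'n \<Rightarrow> complex.
        (\<forall>m. u m \<in> W12 \<Omega>) \<and> (\<exists>C. \<forall>m. W12_norm \<Omega> (u m) \<le> C) \<longrightarrow>
        (\<exists>r v. strict_mono r \<and> v \<in> L2 \<Omega> \<and>
           (\<lambda>m. L2_norm \<Omega> (\<lambda>x. u (r m) x - v x)) \<longlonglongrightarrow> 0))"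

definition dirichlet_form ::
    "(real^'n) set \<Rightarrow> (real^'n \<Rightarrow> complex) \<Rightarrow> (real^'n \<Rightarrow> complex) \<Rightarrow> complex" where
  "dirichlet_form \<Omega> u v =
     (LINT x|lebesgue_on \<Omega>. (\<Sum>i\<in>UNIV. weak_partial \<Omega> i u x * cnj (weak_partial \<Omega> i v x)))"

text \<open>The graph of the self-adjoint operator associated with the form \<open>dirichlet_form \<Omega>\<close> with
  domain \<open>W12 \<Omega>\<close>: \<open>u\<close> belongs to the operator domain and is mapped to \<open>f\<close>.\<close>

definition neumann_laplacian ::
    "(real^'n) set \<Rightarrow> (real^'n \<Rightarrow> complex) \<Rightarrow> (real^'n \<Rightarrow> complex) \<Rightarrow> bool" where
  "neumann_laplacian \<Omega> u f \<longleftrightarrow> u \<in> W12 \<Omega> \<and> f \<in> L2 \<Omega> \<and>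
     (\<forall>v\<in>W12 \<Omega>. dirichlet_form \<Omega> u v = (LINT x|lebesgue_on \<Omega>. f x * cnj (v x)))"

definition neumann_eigenspace :: "(real^'n) set \<Rightarrow> real \<Rightarrow> (real^'n \<Rightarrow> complex) set" where
  "neumann_eigenspace \<Omega> t = {u. neumann_laplacian \<Omega> u (\<lambda>x. of_real t * u x)}"

text \<open>The complex dimension of \<open>V\<close> modulo almost everywhere equality is \<open>n\<close>.\<close>

definition has_dim_AE :: "'a measure \<Rightarrow> ('a \<Rightarrow> complex) set \<Rightarrow> nat \<Rightarrow> bool" where
  "has_dim_AE M V n \<longleftrightarrow>
     (\<exists>e :: nat \<Rightarrow> 'a \<Rightarrow> complex.
        (\<forall>i<n. e i \<in> V) \<and>
        (\<forall>c :: nat \<Rightarrow> complex. (AE x in M. (\<Sum>i<n. c i * e i x) = 0) \<longrightarrow> (\<forall>i<n. c i = 0)) \<and>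
        (\<forall>v\<in>V. \<exists>c :: nat \<Rightarrow> complex. AE x in M. v x = (\<Sum>i<n. c i * e i x)))"

text \<open>\<open>\<mu> 1 \<le> \<mu> 2 \<le> \<dots>\<close> lists the eigenvalues, each one as often as its multiplicity; the value
  \<open>\<mu> 0\<close> is irrelevant. A number \<open>t\<close> that is not an eigenvalue has an eigenspace of dimension 0,
  so it does not occur in the list.\<close>

definition enumerates_neumann_eigenvalues :: "(real^'n) set \<Rightarrow> (nat \<Rightarrow> real) \<Rightarrow> bool" where
  "enumerates_neumann_eigenvalues \<Omega> \<mu> \<longleftrightarrow>
     mono_on {1..} \<mu> \<and>
     (\<forall>t. finite {k. 1 \<le> k \<and> \<mu> k = t} \<and>
          has_dim_AE (lebesgue_on \<Omega>) (neumann_eigenspace \<Omega> t) (card {k. 1 \<le> k \<and> \<mu> k = t}))"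

text \<open>If \<open>\<Omega>\<close> is open and nonempty and the embedding is compact, such a sequence exists and is
  unique on indices \<open>k \<ge> 1\<close>. Otherwise the value may be unspecified.\<close>

definition neumann_eigenvalue :: "(real^'n) set \<Rightarrow> nat \<Rightarrow> real" where
  "neumann_eigenvalue \<Omega> = (SOME \<mu>. enumerates_neumann_eigenvalues \<Omega> \<mu>)"

definition neumann_counting :: "real \<Rightarrow> (real^'n) set \<Rightarrow> nat" where
  "neumann_counting lam \<Omega> = card {k. 1 \<le> k \<and> neumann_eigenvalue \<Omega> k < lam}"

definition isometric_copy :: "'a::metric_space set \<Rightarrow> 'a set \<Rightarrow> bool" where
  "isometric_copy A B \<longleftrightarrow> (\<exists>T. (\<forall>x y. dist (T x) (T y) = dist x y) \<and> B = T ` A)"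

definition tiling :: "(real^'n) set \<Rightarrow> bool" where
  "tiling \<Omega> \<longleftrightarrow>
     (\<exists>P :: nat \<Rightarrow> (real^'n) set.
        (\<forall>j. isometric_copy \<Omega> (P j)) \<and>
        UNIV - (\<Union>j. P j) \<in> null_sets lebesgue \<and>
        (\<forall>j k. j \<noteq> k \<longrightarrow> P j \<inter> P k = {}))"

end

theory Submission
  imports Defs "HOL-Library.Function_Algebras"
begin

text \<open>The idea is Dirichlet-Neumann bracketing. Fix a large cube of side \<open>R\<close>. If \<open>N\<close> is the number of
  Neumann eigenvalues of \<open>\<Omega>\<close> below \<open>\<lambda>\<close>, then a combination \<open>\<phi>\<close> of Dirichlet eigenfunctions of the cube,
  extended by zero, can be made orthogonal on every tile meeting the cube to the transplanted first \<open>N\<close>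
  eigenfunctions, as soon as the number of Dirichlet eigenfunctions exceeds \<open>N\<close> times the number of those
  tiles. Then \<open>\<integral> |\<nabla>\<phi>|\<^sup>2 \<ge> \<lambda> \<integral> |\<phi>|\<^sup>2\<close> on each tile, hence on the cube, which is impossible if only
  Dirichlet eigenvalues below \<open>\<lambda>\<close> were used. So \<open>N\<close> times the number of tiles bounds the number of Dirichlet
  eigenvalues below \<open>\<lambda>\<close>, which are explicit; divide by \<open>R\<^sup>n\<close> and let \<open>R\<close> tend to infinity.

  The variational principle used on the tiles comes from minimizing the Dirichlet form successively
  on orthogonal complements.\<close>

section \<open>Hermitian forms and their eigenvectors\<close>

text \<open>Origin of the constant: the Dirichlet eigenvalues of the cube are sums of
  \<open>(pi m_k / R)^2\<close>, so those below \<open>lam\<close> correspond to lattice points in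
  one orthant of a ball of radius \<open>R sqrt lam / pi\<close>, about
  \<open>2^-n \<omega> (R sqrt lam / pi)^n\<close> of them, with \<open>\<omega>\<close> the volume
  of the unit ball. The tiles number at most about \<open>R^n / |\<Omega>|\<close>. The quotient is
  the Weyl term. Tiles may stick out of the cube. The zero extension of a sine product is still
  Lipschitz, so pulling it back by the isometry of any tile gives an element of
  \<open>W12 \<Omega>\<close>, and everything is computed on \<open>\<Omega>\<close> itself. Two
  objects are fixed only by \<open>SOME\<close>. For \<open>weak_partial\<close>, linearity holds
  only almost everywhere and rests on uniqueness of weak derivatives. For
  \<open>neumann_eigenvalue\<close>, an enumeration has to be constructed before anything is known
  about the chosen one, and the estimates are then made for an arbitrary enumeration. Functions
  equal almost everywhere are not identified, so all forms are merely semidefinite.\<close>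

lemma underdetermined_system:
  fixes A :: "'i \<Rightarrow> 'j \<Rightarrow> 'f::field"
  assumes "finite I" "finite J" "card I < card J"
  shows "\<exists>c. (\<exists>j\<in>J. c j \<noteq> 0) \<and> (\<forall>i\<in>I. (\<Sum>j\<in>J. A i j * c j) = 0)"
  using assms
proof (induction I arbitrary: A J rule: finite_induct)
  case empty
  then have "J \<noteq> {}" by auto
  then show ?case by (intro exI[of _ "\<lambda>_. 1"]) auto
next
  case (insert i0 I)
  show ?case
  proof (cases "\<forall>j\<in>J. A i0 j = 0")
    case True
    have "card I < card J" using insert by auto
    from insert.IH[OF insert.prems(1) this, of A] obtain c where
      c: "\<exists>j\<in>J. c j \<noteq> 0" "\<forall>i\<in>I. (\<Sum>j\<in>J. A i j * c j) = 0" by blast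
    have "(\<Sum>j\<in>J. A i0 j * c j) = 0" using True by simp
    with c show ?thesis by (intro exI[of _ c]) auto
  next
    case False
    then obtain j0 where j0: "j0 \<in> J" "A i0 j0 \<noteq> 0" by blast
    define J' where "J' = J - {j0}"
    have J': "finite J'" "card I < card J'"
      using insert j0 by (auto simp: J'_def card_Diff_singleton)
    \<comment> \<open>Gaussian elimination with pivot \<open>A i0 j0\<close>: row \<open>i0\<close>
      clears column \<open>j0\<close> from the other rows. The value of \<open>c\<close> at
      \<open>j0\<close> below is the back substitution that satisfies row \<open>i0\<close>.\<close>
    define A' where "A' = (\<lambda>i j. A i j - A i j0 * A i0 j / A i0 j0)"
    from insert.IH[OF J', of A'] obtain c' where
      c': "\<exists>j\<in>J'. c' j \<noteq> 0" "\<forall>i\<in>I. (\<Sum>j\<in>J'. A' i j * c' j) = 0" by blast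
    define s where "s = (\<Sum>j\<in>J'. A i0 j * c' j)"
    define c where "c = (\<lambda>j. if j = j0 then - s / A i0 j0 else c' j)"
    have split: "(\<Sum>j\<in>J. A i j * c j) = (\<Sum>j\<in>J'. A i j * c' j) - A i j0 * s / A i0 j0" for i
    proof -
      have "(\<Sum>j\<in>J. A i j * c j) = A i j0 * c j0 + (\<Sum>j\<in>J'. A i j * c j)"
        using j0 insert.prems(1) by (simp add: J'_def sum.remove)
      moreover have "(\<Sum>j\<in>J'. A i j * c j) = (\<Sum>j\<in>J'. A i j * c' j)"
        by (rule sum.cong) (auto simp: J'_def c_def)
      ultimately show ?thesis by (simp add: c_def)
    qed
    have "(\<Sum>j\<in>J. A i j * c j) = 0" if "i \<in> I" for i
    proof -
      have "0 = (\<Sum>j\<in>J'. A i j * c' j - A i j0 / A i0 j0 * (A i0 j * c' j))"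
        using bspec[OF c'(2) that] by (simp add: A'_def left_diff_distrib mult.assoc)
      also have "\<dots> = (\<Sum>j\<in>J'. A i j * c' j) - A i j0 / A i0 j0 * s"
        by (simp add: sum_subtractf sum_distrib_left s_def)
      finally show ?thesis by (simp add: split)
    qed
    moreover have "(\<Sum>j\<in>J. A i0 j * c j) = 0"
      using j0 by (simp add: split s_def[symmetric])
    moreover have "\<exists>j\<in>J. c j \<noteq> 0" using c'(1) by (auto simp: J'_def c_def)
    ultimately show ?thesis by (intro exI[of _ c]) auto
  qed
qed

text \<open>Semidefiniteness is deliberate: null functions have square zero in \<open>L2\<close>,
  and constants have Dirichlet energy zero. The same locale thus covers the \<open>L2\<close>
  product, the Dirichlet form and the difference form in the Euler-Lagrange argument. Only linearity
  in the first argument is assumed; the second follows from Hermitian symmetry.\<close>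

locale hermitian_form = vector_space scale
  for scale :: "complex \<Rightarrow> 'v::ab_group_add \<Rightarrow> 'v" +
  fixes V :: "'v set" and f :: "'v \<Rightarrow> 'v \<Rightarrow> complex"
  assumes V: "subspace V"
    and form_add: "\<lbrakk>u \<in> V; v \<in> V; w \<in> V\<rbrakk> \<Longrightarrow> f (u + v) w = f u w + f v w"
    and form_scale: "\<lbrakk>u \<in> V; w \<in> V\<rbrakk> \<Longrightarrow> f (scale c u) w = c * f u w"
    and form_herm: "\<lbrakk>u \<in> V; v \<in> V\<rbrakk> \<Longrightarrow> f v u = cnj (f u v)"
    and form_nonneg: "u \<in> V \<Longrightarrow> 0 \<le> Re (f u u)"
begin

abbreviation sq :: "'v \<Rightarrow> real" where "sq u \<equiv> Re (f u u)"

lemma V_closed [simp, intro]: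
  "0 \<in> V" "\<lbrakk>u \<in> V; v \<in> V\<rbrakk> \<Longrightarrow> u + v \<in> V" "u \<in> V \<Longrightarrow> scale c u \<in> V"
  "\<lbrakk>u \<in> V; v \<in> V\<rbrakk> \<Longrightarrow> u - v \<in> V" "u \<in> V \<Longrightarrow> - u \<in> V"
  using V by (auto simp: subspace_0 subspace_add subspace_scale subspace_diff subspace_neg)

lemma V_sum [intro]: "(\<And>i. i \<in> I \<Longrightarrow> u i \<in> V) \<Longrightarrow> sum u I \<in> V"
  by (rule subspace_sum[OF V])

lemma form_diff: "\<lbrakk>u \<in> V; v \<in> V; w \<in> V\<rbrakk> \<Longrightarrow> f (u - v) w = f u w - f v w"
  using form_add[of "u - v" v w] by auto

lemma form_zero: "w \<in> V \<Longrightarrow> f 0 w = 0"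
  using form_diff[of w w w] by simp

lemma form_add_right: "\<lbrakk>u \<in> V; v \<in> V; w \<in> V\<rbrakk> \<Longrightarrow> f w (u + v) = f w u + f w v"
  using form_herm[of "u + v" w] form_herm[of u w] form_herm[of v w] form_add[of u v w] by simp

lemma form_diff_right: "\<lbrakk>u \<in> V; v \<in> V; w \<in> V\<rbrakk> \<Longrightarrow> f w (u - v) = f w u - f w v"
  using form_herm[of "u - v" w] form_herm[of u w] form_herm[of v w] form_diff[of u v w] by simp

lemma form_scale_right: "\<lbrakk>u \<in> V; w \<in> V\<rbrakk> \<Longrightarrow> f w (scale c u) = cnj c * f w u"
  using form_herm[of "scale c u" w] form_herm[of u w] form_scale[of u w c] by simp

lemma form_sum:
  assumes "w \<in> V" "\<And>i. i \<in> I \<Longrightarrow> u i \<in> V"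
  shows "f (sum u I) w = (\<Sum>i\<in>I. f (u i) w)"
  using assms(2)
proof (induction I rule: infinite_finite_induct)
  case (insert i I)
  then have "f (u i + sum u I) w = f (u i) w + f (sum u I) w"
    using assms(1) by (intro form_add) auto
  then show ?case using insert by simp
qed (auto simp: form_zero assms(1))

lemma form_sum_right:
  assumes "w \<in> V" "\<And>i. i \<in> I \<Longrightarrow> u i \<in> V"
  shows "f w (sum u I) = (\<Sum>i\<in>I. f w (u i))"
proof -
  have "f w (sum u I) = cnj (f (sum u I) w)" using assms by (intro form_herm) auto
  also have "\<dots> = (\<Sum>i\<in>I. cnj (f (u i) w))" using assms by (simp add: form_sum)
  also have "\<dots> = (\<Sum>i\<in>I. f w (u i))" using assms by (intro sum.cong refl form_herm[symmetric]) auto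
  finally show ?thesis .
qed

lemma Im_form_same: "u \<in> V \<Longrightarrow> Im (f u u) = 0"
  using form_herm[of u u] by (simp add: complex_eq_iff)

lemma form_same: "u \<in> V \<Longrightarrow> f u u = of_real (sq u)"
  by (simp add: complex_eq_iff Im_form_same)

lemma Re_form_commute: "\<lbrakk>u \<in> V; v \<in> V\<rbrakk> \<Longrightarrow> Re (f v u) = Re (f u v)"
  using form_herm[of u v] by simp

text \<open>The square of \<open>u - c v\<close> is nonnegative for every \<open>c\<close>. As the
  form may be degenerate, \<open>sq v = 0\<close> is a separate case, where the expansion is affine
  in \<open>c\<close> and can be nonnegative for all \<open>c\<close> only if \<open>f u v\<close>
  vanishes.\<close>

lemma Cauchy_Schwarz:
  assumes u: "u \<in> V" and v: "v \<in> V"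
  shows "(cmod (f u v))\<^sup>2 \<le> sq u * sq v"
proof -
  define A B z where "A = sq u" and "B = sq v" and "z = f u v"
  have expand: "0 \<le> A - 2 * Re (cnj c * z) + (cmod c)\<^sup>2 * B" for c
  proof -
    have "0 \<le> sq (u - scale c v)" using u v by (intro form_nonneg) auto
    also have "f (u - scale c v) (u - scale c v)
        = f u u - cnj c * z - c * cnj z + c * cnj c * f v v"
      using u v form_herm[OF u v]
      by (simp add: form_diff form_diff_right form_scale form_scale_right z_def algebra_simps)
    also have "Re \<dots> = A - 2 * Re (cnj c * z) + (cmod c)\<^sup>2 * B"
      using Im_form_same[OF v]
      by (simp add: A_def B_def complex_norm_square[symmetric] cmod_power2 power2_eq_square
          algebra_simps)
    finally show ?thesis .
  qed
  show ?thesis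
  proof (cases "B = 0")
    case True
    have "z = 0"
    proof (rule ccontr)
      assume "z \<noteq> 0"
      \<comment> \<open>Chosen so that the expansion takes the value
        \<open>A - (A + 1) = -1\<close>.\<close>
      define t where "t = (A + 1) / (2 * (cmod z)\<^sup>2)"
      have "Re (cnj (of_real t * z) * z) = t * (cmod z)\<^sup>2"
        unfolding cmod_power2 by (simp add: power2_eq_square algebra_simps)
      then have "0 \<le> A - 2 * (t * (cmod z)\<^sup>2)" using expand[of "of_real t * z"] True by simp
      then show False using \<open>z \<noteq> 0\<close> by (simp add: t_def)
    qed
    then show ?thesis using True by (simp add: z_def B_def)
  next
    case False
    then have B: "B > 0" using form_nonneg[OF v] by (simp add: B_def)
    \<comment> \<open>\<open>c = z / B\<close> is the coefficient of the projection of
      \<open>u\<close> on \<open>v\<close>, the minimizer of the expansion.\<close>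
    have "Re (cnj (z / of_real B) * z) = (cmod z)\<^sup>2 / B"
      unfolding cmod_power2 by (simp add: power2_eq_square add_divide_distrib)
    moreover have "(cmod (z / of_real B))\<^sup>2 * B = (cmod z)\<^sup>2 / B"
      using B by (simp add: norm_divide power2_eq_square)
    ultimately have "0 \<le> A - 2 * ((cmod z)\<^sup>2 / B) + (cmod z)\<^sup>2 / B"
      using expand[of "z / of_real B"] by metis
    then show ?thesis using B by (simp add: field_simps A_def B_def z_def)
  qed
qed

text \<open>The substitute for definiteness: vectors of square zero lie in the kernel of the whole
  form. Applied to \<open>a - \<mu> b\<close> it produces eigenvectors, applied to \<open>L2\<close>
  it discards null functions.\<close>

lemma form_eq_0:
  assumes "u \<in> V" "v \<in> V" "sq u = 0"
  shows "f u v = 0"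
  using Cauchy_Schwarz[of u v] assms by simp

lemma parallelogram:
  assumes "u \<in> V" "v \<in> V"
  shows "sq (u - v) = 2 * sq u + 2 * sq v - sq (u + v)"
  using assms by (simp add: form_add form_diff form_add_right form_diff_right)

lemma form_tendsto:
  assumes u: "\<And>m. u m \<in> V" and w: "w \<in> V" and v: "v \<in> V"
    and lim: "(\<lambda>m. sq (u m - w)) \<longlonglongrightarrow> 0"
  shows "(\<lambda>m. f (u m) v) \<longlonglongrightarrow> f w v"
proof -
  have "(\<lambda>m. sqrt (sq (u m - w) * sq v)) \<longlonglongrightarrow> sqrt (0 * sq v)"
    by (intro tendsto_intros lim)
  then have *: "(\<lambda>m. sqrt (sq (u m - w) * sq v)) \<longlonglongrightarrow> 0" by simp
  have "(\<lambda>m. f (u m - w) v) \<longlonglongrightarrow> 0"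
    by (rule Lim_null_comparison[OF _ *])
       (use u w v in \<open>auto intro!: always_eventually real_le_rsqrt Cauchy_Schwarz\<close>)
  then have "(\<lambda>m. f (u m) v - f w v) \<longlonglongrightarrow> 0" using u w v by (simp add: form_diff)
  then show ?thesis by (rule LIM_zero_cancel)
qed

lemma form_same_tendsto:
  assumes u: "\<And>m. u m \<in> V" and w: "w \<in> V"
    and lim: "(\<lambda>m. sq (u m - w)) \<longlonglongrightarrow> 0"
  shows "(\<lambda>m. sq (u m)) \<longlonglongrightarrow> sq w"
proof -
  have eq: "sq (u m) = sq (u m - w) + 2 * Re (f (u m) w) - sq w" for m
    using u[of m] w Re_form_commute[of w "u m"] by (simp add: form_diff form_diff_right)
  have "(\<lambda>m. sq (u m - w) + 2 * Re (f (u m) w) - sq w)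
      \<longlonglongrightarrow> 0 + 2 * sq w - sq w"
    by (intro tendsto_intros lim form_tendsto[OF u w w lim])
  then show ?thesis by (simp add: eq)
qed

end

text \<open>The abstract Neumann problem: \<open>a\<close> is the energy and \<open>b\<close> the
  \<open>L2\<close> product. Compactness is phrased through Cauchy subsequences because the
  \<open>L2\<close> limit need not lie in \<open>V\<close>; membership in \<open>V\<close> comes
  from completeness in the norm of \<open>a + b\<close>. The third assumption keeps the successive
  minimization from running out of vectors.\<close>

locale compact_form_pair = a: hermitian_form scale V a + b: hermitian_form scale V b
  for scale :: "complex \<Rightarrow> 'v::ab_group_add \<Rightarrow> 'v" and V a b +
  assumes compact:
    "\<lbrakk>\<And>m. u m \<in> V; \<And>m. a.sq (u m) + b.sq (u m) \<le> C\<rbrakk> \<Longrightarrow>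
       \<exists>r :: nat \<Rightarrow> nat. strict_mono r \<and>
         (\<forall>\<epsilon>>0. \<exists>N. \<forall>m\<ge>N. \<forall>l\<ge>N. b.sq (u (r m) - u (r l)) < \<epsilon>)"
    and complete:
    "\<lbrakk>\<And>m. u m \<in> V;
      \<And>\<epsilon>. \<epsilon> > 0 \<Longrightarrow> \<exists>N. \<forall>m\<ge>N. \<forall>l\<ge>N. a.sq (u m - u l) + b.sq (u m - u l) < \<epsilon>\<rbrakk> \<Longrightarrow>
       \<exists>w\<in>V. (\<lambda>m. a.sq (u m - w) + b.sq (u m - w)) \<longlonglongrightarrow> 0"
    and infinite_dimension:
    "\<lbrakk>finite S; S \<subseteq> V\<rbrakk> \<Longrightarrow> \<exists>v\<in>V. b.sq v \<noteq> 0 \<and> (\<forall>e\<in>S. b v e = 0)"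
begin

text \<open>A normalized minimizer of the Rayleigh quotient \<open>a / b\<close> on the
  \<open>b\<close>-complement of \<open>S\<close>. The inequality avoids division, since
  \<open>b.sq v\<close> may be zero for nonzero \<open>v\<close>.\<close>

definition minimizer :: "'v set \<Rightarrow> 'v \<Rightarrow> bool" where
  "minimizer S w \<longleftrightarrow> w \<in> V \<and> b.sq w = 1 \<and> (\<forall>e\<in>S. b w e = 0) \<and>
     (\<forall>v\<in>V. (\<forall>e\<in>S. b v e = 0) \<longrightarrow> a.sq w * b.sq v \<le> a.sq v)"

text \<open>The parallelogram identity turns \<open>b\<close>-convergence of a minimizing sequence into
  \<open>a\<close>-convergence.\<close>

lemma minimizer_exists:
  assumes S: "finite S" "S \<subseteq> V"
  shows "\<exists>w. minimizer S w"
proof -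
  define q n where "q = (\<lambda>u. a.sq u)" and "n = (\<lambda>u. b.sq u)"
  define E where "E = {v \<in> V. \<forall>e\<in>S. b v e = 0}"
  have EV: "v \<in> V" if "v \<in> E" for v using that by (simp add: E_def)
  have E_add: "u + v \<in> E" if "u \<in> E" "v \<in> E" for u v
    using that S by (auto simp: E_def b.form_add subset_iff)
  have E_scale: "scale c u \<in> E" if "u \<in> E" for u c
    using that S by (auto simp: E_def b.form_scale subset_iff)
  have q_scale: "q (scale (of_real c) u) = c\<^sup>2 * q u" and n_scale: "n (scale (of_real c) u) = c\<^sup>2 * n u"
    if "u \<in> V" for c u
    using that by (simp_all add: q_def n_def a.form_scale a.form_scale_right b.form_scale
        b.form_scale_right power2_eq_square)
  have q0: "0 \<le> q u" and n0: "0 \<le> n u" if "u \<in> V" for u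
    using that by (simp_all add: q_def n_def a.form_nonneg b.form_nonneg)
  have normalize: "\<exists>c. c\<^sup>2 * n v = 1 \<and> n (scale (of_real c) v) = 1 \<and> q (scale (of_real c) v) = q v / n v"
    if "v \<in> V" "n v \<noteq> 0" for v
  proof -
    have "n v > 0" using that n0[of v] by simp
    then have "(1 / sqrt (n v))\<^sup>2 = 1 / n v" by (simp add: power_divide)
    then show ?thesis using that \<open>n v > 0\<close>
      by (intro exI[of _ "1 / sqrt (n v)"]) (simp only: q_scale n_scale, simp)
  qed
  define X where "X = q ` {v \<in> E. n v = 1}"
  define \<mu> where "\<mu> = Inf X"
  have "\<exists>v\<in>E. n v \<noteq> 0" using infinite_dimension[OF S] by (auto simp: E_def n_def)
  then obtain v0 where v0: "v0 \<in> E" "n v0 \<noteq> 0" by blast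
  have X_ne: "X \<noteq> {}"
    using normalize[OF EV[OF v0(1)] v0(2)] E_scale[OF v0(1)] by (auto simp: X_def)
  have X_bdd: "bdd_below X"
    by (rule bdd_belowI[of _ 0]) (auto simp: X_def intro!: q0 EV)
  have lower: "\<mu> * n v \<le> q v" if "v \<in> E" for v
  proof (cases "n v = 0")
    case False
    then obtain c where c: "n (scale (of_real c) v) = 1" "q (scale (of_real c) v) = q v / n v"
      using normalize EV[OF \<open>v \<in> E\<close>] by blast
    then have "q v / n v \<in> X" using E_scale[OF \<open>v \<in> E\<close>] by (auto simp: X_def intro!: image_eqI)
    then have "\<mu> \<le> q v / n v" unfolding \<mu>_def by (rule cInf_lower[OF _ X_bdd])
    moreover have "n v > 0" using False n0[OF EV[OF \<open>v \<in> E\<close>]] by simp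
    ultimately show ?thesis by (simp add: field_simps)
  qed (use q0[OF EV[OF that]] in simp)
  have "\<exists>u. u \<in> E \<and> n u = 1 \<and> q u < \<mu> + inverse (real (Suc m))" for m
  proof -
    have "Inf X < \<mu> + inverse (real (Suc m))" by (simp add: \<mu>_def)
    then obtain x where "x \<in> X" "x < \<mu> + inverse (real (Suc m))"
      using cInf_lessD[OF X_ne] by blast
    then show ?thesis by (auto simp: X_def)
  qed
  then obtain u where u: "\<And>m. u m \<in> E" "\<And>m. n (u m) = 1"
    "\<And>m. q (u m) < \<mu> + inverse (real (Suc m))" by metis
  have uV: "u m \<in> V" for m using u(1) EV by blast
  have "q (u m) + n (u m) \<le> \<mu> + 2" for m
  proof -
    have "inverse (real (Suc m)) \<le> 1" by (simp add: inverse_le_1_iff)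
    then show ?thesis using u(2)[of m] u(3)[of m] by linarith
  qed
  then have "\<exists>r :: nat \<Rightarrow> nat. strict_mono r \<and>
      (\<forall>\<epsilon>>0. \<exists>N. \<forall>m\<ge>N. \<forall>l\<ge>N. n (u (r m) - u (r l)) < \<epsilon>)"
    unfolding q_def n_def by (intro compact[of u "\<mu> + 2"] uV)
  then obtain r :: "nat \<Rightarrow> nat" where r: "strict_mono r" and
    rC: "\<And>\<epsilon>. \<epsilon> > 0 \<Longrightarrow> \<exists>N. \<forall>m\<ge>N. \<forall>l\<ge>N. n (u (r m) - u (r l)) < \<epsilon>"
    by blast
  define w where "w = u \<circ> r"
  have w: "w m \<in> E" "w m \<in> V" "n (w m) = 1" for m using u uV by (auto simp: w_def)
  have qw: "q (w m) < \<mu> + inverse (real (Suc m))" for m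
  proof -
    have "m \<le> r m" using r by (simp add: seq_suble)
    then have "inverse (real (Suc (r m))) \<le> inverse (real (Suc m))"
      by (intro le_imp_inverse_le) auto
    then show ?thesis using u(3)[of "r m"] unfolding w_def comp_def by linarith
  qed
  \<comment> \<open>The sum \<open>w m + w l\<close> also satisfies the constraints, so its energy
    is at least \<open>\<mu>\<close> times its square, which is \<open>4 - n (w m - w l)\<close>.
    The terms \<open>4 * \<mu>\<close> cancel, and only the minimization errors and a multiple of
    the \<open>b\<close>-distance remain.\<close>
  have qdiff: "q (w m - w l) \<le> 2 * inverse (real (Suc m)) + 2 * inverse (real (Suc l)) + \<mu> * n (w m - w l)" for m l
  proof -
    have "q (w m - w l) = 2 * q (w m) + 2 * q (w l) - q (w m + w l)"
      unfolding q_def by (rule a.parallelogram) (use w in auto)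
    moreover have "n (w m + w l) = 4 - n (w m - w l)"
      using b.parallelogram[of "w m" "w l"] w(2) w(3)[of m] w(3)[of l] by (simp add: n_def)
    moreover have "\<mu> * n (w m + w l) \<le> q (w m + w l)" by (intro lower E_add w)
    ultimately have "q (w m - w l) \<le> 2 * q (w m) + 2 * q (w l) - \<mu> * (4 - n (w m - w l))" by simp
    then show ?thesis using qw[of m] qw[of l] by (simp add: algebra_simps)
  qed
  have \<mu>0: "\<mu> \<ge> 0" unfolding \<mu>_def
    by (rule cInf_greatest[OF X_ne]) (auto simp: X_def intro!: q0 EV)
  have "\<exists>N. \<forall>m\<ge>N. \<forall>l\<ge>N. q (w m - w l) + n (w m - w l) < \<epsilon>" if "\<epsilon> > 0" for \<epsilon>
  proof -
    \<comment> \<open>Half of \<open>\<epsilon>\<close> is reserved for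
      \<open>(\<mu> + 1) * n (w m - w l)\<close>, the other half for the two errors
      \<open>2 * inverse ...\<close>, each below \<open>\<epsilon> / 4\<close>.\<close>
    define \<delta> where "\<delta> = \<epsilon> / (2 * (\<mu> + 1))"
    have "\<delta> > 0" using that \<mu>0 by (simp add: \<delta>_def)
    then obtain N where N: "\<forall>m\<ge>N. \<forall>l\<ge>N. n (w m - w l) < \<delta>"
      using rC[OF \<open>\<delta> > 0\<close>] unfolding w_def comp_def by blast
    obtain N' where N': "inverse (real (Suc N')) < \<epsilon> / 8"
      using reals_Archimedean[of "\<epsilon> / 8"] \<open>\<epsilon> > 0\<close> by fastforce
    have small: "inverse (real (Suc j)) < \<epsilon> / 8" if "j \<ge> N'" for j
      by (rule order.strict_trans1[OF le_imp_inverse_le N']) (use that in auto)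
    have "q (w m - w l) + n (w m - w l) < \<epsilon>" if "m \<ge> max N N'" "l \<ge> max N N'" for m l
    proof -
      have "inverse (real (Suc m)) < \<epsilon> / 8" "inverse (real (Suc l)) < \<epsilon> / 8"
        using that by (intro small; simp)+
      moreover have "(\<mu> + 1) * n (w m - w l) < (\<mu> + 1) * \<delta>"
        using N that \<mu>0 by (intro mult_strict_left_mono) auto
      moreover have "(\<mu> + 1) * \<delta> = \<epsilon> / 2" using \<mu>0 by (simp add: \<delta>_def field_simps)
      ultimately show ?thesis using qdiff[of m l] by (simp add: algebra_simps)
    qed
    then show ?thesis by blast
  qed
  then obtain z where z: "z \<in> V" and lim: "(\<lambda>m. q (w m - z) + n (w m - z)) \<longlonglongrightarrow> 0"
    using complete[of w, OF w(2)] unfolding q_def n_def by blast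
  have wz: "0 \<le> q (w m - z)" "0 \<le> n (w m - z)" for m
    using q0[of "w m - z"] n0[of "w m - z"] w(2) z by auto
  have limq: "(\<lambda>m. q (w m - z)) \<longlonglongrightarrow> 0"
    by (rule Lim_null_comparison[OF _ lim]) (simp add: wz)
  have limn: "(\<lambda>m. n (w m - z)) \<longlonglongrightarrow> 0"
    by (rule Lim_null_comparison[OF _ lim]) (simp add: wz)
  have "(\<lambda>m. n (w m)) \<longlonglongrightarrow> n z"
    using b.form_same_tendsto[of w z, OF w(2) z] limn unfolding n_def by blast
  then have nz: "n z = 1" using w(3) by (simp add: LIMSEQ_const_iff)
  have limqz: "(\<lambda>m. q (w m)) \<longlonglongrightarrow> q z"
    using a.form_same_tendsto[of w z, OF w(2) z] limq unfolding q_def by blast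
  have "(\<lambda>m. \<mu> + inverse (real (Suc m))) \<longlonglongrightarrow> \<mu> + 0"
    by (intro tendsto_intros LIMSEQ_inverse_real_of_nat)
  then have "q z \<le> \<mu> + 0"
    by (rule LIMSEQ_le[OF limqz]) (use qw less_imp_le in blast)
  then have "q z \<le> \<mu>" by simp
  have "b z e = 0" if "e \<in> S" for e
  proof -
    have "(\<lambda>m. b (w m) e) \<longlonglongrightarrow> b z e"
      using b.form_tendsto[of w z e, OF w(2) z] limn that S unfolding n_def by blast
    moreover have "b (w m) e = 0" for m using w(1)[of m] that by (simp add: E_def)
    ultimately show ?thesis by (simp add: LIMSEQ_const_iff)
  qed
  then have "z \<in> E" using z by (simp add: E_def)
  have "q z * n v \<le> q v" if "v \<in> E" for v
  proof -
    have "q z * n v \<le> \<mu> * n v" using \<open>q z \<le> \<mu>\<close> n0[OF EV[OF that]] by (rule mult_right_mono)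
    then show ?thesis using lower[OF that] by linarith
  qed
  then have "minimizer S z"
    using \<open>z \<in> E\<close> nz by (auto simp: minimizer_def E_def q_def n_def)
  then show ?thesis ..
qed

text \<open>Well-founded dependent choice: the condition on \<open>e k\<close> involves only earlier
  values, which is the congruence condition in the first goal.\<close>

lemma minimizer_sequence: "\<exists>e. \<forall>k. minimizer (e ` {..<k}) (e (k::nat))"
proof (rule dependent_wf_choice[OF wf_less_than])
  fix f g :: "nat \<Rightarrow> 'v" and x r assume "\<And>z. (z, x) \<in> less_than \<Longrightarrow> f z = g z"
  then have "f ` {..<x} = g ` {..<x}" by (intro image_cong) auto
  then show "minimizer (f ` {..<x}) r = minimizer (g ` {..<x}) r" by simp
next
  fix x f assume "\<And>y. (y, x) \<in> less_than \<Longrightarrow> minimizer (f ` {..<y}) (f y)"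
  then have "f ` {..<x} \<subseteq> V" by (auto simp: minimizer_def)
  then show "\<exists>r. minimizer (f ` {..<x}) r" by (intro minimizer_exists) auto
qed

text \<open>On the orthogonal complement of \<open>S\<close> the form \<open>a - \<mu> b\<close> is nonnegative and vanishes at
  the minimizer, so the Cauchy-Schwarz inequality gives the Euler-Lagrange equation.\<close>

lemma minimizer_euler_lagrange:
  assumes S: "S \<subseteq> V" and w: "minimizer S w" and v: "v \<in> V" "\<forall>e\<in>S. b v e = 0"
  shows "a w v = of_real (a.sq w) * b w v"
proof -
  define \<mu> where "\<mu> = a.sq w"
  define E where "E = {v \<in> V. \<forall>e\<in>S. b v e = 0}"
  have sub: "e \<in> V" if "e \<in> S" for e using S that by blast
  interpret c: hermitian_form scale E "\<lambda>u v. a u v - of_real \<mu> * b u v"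
  proof
    show "a.subspace E"
      unfolding a.subspace_def
      by (auto simp: E_def b.form_add b.form_scale b.form_zero sub)
  next
    fix u v assume "u \<in> E" "v \<in> E"
    then have "u \<in> V" "v \<in> V" by (auto simp: E_def)
    then show "a v u - complex_of_real \<mu> * b v u = cnj (a u v - complex_of_real \<mu> * b u v)"
      using a.form_herm[of u v] b.form_herm[of u v] by simp
  qed (use w in \<open>auto simp: E_def a.form_add a.form_scale b.form_add b.form_scale algebra_simps
        minimizer_def \<mu>_def\<close>)
  have "w \<in> E" "v \<in> E" using w v by (auto simp: E_def minimizer_def)
  moreover have "Re (a w w - of_real \<mu> * b w w) = 0" using w by (simp add: minimizer_def \<mu>_def)
  ultimately have "a w v - of_real \<mu> * b w v = 0" by (rule c.form_eq_0)
  then show ?thesis by (simp add: \<mu>_def)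
qed

text \<open>Indices start at 0. The last clause is the variational characterization; it stands in
  for completeness of the eigenvectors, which is never stated.\<close>

definition eigensequence :: "(nat \<Rightarrow> 'v) \<Rightarrow> (nat \<Rightarrow> real) \<Rightarrow> bool" where
  "eigensequence e \<mu> \<longleftrightarrow> (\<forall>k. e k \<in> V) \<and> (\<forall>j k. b (e j) (e k) = (if j = k then 1 else 0)) \<and> mono \<mu> \<and>
     (\<forall>k. \<forall>v\<in>V. a (e k) v = of_real (\<mu> k) * b (e k) v) \<and> (\<forall>t. finite {k. \<mu> k < t}) \<and>
     (\<forall>k. \<forall>v\<in>V. (\<forall>i<k. b v (e i) = 0) \<longrightarrow> \<mu> k * b.sq v \<le> a.sq v)"

text \<open>The Euler-Lagrange equation is available only against vectors orthogonal to the earlier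
  minimizers. An induction removes this restriction, and compactness forces the eigenvalues to
  infinity.\<close>

theorem eigensequence_exists: "\<exists>e \<mu>. eigensequence e \<mu>"
proof -
  obtain e where e: "\<And>k. minimizer (e ` {..<k}) (e (k::nat))" using minimizer_sequence by blast
  define \<mu> where "\<mu> = (\<lambda>k. a.sq (e k))"
  have eV: "e k \<in> V" for k using e[of k] by (simp add: minimizer_def)
  have ort: "b (e j) (e k) = (if j = k then 1 else 0)" for j k
  proof -
    have less: "b (e j) (e k) = 0" if "k < j" for j k
      using e[of j] that by (auto simp: minimizer_def)
    have "b (e k) (e k) = 1" using e[of k] b.form_same[OF eV[of k]] by (simp add: minimizer_def)
    moreover have "b (e j) (e k) = 0" if "j < k"
      using less[OF that] b.form_herm[of "e k" "e j"] eV by simp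
    ultimately show ?thesis using less[of k j] by (cases j k rule: linorder_cases) auto
  qed
  have lower: "\<mu> k * b.sq v \<le> a.sq v"
    if "v \<in> V" "\<And>i. i < k \<Longrightarrow> b v (e i) = 0" for k v
    using e[of k] that by (auto simp: minimizer_def \<mu>_def)
  have mono: "mono \<mu>"
  proof (rule monoI)
    fix j k :: nat assume "j \<le> k"
    then have "\<mu> j * b.sq (e k) \<le> a.sq (e k)" by (intro lower eV) (simp add: ort)
    then show "\<mu> j \<le> \<mu> k" by (simp add: ort \<mu>_def)
  qed
  have eig: "\<forall>v\<in>V. a (e k) v = of_real (\<mu> k) * b (e k) v" for k
  proof (induction k rule: less_induct)
    case (less k)
    show ?case
    proof
      fix v assume v: "v \<in> V"
      define p where "p = (\<Sum>i<k. scale (b v (e i)) (e i))"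
      have p: "p \<in> V" unfolding p_def using eV by auto
      have "b p (e j) = b v (e j)" if "j < k" for j
      proof -
        have "b p (e j) = (\<Sum>i<k. b v (e i) * b (e i) (e j))"
          unfolding p_def using eV by (subst b.form_sum) (auto simp: b.form_scale)
        also have "\<dots> = (\<Sum>i<k. if i = j then b v (e j) else 0)"
          by (rule sum.cong) (auto simp: ort)
        also have "\<dots> = b v (e j)" using that by simp
        finally show ?thesis .
      qed
      then have orth: "\<forall>x\<in>e ` {..<k}. b (v - p) x = 0" using v p eV by (auto simp: b.form_diff)
      have "a (e k) (v - p) = of_real (\<mu> k) * b (e k) (v - p)"
        unfolding \<mu>_def by (rule minimizer_euler_lagrange[OF _ e _ orth]) (use eV v p in auto)
      \<comment> \<open>The earlier \<open>e i\<close> are eigenvectors by induction, so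
        orthogonality to them in \<open>b\<close> gives orthogonality in \<open>a\<close>. The part
        of \<open>v\<close> along them then contributes nothing to either side.\<close>
      moreover have "a (e k) p = 0" "b (e k) p = 0"
      proof -
        have "a (e k) (e i) = 0" if "i < k" for i
          using less.IH[OF that] eV[of k] a.form_herm[of "e i" "e k"] eV[of i] ort[of i k] that by simp
        then show "a (e k) p = 0" "b (e k) p = 0"
          unfolding p_def using eV
          by (auto simp: a.form_sum_right b.form_sum_right a.form_scale_right b.form_scale_right ort)
      qed
      ultimately show "a (e k) v = of_real (\<mu> k) * b (e k) v"
        using v p eV by (simp add: a.form_diff_right b.form_diff_right)
    qed
  qed
  \<comment> \<open>Otherwise all of the orthonormal \<open>e k\<close> have bounded energy, yet any
    two distinct ones are at squared \<open>b\<close>-distance 2, so no subsequence is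
    Cauchy.\<close>
  have fin: "finite {k. \<mu> k < t}" for t
  proof (rule ccontr)
    assume inf: "infinite {k. \<mu> k < t}"
    have bound: "\<mu> k \<le> t" for k
    proof -
      obtain l where "l > k" "\<mu> l < t" using inf by (auto simp: infinite_nat_iff_unbounded)
      then show ?thesis using monoD[OF mono, of k l] by simp
    qed
    have "a.sq (e m) + b.sq (e m) \<le> t + 1" for m
      using bound[of m] by (simp add: ort \<mu>_def)
    then obtain r :: "nat \<Rightarrow> nat" where r: "strict_mono r" and
      "\<forall>\<epsilon>>0. \<exists>N. \<forall>m\<ge>N. \<forall>l\<ge>N. b.sq (e (r m) - e (r l)) < \<epsilon>"
      using compact[of e "t + 1"] eV by blast
    then obtain N where N: "\<forall>m\<ge>N. \<forall>l\<ge>N. b.sq (e (r m) - e (r l)) < 1"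
      by (meson zero_less_one)
    have "r (Suc N) \<noteq> r N" using r by (simp add: strict_mono_eq)
    moreover have "b.sq (e (r (Suc N)) - e (r N)) < 1"
      using N by (meson le_SucI order_refl)
    ultimately show False using eV by (simp add: b.form_diff b.form_diff_right ort)
  qed
  have "eigensequence e \<mu>"
    unfolding eigensequence_def using eV ort mono eig fin lower by blast
  then show ?thesis by blast
qed

section \<open>Consequences for a given eigensequence\<close>

context
  fixes e :: "nat \<Rightarrow> 'v" and \<mu> :: "nat \<Rightarrow> real"
  assumes e\<mu>: "eigensequence e \<mu>"
begin

lemma eigensequence_props:
  shows eV: "e k \<in> V" and orthonormal: "b (e j) (e k) = (if j = k then 1 else 0)" and mono_eigenvalues: "mono \<mu>"
    and eigenvector: "v \<in> V \<Longrightarrow> a (e k) v = of_real (\<mu> k) * b (e k) v"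
    and finite_below: "finite {k. \<mu> k < t}"
    and lower_bound: "\<lbrakk>v \<in> V; \<And>i. i < k \<Longrightarrow> b v (e i) = 0\<rbrakk> \<Longrightarrow> \<mu> k * b.sq v \<le> a.sq v"
  using e\<mu> unfolding eigensequence_def by blast+

lemma finite_eigenvalue: "finite {k. \<mu> k = t}"
  by (rule finite_subset[OF _ finite_below[of "t + 1"]]) auto

lemma eigenvalue_above: "\<exists>k. t \<le> \<mu> k"
proof (rule ccontr)
  assume "\<not> ?thesis"
  then have "{k. \<mu> k < t} = UNIV" by (auto simp: not_le)
  then show False using finite_below[of t] by simp
qed

text \<open>The lower bound is used at the first index whose eigenvalue reaches \<open>t\<close>,
  which exists because the eigenvalues are unbounded; all earlier indices are covered by the
  orthogonality hypothesis.\<close>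

lemma variational_bound:
  assumes v: "v \<in> V" "\<And>k. \<mu> k < t \<Longrightarrow> b v (e k) = 0"
  shows "t * b.sq v \<le> a.sq v"
proof -
  define K where "K = (LEAST k. t \<le> \<mu> k)"
  have K: "t \<le> \<mu> K" unfolding K_def using eigenvalue_above by (rule LeastI_ex)
  have "\<mu> i < t" if "i < K" for i using not_less_Least[of i "\<lambda>k. t \<le> \<mu> k"] that by (auto simp: K_def)
  then have "\<mu> K * b.sq v \<le> a.sq v" using v by (intro lower_bound) auto
  moreover have "t * b.sq v \<le> \<mu> K * b.sq v" by (rule mult_right_mono[OF K b.form_nonneg[OF v(1)]])
  ultimately show ?thesis by linarith
qed

text \<open>This shows that no eigenvector is missed. The remainder \<open>w\<close> is orthogonal
  to the \<open>e j\<close> with eigenvalue \<open>t\<close> by construction and to the others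
  because their eigenvalues differ from \<open>t\<close>. A vector orthogonal to every
  \<open>e j\<close> satisfies the variational bound at all levels, while \<open>w\<close> has
  Rayleigh quotient \<open>t\<close>.\<close>

lemma eigenvector_expansion:
  assumes u: "u \<in> V" and eig: "\<And>v. v \<in> V \<Longrightarrow> a u v = of_real t * b u v"
  defines "w \<equiv> u - (\<Sum>k | \<mu> k = t. scale (b u (e k)) (e k))"
  shows "w \<in> V" "b.sq w = 0"
proof -
  define p where "p = (\<Sum>k | \<mu> k = t. scale (b u (e k)) (e k))"
  have p: "p \<in> V" unfolding p_def using eV by auto
  have w: "w = u - p" by (simp add: w_def p_def)
  show wV: "w \<in> V" using u p by (simp add: w)
  have ap: "a p v = of_real t * b p v" if "v \<in> V" for v
    unfolding p_def using that eV
    by (simp add: a.form_sum b.form_sum a.form_scale b.form_scale eigenvector sum_distrib_left mult_ac)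
  have orth: "b w (e j) = 0" for j
  proof (cases "\<mu> j = t")
    case True
    have "b p (e j) = (\<Sum>k | \<mu> k = t. b u (e k) * b (e k) (e j))"
      unfolding p_def using eV by (subst b.form_sum) (auto simp: b.form_scale)
    also have "\<dots> = (\<Sum>k | \<mu> k = t. if k = j then b u (e j) else 0)"
      by (rule sum.cong) (auto simp: orthonormal)
    also have "\<dots> = b u (e j)" using True finite_eigenvalue by simp
    finally show ?thesis using u p eV by (simp add: w b.form_diff)
  next
    case False
    have "of_real t * b w (e j) = a w (e j)"
      using u p eV by (simp add: w a.form_diff b.form_diff eig ap right_diff_distrib)
    also have "\<dots> = cnj (a (e j) w)" using wV eV by (intro a.form_herm) auto
    also have "\<dots> = of_real (\<mu> j) * cnj (b (e j) w)" using wV by (simp add: eigenvector)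
    also have "cnj (b (e j) w) = b w (e j)" using wV eV by (intro b.form_herm[symmetric]) auto
    finally have "(of_real t - of_real (\<mu> j)) * b w (e j) = 0" by (simp add: left_diff_distrib)
    then show ?thesis using False by simp
  qed
  have aw: "a.sq w = t * b.sq w"
    using u p wV by (simp add: w a.form_diff[of u p] b.form_diff[of u p] eig ap right_diff_distrib)
  \<comment> \<open>Any level above \<open>t\<close> would do; together with \<open>aw\<close> it
    leaves \<open>b.sq w \<le> 0\<close>.\<close>
  have "(t + 1) * b.sq w \<le> a.sq w" by (rule variational_bound[OF wV orth])
  then show "b.sq w = 0" using aw b.form_nonneg[OF wV] by (simp add: distrib_right)
qed

end

end

section \<open>Square-integrable functions\<close>

lemma square_norm_add_le: "(norm (x + y))\<^sup>2 \<le> 2 * (norm x)\<^sup>2 + 2 * (norm y)\<^sup>2"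
  for x y :: "'a::real_normed_vector"
proof -
  have "(norm (x + y))\<^sup>2 \<le> (norm x + norm y)\<^sup>2"
    by (intro power_mono norm_triangle_ineq) auto
  also have "\<dots> \<le> 2 * (norm x)\<^sup>2 + 2 * (norm y)\<^sup>2"
    using zero_le_power2[of "norm x - norm y"] by (simp add: power2_sum power2_diff)
  finally show ?thesis .
qed

text \<open>The weights \<open>2 ^ k\<close> replace the usual appeal to Minkowski's inequality: if the series
  with terms \<open>2 ^ k d\<^sub>k\<^sup>2\<close> converges, then so does the one with terms \<open>d\<^sub>k\<close>.\<close>

lemma Riesz_Fischer:
  fixes u :: "nat \<Rightarrow> 'a \<Rightarrow> complex"
  assumes meas [measurable]: "\<And>m. u m \<in> borel_measurable M"
    and int: "\<And>m l. integrable M (\<lambda>x. (cmod (u m x - u l x))\<^sup>2)"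
    and Cauchy: "\<And>\<epsilon>. \<epsilon> > 0 \<Longrightarrow> \<exists>N. \<forall>m\<ge>N. \<forall>l\<ge>N. (LINT x|M. (cmod (u m x - u l x))\<^sup>2) < \<epsilon>"
  shows "\<exists>w\<in>borel_measurable M. (\<forall>m. integrable M (\<lambda>x. (cmod (u m x - w x))\<^sup>2)) \<and>
    (\<lambda>m. LINT x|M. (cmod (u m x - w x))\<^sup>2) \<longlonglongrightarrow> 0"
proof -
  have nn: "(\<integral>\<^sup>+x. ennreal ((cmod (u m x - u l x))\<^sup>2) \<partial>M) = ennreal (LINT x|M. (cmod (u m x - u l x))\<^sup>2)" for m l
    by (rule nn_integral_eq_integral[OF int]) auto
  \<comment> \<open>Successive squared distances below \<open>4^-k\<close> leave the summable bound
    \<open>2^-k\<close> after multiplication by the weight \<open>2^k\<close>.\<close>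
  have "\<exists>r. \<forall>k. (\<forall>m\<ge>r k. \<forall>l\<ge>r k. (LINT x|M. (cmod (u m x - u l x))\<^sup>2) < (1/4)^k) \<and> r k < r (Suc k)"
  proof (rule dependent_nat_choice)
    show "\<exists>x. \<forall>m\<ge>x. \<forall>l\<ge>x. (LINT y|M. (cmod (u m y - u l y))\<^sup>2) < (1/4)^0"
      by (rule Cauchy) simp
  next
    fix x n
    obtain N where "\<forall>m\<ge>N. \<forall>l\<ge>N. (LINT y|M. (cmod (u m y - u l y))\<^sup>2) < (1/4)^Suc n"
      using Cauchy[of "(1/4)^Suc n"] by auto
    then show "\<exists>y. (\<forall>m\<ge>y. \<forall>l\<ge>y. (LINT z|M. (cmod (u m z - u l z))\<^sup>2) < (1/4)^Suc n) \<and> x < y"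
      by (intro exI[of _ "max N (Suc x)"]) auto
  qed
  then obtain r where r: "\<And>k m l. m \<ge> r k \<Longrightarrow> l \<ge> r k \<Longrightarrow> (LINT x|M. (cmod (u m x - u l x))\<^sup>2) < (1/4)^k"
    and r_less: "\<And>k. r k < r (Suc k)" by blast
  have sm: "strict_mono r" by (rule strict_mono_Suc_iff[THEN iffD2]) (use r_less in blast)
  define d where "d = (\<lambda>k x. 2^k * (cmod (u (r (Suc k)) x - u (r k) x))\<^sup>2)"
  have d_meas [measurable]: "d k \<in> borel_measurable M" for k unfolding d_def by measurable
  have "(\<integral>\<^sup>+x. (\<Sum>k. ennreal (d k x)) \<partial>M) = (\<Sum>k. \<integral>\<^sup>+x. ennreal (d k x) \<partial>M)"
    by (rule nn_integral_suminf) auto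
  also have "\<dots> \<le> (\<Sum>k. ennreal ((1/2)^k))"
  proof (rule suminf_le)
    fix k
    have "(\<integral>\<^sup>+x. ennreal (d k x) \<partial>M) = 2^k * (\<integral>\<^sup>+x. ennreal ((cmod (u (r (Suc k)) x - u (r k) x))\<^sup>2) \<partial>M)"
      unfolding d_def by (subst nn_integral_cmult[symmetric]) (auto simp: ennreal_mult ennreal_power[symmetric])
    also have "\<dots> = ennreal (2^k * (LINT x|M. (cmod (u (r (Suc k)) x - u (r k) x))\<^sup>2))"
      unfolding nn by (subst ennreal_mult) (auto simp: ennreal_power[symmetric])
    also have "\<dots> \<le> ennreal (2^k * (1/4)^k)"
      using r[of k "r (Suc k)" "r k"] r_less[of k]
      by (intro ennreal_leI mult_left_mono) (auto intro: less_imp_le)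
    also have "(2::real)^k * (1/4)^k = (1/2)^k" by (simp add: power_mult_distrib[symmetric])
    finally show "(\<integral>\<^sup>+x. ennreal (d k x) \<partial>M) \<le> ennreal ((1/2)^k)" .
  qed auto
  also have "\<dots> = ennreal (\<Sum>k. (1/2)^k)" by (rule suminf_ennreal2) auto
  also have "\<dots> < \<infinity>" by simp
  finally have "AE x in M. (\<Sum>k. ennreal (d k x)) \<noteq> \<infinity>"
    by (intro nn_integral_PInf_AE) auto
  then have conv: "AE x in M. convergent (\<lambda>k. u (r k) x)"
  proof eventually_elim
    case (elim x)
    have d0: "0 \<le> d k x" for k by (simp add: d_def)
    have "summable (\<lambda>k. d k x)" by (rule summable_suminf_not_top) (use elim d0 in auto)
    then have sd: "summable (\<lambda>k. d k x + (1/2)^k)" by (intro summable_add) auto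
    have "cmod (u (r (Suc k)) x - u (r k) x) \<le> d k x + (1/2)^k" for k
    proof -
      define c where "c = cmod (u (r (Suc k)) x - u (r k) x)"
      \<comment> \<open>From \<open>(2^k c - 1)^2 \<ge> 0\<close>; after division by
        \<open>2^k\<close> the increment \<open>c\<close> is bounded by two summable
        sequences.\<close>
      have "2 * (2^k * c) \<le> (2^k * c)\<^sup>2 + 1" using zero_le_power2[of "2^k * c - 1"]
        by (simp add: power2_diff)
      then have "2 * (2^k * c) / 2^k \<le> ((2^k * c)\<^sup>2 + 1) / 2^k" by (intro divide_right_mono) auto
      also have "((2^k * c)\<^sup>2 + 1) / 2^k = 2^k * c\<^sup>2 + (1/2)^k"
        by (simp add: power2_eq_square add_divide_distrib power_one_over)
      finally have "2 * c \<le> d k x + (1/2)^k" by (simp add: d_def c_def)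
      moreover have "0 \<le> c" by (simp add: c_def)
      ultimately show ?thesis unfolding c_def by linarith
    qed
    then have "summable (\<lambda>k. u (r (Suc k)) x - u (r k) x)"
      by (intro summable_comparison_test'[OF sd, of 0]) auto
    then have "convergent (\<lambda>n. \<Sum>k<n. u (r (Suc k)) x - u (r k) x)"
      by (simp add: summable_iff_convergent)
    then have "convergent (\<lambda>n. u (r n) x - u (r 0) x)"
      using sum_lessThan_telescope[of "\<lambda>k. u (r k) x"] by simp
    then have "convergent (\<lambda>n. (u (r n) x - u (r 0) x) + u (r 0) x)"
      by (intro convergent_add convergent_const)
    then show ?case by simp
  qed
  define w where "w = (\<lambda>x. lim (\<lambda>k. u (r k) x))"
  have w_meas [measurable]: "w \<in> borel_measurable M" unfolding w_def by measurable
  \<comment> \<open>Fatou's lemma along the almost everywhere convergent subsequence carries the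
    Cauchy estimate over to the limit.\<close>
  have bound: "(\<integral>\<^sup>+x. ennreal ((cmod (u m x - w x))\<^sup>2) \<partial>M) \<le> ennreal \<epsilon>"
    if N: "\<And>l. l \<ge> N \<Longrightarrow> (LINT x|M. (cmod (u m x - u l x))\<^sup>2) < \<epsilon>" for m N \<epsilon>
  proof -
    have "(\<integral>\<^sup>+x. ennreal ((cmod (u m x - w x))\<^sup>2) \<partial>M)
        = (\<integral>\<^sup>+x. liminf (\<lambda>k. ennreal ((cmod (u m x - u (r k) x))\<^sup>2)) \<partial>M)"
    proof (rule nn_integral_cong_AE)
      show "AE x in M. ennreal ((cmod (u m x - w x))\<^sup>2)
          = liminf (\<lambda>k. ennreal ((cmod (u m x - u (r k) x))\<^sup>2))"
        using conv
      proof eventually_elim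
        case (elim x)
        then have "(\<lambda>k. u (r k) x) \<longlonglongrightarrow> w x" by (simp add: w_def convergent_LIMSEQ_iff)
        then have "(\<lambda>k. ennreal ((cmod (u m x - u (r k) x))\<^sup>2)) \<longlonglongrightarrow> ennreal ((cmod (u m x - w x))\<^sup>2)"
          by (intro tendsto_intros)
        then show ?case by (intro lim_imp_Liminf[symmetric]) auto
      qed
    qed
    also have "\<dots> \<le> liminf (\<lambda>k. \<integral>\<^sup>+x. ennreal ((cmod (u m x - u (r k) x))\<^sup>2) \<partial>M)"
      by (rule nn_integral_liminf) auto
    also have "\<dots> \<le> ennreal \<epsilon>"
    proof (rule Liminf_le)
      have "eventually (\<lambda>k. r k \<ge> N) sequentially"
        using filterlim_subseq[OF sm] by (simp add: filterlim_at_top)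
      then show "\<forall>\<^sub>F k in sequentially. (\<integral>\<^sup>+x. ennreal ((cmod (u m x - u (r k) x))\<^sup>2) \<partial>M) \<le> ennreal \<epsilon>"
        by eventually_elim (simp only: nn, rule ennreal_leI, rule less_imp_le, rule N)
    qed simp
    finally show ?thesis .
  qed
  obtain N1 where N1: "\<forall>m\<ge>N1. \<forall>l\<ge>N1. (LINT x|M. (cmod (u m x - u l x))\<^sup>2) < 1"
    using Cauchy[of 1] by auto
  have N1_int: "integrable M (\<lambda>x. (cmod (u N1 x - w x))\<^sup>2)"
  proof (rule integrableI_bounded)
    have "(\<integral>\<^sup>+x. ennreal (norm ((cmod (u N1 x - w x))\<^sup>2)) \<partial>M) \<le> ennreal 1"
      using bound[of N1 N1 1] N1 by simp
    then show "(\<integral>\<^sup>+x. ennreal (norm ((cmod (u N1 x - w x))\<^sup>2)) \<partial>M) < \<infinity>"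
      by (rule order.strict_trans1) simp
  qed measurable
  have w_int: "integrable M (\<lambda>x. (cmod (u m x - w x))\<^sup>2)" for m
  proof (rule Bochner_Integration.integrable_bound)
    show "integrable M (\<lambda>x. 2 * (cmod (u m x - u N1 x))\<^sup>2 + 2 * (cmod (u N1 x - w x))\<^sup>2)"
      by (intro Bochner_Integration.integrable_add integrable_mult_right int N1_int)
    show "AE x in M. norm ((cmod (u m x - w x))\<^sup>2)
        \<le> norm (2 * (cmod (u m x - u N1 x))\<^sup>2 + 2 * (cmod (u N1 x - w x))\<^sup>2)"
      using square_norm_add_le[of "u m x - u N1 x" "u N1 x - w x" for x] by (intro AE_I2) simp
  qed measurable
  have "(\<lambda>m. LINT x|M. (cmod (u m x - w x))\<^sup>2) \<longlonglongrightarrow> 0"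
  proof (rule LIMSEQ_I)
    fix \<epsilon> :: real assume "\<epsilon> > 0"
    then obtain N where N: "\<forall>m\<ge>N. \<forall>l\<ge>N. (LINT x|M. (cmod (u m x - u l x))\<^sup>2) < \<epsilon> / 2"
      using Cauchy[of "\<epsilon> / 2"] by auto
    have "norm ((LINT x|M. (cmod (u m x - w x))\<^sup>2) - 0) < \<epsilon>" if "m \<ge> N" for m
    proof -
      have "ennreal (LINT x|M. (cmod (u m x - w x))\<^sup>2) \<le> ennreal (\<epsilon> / 2)"
        using bound[of N m "\<epsilon> / 2"] N that nn_integral_eq_integral[OF w_int[of m]] by simp
      then show ?thesis using \<open>\<epsilon> > 0\<close> by (simp add: ennreal_le_iff)
    qed
    then show "\<exists>no. \<forall>n\<ge>no. norm ((LINT x|M. (cmod (u n x - w x))\<^sup>2) - 0) < \<epsilon>" by blast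
  qed
  then show ?thesis using w_meas w_int by blast
qed

section \<open>Square-integrable functions as a semidefinite Hermitian space\<close>

definition cscale :: "complex \<Rightarrow> ('a \<Rightarrow> complex) \<Rightarrow> 'a \<Rightarrow> complex" where
  "cscale c u = (\<lambda>x. c * u x)"

lemma cscale_apply [simp]: "cscale c u x = c * u x"
  by (simp add: cscale_def)

lemma vector_space_cscale: "vector_space cscale"
  by unfold_locales (auto simp: fun_eq_iff algebra_simps)

lemma fun_sum_apply [simp]: "sum u I x = (\<Sum>i\<in>I. u i x)" for u :: "'i \<Rightarrow> 'a \<Rightarrow> 'b::comm_monoid_add"
  by (induction I rule: infinite_finite_induct) auto

definition L2_inner :: "(real^'n) set \<Rightarrow> (real^'n \<Rightarrow> complex) \<Rightarrow> (real^'n \<Rightarrow> complex) \<Rightarrow> complex" where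
  "L2_inner \<Omega> u v = (LINT x|lebesgue_on \<Omega>. u x * cnj (v x))"

lemma L2_measurable: "u \<in> L2 \<Omega> \<Longrightarrow> u \<in> borel_measurable (lebesgue_on \<Omega>)"
  and L2_integrable: "u \<in> L2 \<Omega> \<Longrightarrow> integrable (lebesgue_on \<Omega>) (\<lambda>x. (cmod (u x))\<^sup>2)"
  by (simp_all add: L2_def)

lemma L2_mult_integrable:
  assumes "u \<in> L2 \<Omega>" "v \<in> L2 \<Omega>"
  shows "integrable (lebesgue_on \<Omega>) (\<lambda>x. u x * v x)"
proof (rule Bochner_Integration.integrable_bound)
  show "integrable (lebesgue_on \<Omega>) (\<lambda>x. (cmod (u x))\<^sup>2 + (cmod (v x))\<^sup>2)"
    by (intro Bochner_Integration.integrable_add L2_integrable assms)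
  show "(\<lambda>x. u x * v x) \<in> borel_measurable (lebesgue_on \<Omega>)"
    by (intro borel_measurable_times L2_measurable assms)
  have "s * t \<le> s\<^sup>2 + t\<^sup>2" if "0 \<le> s" "0 \<le> t" for s t :: real
    using sum_squares_bound[of s t] mult_nonneg_nonneg[OF that] by linarith
  then show "AE x in lebesgue_on \<Omega>. norm (u x * v x) \<le> norm ((cmod (u x))\<^sup>2 + (cmod (v x))\<^sup>2)"
    by (intro AE_I2) (simp add: norm_mult)
qed

lemma L2_cnj: "u \<in> L2 \<Omega> \<Longrightarrow> (\<lambda>x. cnj (u x)) \<in> L2 \<Omega>"
  by (auto simp: L2_def intro: measurable_compose[OF _ borel_measurable_continuous_onI]
      continuous_intros)

lemma L2_mult_cnj_integrable:
  "\<lbrakk>u \<in> L2 \<Omega>; v \<in> L2 \<Omega>\<rbrakk> \<Longrightarrow> integrable (lebesgue_on \<Omega>) (\<lambda>x. u x * cnj (v x))"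
  by (intro L2_mult_integrable L2_cnj)

lemma L2_zero: "0 \<in> L2 \<Omega>"
  by (simp add: L2_def zero_fun_def)

lemma L2_scale: "u \<in> L2 \<Omega> \<Longrightarrow> cscale c u \<in> L2 \<Omega>"
  unfolding L2_def cscale_def by (auto simp: norm_mult power_mult_distrib)

lemma L2_add:
  assumes "u \<in> L2 \<Omega>" "v \<in> L2 \<Omega>"
  shows "u + v \<in> L2 \<Omega>"
proof -
  have *: "(\<lambda>x. u x + v x) \<in> borel_measurable (lebesgue_on \<Omega>)"
    by (intro borel_measurable_add L2_measurable assms)
  have "integrable (lebesgue_on \<Omega>) (\<lambda>x. (cmod (u x + v x))\<^sup>2)"
  proof (rule Bochner_Integration.integrable_bound)
    show "integrable (lebesgue_on \<Omega>) (\<lambda>x. 2 * (cmod (u x))\<^sup>2 + 2 * (cmod (v x))\<^sup>2)"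
      by (intro Bochner_Integration.integrable_add integrable_mult_right L2_integrable assms)
    show "(\<lambda>x. (cmod (u x + v x))\<^sup>2) \<in> borel_measurable (lebesgue_on \<Omega>)" using * by measurable
    show "AE x in lebesgue_on \<Omega>. norm ((cmod (u x + v x))\<^sup>2)
        \<le> norm (2 * (cmod (u x))\<^sup>2 + 2 * (cmod (v x))\<^sup>2)"
      using square_norm_add_le by (intro AE_I2) simp
  qed
  with * show ?thesis by (simp add: L2_def plus_fun_def)
qed

lemma L2_inner_same: "L2_inner \<Omega> u u = of_real (LINT x|lebesgue_on \<Omega>. (cmod (u x))\<^sup>2)"
proof -
  have "L2_inner \<Omega> u u = (LINT x|lebesgue_on \<Omega>. complex_of_real ((cmod (u x))\<^sup>2))"
    by (simp only: L2_inner_def complex_norm_square[symmetric])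
  then show ?thesis by (simp only: integral_complex_of_real)
qed

lemma hermitian_form_L2_inner: "hermitian_form cscale (L2 \<Omega>) (L2_inner \<Omega>)"
proof -
  interpret vector_space cscale by (rule vector_space_cscale)
  show ?thesis
  proof
    show "subspace (L2 \<Omega>)" by (simp add: subspace_def L2_zero L2_add L2_scale)
  next
    fix u v w assume *: "u \<in> L2 \<Omega>" "v \<in> L2 \<Omega>" "w \<in> L2 \<Omega>"
    then show "L2_inner \<Omega> (u + v) w = L2_inner \<Omega> u w + L2_inner \<Omega> v w"
      using L2_mult_cnj_integrable[OF *(1,3)] L2_mult_cnj_integrable[OF *(2,3)]
      by (simp add: L2_inner_def distrib_right)
  next
    fix u v assume *: "u \<in> L2 \<Omega>" "v \<in> L2 \<Omega>"
    have "L2_inner \<Omega> v u = (LINT x|lebesgue_on \<Omega>. cnj (u x * cnj (v x)))"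
      unfolding L2_inner_def by (rule Bochner_Integration.integral_cong) auto
    then show "L2_inner \<Omega> v u = cnj (L2_inner \<Omega> u v)"
      by (simp only: L2_inner_def Bochner_Integration.integral_cnj)
  qed (simp_all add: L2_inner_same, simp add: L2_inner_def mult.assoc)
qed

interpretation L2: hermitian_form cscale "L2 \<Omega>" "L2_inner \<Omega>" for \<Omega>
  by (rule hermitian_form_L2_inner)

lemma L2_inner_same_eq_0_iff:
  assumes "u \<in> L2 \<Omega>"
  shows "Re (L2_inner \<Omega> u u) = 0 \<longleftrightarrow> (AE x in lebesgue_on \<Omega>. u x = 0)"
  unfolding L2_inner_same using integral_nonneg_eq_0_iff_AE[OF L2_integrable[OF assms]] by simp

lemma L2_inner_cong_AE:
  assumes "u \<in> L2 \<Omega>" "v \<in> L2 \<Omega>" "u' \<in> L2 \<Omega>" "v' \<in> L2 \<Omega>"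
    "AE x in lebesgue_on \<Omega>. u x = u' x" "AE x in lebesgue_on \<Omega>. v x = v' x"
  shows "L2_inner \<Omega> u v = L2_inner \<Omega> u' v'"
  unfolding L2_inner_def
proof (rule integral_cong_AE)
  show "AE x in lebesgue_on \<Omega>. u x * cnj (v x) = u' x * cnj (v' x)"
    using assms(5,6) by eventually_elim simp
qed (intro borel_measurable_integrable L2_mult_cnj_integrable assms)+

lemma L2_complete:
  assumes u: "\<And>m. u m \<in> L2 \<Omega>"
    and Cauchy: "\<And>\<epsilon>. \<epsilon> > 0 \<Longrightarrow> \<exists>N. \<forall>m\<ge>N. \<forall>l\<ge>N. Re (L2_inner \<Omega> (u m - u l) (u m - u l)) < \<epsilon>"
  shows "\<exists>w\<in>L2 \<Omega>. (\<lambda>m. Re (L2_inner \<Omega> (u m - w) (u m - w))) \<longlonglongrightarrow> 0"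
proof -
  have "u m - u l \<in> L2 \<Omega>" for m l using u by auto
  then have "integrable (lebesgue_on \<Omega>) (\<lambda>x. (cmod (u m x - u l x))\<^sup>2)" for m l
    using L2_integrable by fastforce
  then obtain w where w: "w \<in> borel_measurable (lebesgue_on \<Omega>)"
    "integrable (lebesgue_on \<Omega>) (\<lambda>x. (cmod (u 0 x - w x))\<^sup>2)"
    and lim: "(\<lambda>m. LINT x|lebesgue_on \<Omega>. (cmod (u m x - w x))\<^sup>2) \<longlonglongrightarrow> 0"
    using Riesz_Fischer[of u "lebesgue_on \<Omega>"] L2_measurable[OF u] Cauchy
    by (force simp: L2_inner_same)
  \<comment> \<open>The Riesz-Fischer limit is known only through its differences to the
    \<open>u m\<close>; writing \<open>w\<close> as \<open>u 0 - (u 0 - w)\<close> puts it in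
    \<open>L2\<close>.\<close>
  have "u 0 - w \<in> L2 \<Omega>" using w L2_measurable[OF u[of 0]] by (simp add: L2_def fun_diff_def)
  then have "u 0 - (u 0 - w) \<in> L2 \<Omega>" using u[of 0] by blast
  then have "w \<in> L2 \<Omega>" by simp
  then show ?thesis using lim by (auto simp: L2_inner_same)
qed

lemma L2_bounded:
  assumes "\<Omega> \<in> lmeasurable" "u \<in> borel_measurable (lebesgue_on \<Omega>)" "\<And>x. x \<in> \<Omega> \<Longrightarrow> cmod (u x) \<le> B"
  shows "u \<in> L2 \<Omega>"
proof -
  have "integrable (lebesgue_on \<Omega>) (\<lambda>x. (cmod (u x))\<^sup>2)"
  proof (rule Bochner_Integration.integrable_bound)
    show "integrable (lebesgue_on \<Omega>) (\<lambda>x. B\<^sup>2)"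
      using assms(1) by (auto simp: finite_measure.integrable_const fmeasurable_def
          intro!: finite_measure.integrable_const finite_measure_lebesgue_on)
    show "(\<lambda>x. (cmod (u x))\<^sup>2) \<in> borel_measurable (lebesgue_on \<Omega>)" using assms(2) by measurable
    show "AE x in lebesgue_on \<Omega>. norm ((cmod (u x))\<^sup>2) \<le> norm (B\<^sup>2)"
      by (intro AE_I2) (auto simp: assms(3) intro!: power_mono)
  qed
  with assms(2) show ?thesis by (simp add: L2_def)
qed

section \<open>Uniqueness of weak derivatives\<close>

text \<open>The family \<open>p(1/t) exp(-c/t)\<close>, extended by zero, is closed under
  differentiation, so smoothness of bumps needs no formula for higher derivatives. The parameter
  \<open>c\<close> will tend to 0, which turns the case \<open>p = 1\<close> into the indicator of
  the positive half-line.\<close>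

definition exp_inverse :: "real \<Rightarrow> real poly \<Rightarrow> real \<Rightarrow> real" where
  "exp_inverse c p t = (if t > 0 then poly p (1 / t) * exp (- c / t) else 0)"

lemma exp_inverse_smult: "exp_inverse c (smult s p) t = s * exp_inverse c p t"
  by (simp add: exp_inverse_def)

lemma poly_times_exp_tendsto_0:
  fixes p :: "real poly"
  assumes "c > 0"
  shows "((\<lambda>s. poly p s * exp (- c * s)) \<longlongrightarrow> 0) at_top"
proof -
  have pow: "((\<lambda>s. s ^ i * exp (- c * s)) \<longlongrightarrow> 0) at_top" for i
  proof -
    have "filterlim (\<lambda>s. c * s) at_top at_top"
      by (rule filterlim_tendsto_pos_mult_at_top[OF tendsto_const assms filterlim_ident])
    then have "((\<lambda>s. (c * s) ^ i / exp (c * s)) \<longlongrightarrow> 0) at_top"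
      by (rule filterlim_compose[OF tendsto_power_div_exp_0])
    then have "((\<lambda>s. (1 / c ^ i) * ((c * s) ^ i / exp (c * s))) \<longlongrightarrow> (1 / c ^ i) * 0) at_top"
      by (intro tendsto_intros)
    moreover have "(\<lambda>s. (1 / c ^ i) * ((c * s) ^ i / exp (c * s))) = (\<lambda>s. s ^ i * exp (- c * s))"
      using assms by (auto simp: fun_eq_iff power_mult_distrib exp_minus field_simps)
    ultimately show ?thesis by simp
  qed
  have "((\<lambda>s. \<Sum>i\<le>degree p. coeff p i * (s ^ i * exp (- c * s))) \<longlongrightarrow> (\<Sum>i\<le>degree p. coeff p i * 0)) at_top"
    by (intro tendsto_intros pow)
  then show ?thesis by (simp add: poly_altdef sum_distrib_right mult.assoc)
qed

text \<open>With \<open>s = 1/t\<close> the derivative in \<open>t\<close> is \<open>-s^2\<close>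
  times the derivative in \<open>s\<close>, and \<open>p(s) exp(-c s)\<close> becomes
  \<open>s^2 (c p - p')(s) exp(-c s)\<close>; the polynomial \<open>[:0, 0, 1:]\<close> is the
  factor \<open>s^2\<close>.\<close>

lemma exp_inverse_has_derivative:
  fixes c t :: real and p :: "real poly"
  assumes c: "c > 0"
  defines "p' \<equiv> [:0, 0, 1:] * (smult c p - pderiv p)"
  shows "(exp_inverse c p has_real_derivative exp_inverse c p' t) (at t)"
proof (cases t "0 :: real" rule: linorder_cases)
  case less
  have "((\<lambda>_. 0) has_real_derivative 0) (at t)" by simp
  then have "(exp_inverse c p has_real_derivative 0) (at t)"
    by (rule has_field_derivative_transform_within_open[of _ _ _ "{..<0}"])
       (use less in \<open>auto simp: exp_inverse_def\<close>)
  then show ?thesis using less by (simp add: exp_inverse_def)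
next
  case greater
  have "((\<lambda>t. poly p (1 / t) * exp (- c / t)) has_real_derivative
      (poly (pderiv p) (1 / t) * (- 1 / t\<^sup>2)) * exp (- c / t) + poly p (1 / t) * (exp (- c / t) * (c / t\<^sup>2))) (at t)"
  proof -
    have "((\<lambda>t. 1 / t) has_real_derivative (- 1 / t\<^sup>2)) (at t)"
      using greater by (auto intro!: derivative_eq_intros simp: power2_eq_square)
    then have "((\<lambda>t. poly p (1 / t)) has_real_derivative poly (pderiv p) (1 / t) * (- 1 / t\<^sup>2)) (at t)"
      by (rule DERIV_chain2[OF poly_DERIV])
    moreover have "((\<lambda>t. exp (- c / t)) has_real_derivative exp (- c / t) * (c / t\<^sup>2)) (at t)"
      using greater by (auto intro!: derivative_eq_intros simp: power2_eq_square)
    ultimately show ?thesis using DERIV_mult by (fastforce simp: algebra_simps)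
  qed
  also have "(poly (pderiv p) (1 / t) * (- 1 / t\<^sup>2)) * exp (- c / t) + poly p (1 / t) * (exp (- c / t) * (c / t\<^sup>2))
      = exp_inverse c p' t"
    using greater by (simp add: exp_inverse_def p'_def power2_eq_square field_simps)
  finally show ?thesis
    by (rule has_field_derivative_transform_within_open[of _ _ _ "{0<..}"])
       (use greater in \<open>auto simp: exp_inverse_def\<close>)
next
  case equal
  \<comment> \<open>At the origin the right difference quotient is \<open>s p(s) exp(-c s)\<close>
    with \<open>s = 1/h\<close>, hence the extra factor \<open>[:0, 1:]\<close>.\<close>
  have "((\<lambda>s. poly (p * [:0, 1:]) s * exp (- c * s)) \<longlongrightarrow> 0) at_top"
    by (rule poly_times_exp_tendsto_0[OF c])
  then have "((\<lambda>h. poly (p * [:0, 1:]) (inverse h) * exp (- c * inverse h)) \<longlongrightarrow> 0) (at_right 0)"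
    by (rule filterlim_compose[OF _ filterlim_inverse_at_top_right])
  then have right: "((\<lambda>h. exp_inverse c p h / h) \<longlongrightarrow> 0) (at_right 0)"
    by (rule Lim_transform_eventually)
       (auto simp: eventually_at_filter exp_inverse_def field_simps)
  have left: "((\<lambda>h. exp_inverse c p h / h) \<longlongrightarrow> 0) (at_left 0)"
    by (rule tendsto_eventually) (auto simp: eventually_at_filter exp_inverse_def)
  have "((\<lambda>h. exp_inverse c p h / h) \<longlongrightarrow> 0) (at 0)"
    by (rule filterlim_split_at[OF left right])
  then show ?thesis using equal by (simp add: has_field_derivative_iff exp_inverse_def)
qed

text \<open>A class of differentiable functions that contains the partial derivatives of its members
  consists of smooth functions; the induction on the order keeps \<open>f\<close> arbitrary within
  the class.\<close>

lemma continuously_diff_coinduct: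
  assumes "f \<in> F"
    and "\<And>f. f \<in> F \<Longrightarrow> (\<forall>x. f differentiable (at x)) \<and> (\<forall>i. partial_deriv i f \<in> F)"
  shows "continuously_diff m f"
  using assms(1)
proof (induction m arbitrary: f)
  case 0
  then show ?case
    using assms(2) by (auto simp: continuous_on_eq_continuous_at intro: differentiable_imp_continuous_within)
qed (use assms(2) in auto)

text \<open>The smallest convenient class containing the bumps and closed under partial derivatives.
  The polynomial \<open>p\<close> is arbitrary because differentiation changes it, and the sign of
  \<open>s\<close> allows either side of a hyperplane.\<close>

inductive_set elementary_smooth :: "(real^'n \<Rightarrow> complex) set" where
  const: "(\<lambda>x. a) \<in> elementary_smooth"
| affine: "c > 0 \<Longrightarrow> (\<lambda>x. of_real (exp_inverse c p (s * x $ k + a))) \<in> elementary_smooth"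
| add: "\<lbrakk>f \<in> elementary_smooth; g \<in> elementary_smooth\<rbrakk> \<Longrightarrow> (\<lambda>x. f x + g x) \<in> elementary_smooth"
| mult: "\<lbrakk>f \<in> elementary_smooth; g \<in> elementary_smooth\<rbrakk> \<Longrightarrow> (\<lambda>x. f x * g x) \<in> elementary_smooth"

lemma elementary_smooth_prod:
  "(\<And>k. k \<in> K \<Longrightarrow> f k \<in> elementary_smooth) \<Longrightarrow> (\<lambda>x. \<Prod>k\<in>K. f k x) \<in> elementary_smooth"
  by (induction K rule: infinite_finite_induct)
     (auto intro: elementary_smooth.const elementary_smooth.mult)

lemma elementary_smooth_derivative:
  fixes f :: "real^'n \<Rightarrow> complex"
  assumes "f \<in> elementary_smooth"
  shows "\<exists>D. (\<forall>x. (f has_derivative D x) (at x)) \<and> (\<forall>i. (\<lambda>x. D x (axis i 1)) \<in> elementary_smooth)"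
  using assms
proof induction
  case (const a)
  show ?case by (intro exI[of _ "\<lambda>_ _. 0"]) (auto intro: elementary_smooth.const)
next
  case (affine c p s k a)
  define q where "q = smult s ([:0, 0, 1:] * (smult c p - pderiv p))"
  have "((\<lambda>x. complex_of_real (exp_inverse c p (s * x $ k + a))) has_derivative
      (\<lambda>v. of_real (exp_inverse c q (s * x $ k + a) * v $ k))) (at x)" for x :: "real^'n"
  proof -
    have "((\<lambda>x. s * x $ k + a) has_derivative (\<lambda>v. s * v $ k)) (at x)"
      by (auto intro!: derivative_eq_intros bounded_linear_imp_has_derivative bounded_linear_vec_nth)
    from has_derivative_compose[OF this exp_inverse_has_derivative[OF affine, unfolded has_field_derivative_def]]
    have "((\<lambda>x. exp_inverse c p (s * x $ k + a)) has_derivative (\<lambda>v. exp_inverse c q (s * x $ k + a) * v $ k)) (at x)"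
      unfolding q_def exp_inverse_smult by (simp only: mult_ac)
    then show ?thesis by (rule has_derivative_of_real)
  qed
  moreover have "(\<lambda>x. of_real (exp_inverse c q (s * x $ k + a) * (axis i 1 :: real^'n) $ k)) \<in> elementary_smooth" for i
    by (cases "i = k") (auto simp: axis_def intro: elementary_smooth.const elementary_smooth.affine affine)
  ultimately show ?case
    by (intro exI[of _ "\<lambda>x v. of_real (exp_inverse c q (s * x $ k + a) * v $ k)"] conjI allI)
next
  case (add f g)
  then obtain D E where D: "\<And>x. (f has_derivative D x) (at x)" "\<And>i. (\<lambda>x. D x (axis i 1)) \<in> elementary_smooth"
    and E: "\<And>x. (g has_derivative E x) (at x)" "\<And>i. (\<lambda>x. E x (axis i 1)) \<in> elementary_smooth" by blast
  show ?case
    by (intro exI[of _ "\<lambda>x v. D x v + E x v"]) (auto intro!: has_derivative_add D E elementary_smooth.add)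
next
  case (mult f g)
  then obtain D E where D: "\<And>x. (f has_derivative D x) (at x)" "\<And>i. (\<lambda>x. D x (axis i 1)) \<in> elementary_smooth"
    and E: "\<And>x. (g has_derivative E x) (at x)" "\<And>i. (\<lambda>x. E x (axis i 1)) \<in> elementary_smooth" by blast
  show ?case
    by (intro exI[of _ "\<lambda>x v. f x * E x v + D x v * g x"])
       (auto intro!: has_derivative_mult D E elementary_smooth.add elementary_smooth.mult mult.hyps)
qed

lemma elementary_smooth_continuously_diff:
  fixes f :: "real^'n \<Rightarrow> complex"
  assumes "f \<in> elementary_smooth"
  shows "continuously_diff m f"
proof (rule continuously_diff_coinduct[OF assms])
  fix f :: "real^'n \<Rightarrow> complex" assume "f \<in> elementary_smooth"
  then obtain D where D: "\<And>x. (f has_derivative D x) (at x)" "\<And>i. (\<lambda>x. D x (axis i 1)) \<in> elementary_smooth"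
    using elementary_smooth_derivative by blast
  have "partial_deriv i f = (\<lambda>x. D x (axis i 1))" for i
    by (auto simp: partial_deriv_def fun_eq_iff frechet_derivative_at[OF D(1), symmetric])
  then show "(\<forall>x. f differentiable at x) \<and> (\<forall>i. partial_deriv i f \<in> elementary_smooth)"
    using D by (auto simp: differentiable_def)
qed

text \<open>One factor for each face of the box. The coefficients \<open>1\<close>,
  \<open>-1\<close> and the form \<open>+ - a $ k\<close> are written out so that each factor
  matches the \<open>affine\<close> rule literally.\<close>

definition box_bump :: "real \<Rightarrow> real^'n \<Rightarrow> real^'n \<Rightarrow> real^'n \<Rightarrow> complex" where
  "box_bump c a b x =
     (\<Prod>k\<in>UNIV. of_real (exp_inverse c 1 (1 * x $ k + - a $ k)) * of_real (exp_inverse c 1 (-1 * x $ k + b $ k)))"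

lemma box_bump_nonzero_iff: "c > 0 \<Longrightarrow> box_bump c a b x \<noteq> 0 \<longleftrightarrow> x \<in> box a b"
  by (auto simp: box_bump_def exp_inverse_def mem_box_cart split: if_splits)

lemma box_bump_test_function:
  assumes "c > 0" "cbox a b \<subseteq> \<Omega>"
  shows "box_bump c a b \<in> test_functions \<Omega>"
proof -
  have "box_bump c a b \<in> elementary_smooth"
    unfolding box_bump_def[abs_def]
    by (intro elementary_smooth_prod elementary_smooth.mult elementary_smooth.affine assms)
  moreover have "closure {x. box_bump c a b x \<noteq> 0} \<subseteq> cbox a b"
    using assms by (intro closure_minimal) (auto simp: box_bump_nonzero_iff box_subset_cbox[THEN subsetD])
  moreover from this have "compact (closure {x. box_bump c a b x \<noteq> 0})"
    by (meson bounded_cbox bounded_subset closed_closure compact_eq_bounded_closed)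
  ultimately show ?thesis
    using assms by (auto simp: test_functions_def elementary_smooth_continuously_diff)
qed

lemma box_bump_le_1: "c > 0 \<Longrightarrow> cmod (box_bump c a b x) \<le> 1"
proof -
  assume "c > 0"
  then have "\<bar>exp_inverse c 1 t\<bar> \<le> 1" for t by (auto simp: exp_inverse_def)
  then show ?thesis
    by (auto simp: box_bump_def norm_mult prod_norm[symmetric] intro!: prod_le_1 mult_le_one)
qed

lemma box_bump_tendsto_indicator:
  fixes a b :: "real^'n"
  shows
  "(\<lambda>m. box_bump (inverse (real (Suc m))) a b x) \<longlonglongrightarrow> indicator (box a b) x"
proof (cases "x \<in> box a b")
  case True
  have lim: "(\<lambda>m. complex_of_real (exp_inverse (inverse (real (Suc m))) 1 t)) \<longlonglongrightarrow> 1" if "t > 0" for t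
  proof -
    have "(\<lambda>m. exp (- inverse (real (Suc m)) / t)) \<longlonglongrightarrow> exp (- 0 / t)"
      by (intro tendsto_intros LIMSEQ_inverse_real_of_nat) (use that in auto)
    then have "(\<lambda>m. complex_of_real (exp (- inverse (real (Suc m)) / t))) \<longlonglongrightarrow> of_real 1"
      by (intro tendsto_of_real) simp
    then show ?thesis using that by (simp add: exp_inverse_def)
  qed
  have "(\<lambda>m. box_bump (inverse (real (Suc m))) a b x) \<longlonglongrightarrow> (\<Prod>k\<in>(UNIV::'n set). 1 * 1)"
    unfolding box_bump_def using True by (intro tendsto_intros lim) (auto simp: mem_box_cart)
  then show ?thesis using True by simp
next
  case False
  then have "box_bump (inverse (real (Suc m))) a b x = 0" for m
    using box_bump_nonzero_iff[of "inverse (real (Suc m))" a b x] by auto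
  then show ?thesis using False by simp
qed

text \<open>The positive and the negative part of \<open>f\<close> are densities of finite measures
  that agree on open boxes. These form an intersection-stable generator of the Borel sets, so the
  measures and hence the densities agree.\<close>

lemma AE_zero_if_box_integrals_zero:
  fixes f :: "'a::euclidean_space \<Rightarrow> real"
  assumes int: "integrable lborel f" and zero: "\<And>a b. (LINT x|lborel. indicator (box a b) x * f x) = 0"
  shows "AE x in lborel. f x = 0"
proof -
  have [measurable]: "f \<in> borel_measurable borel" using int by auto
  have intb: "integrable lborel (\<lambda>x. indicator X x * max 0 (s * f x))" if "X \<in> sets borel" for X and s :: real
    using that int integrable_mult_indicator[of X lborel "\<lambda>x. max 0 (s * f x)"] by auto
  have nn: "emeasure (density lborel (\<lambda>x. ennreal (s * f x))) X
      = ennreal (LINT x|lborel. indicator X x * max 0 (s * f x))" if "X \<in> sets borel" for X and s :: real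
  proof -
    have "emeasure (density lborel (\<lambda>x. ennreal (s * f x))) X = (\<integral>\<^sup>+x. ennreal (s * f x) * indicator X x \<partial>lborel)"
      using that by (intro emeasure_density) auto
    also have "\<dots> = (\<integral>\<^sup>+x. ennreal (indicator X x * max 0 (s * f x)) \<partial>lborel)"
      by (intro nn_integral_cong) (auto simp: indicator_def max_def ennreal_neg)
    also have "\<dots> = ennreal (LINT x|lborel. indicator X x * max 0 (s * f x))"
      by (rule nn_integral_eq_integral[OF intb[OF that]]) auto
    finally show ?thesis .
  qed
  \<comment> \<open>\<open>ennreal\<close> cuts negative reals off at 0, so these are the densities
    of the positive and of the negative part.\<close>
  have eq: "density lborel (\<lambda>x. ennreal (1 * f x)) = density lborel (\<lambda>x. ennreal (-1 * f x))"
  proof (rule measure_eqI_generator_eq)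
    let ?E = "range (\<lambda>(a, b). box a b::'a set)"
    show "Int_stable ?E" by (auto simp: Int_stable_def box_Int_box)
    show "?E \<subseteq> Pow UNIV" "sets (density lborel (\<lambda>x. ennreal (1 * f x))) = sigma_sets UNIV ?E"
      "sets (density lborel (\<lambda>x. ennreal (-1 * f x))) = sigma_sets UNIV ?E"
      by (simp_all add: borel_eq_box)
    let ?A = "\<lambda>n::nat. box (- (real n *\<^sub>R One)) (real n *\<^sub>R One) :: 'a set"
    show "range ?A \<subseteq> ?E" "(\<Union>i. ?A i) = UNIV" unfolding UN_box_eq_UNIV by auto
    show "emeasure (density lborel (\<lambda>x. ennreal (1 * f x))) (?A i) \<noteq> \<infinity>" for i
      by (subst nn) auto
    fix X assume "X \<in> ?E"
    then obtain a b where X: "X = box a b" by auto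
    have "(LINT x|lborel. indicator X x * max 0 (1 * f x)) - (LINT x|lborel. indicator X x * max 0 (-1 * f x))
        = (LINT x|lborel. indicator X x * max 0 (1 * f x) - indicator X x * max 0 (-1 * f x))"
      by (intro Bochner_Integration.integral_diff[symmetric] intb) (simp_all add: X)
    also have "\<dots> = (LINT x|lborel. indicator X x * f x)"
      by (intro Bochner_Integration.integral_cong) (auto simp: max_def indicator_def)
    also have "\<dots> = 0" unfolding X by (rule zero)
    finally show "emeasure (density lborel (\<lambda>x. ennreal (1 * f x))) X = emeasure (density lborel (\<lambda>x. ennreal (-1 * f x))) X"
      by (subst (1 2) nn) (auto simp: X)
  qed
  have "AE x in lborel. ennreal (1 * f x) = ennreal (-1 * f x)"
  proof (rule sigma_finite_density_unique[THEN iffD1, OF _ _ _ eq])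
    have "finite_measure (density lborel (\<lambda>x. ennreal (1 * f x)))"
      by (rule finite_measureI) (use nn[of UNIV 1] in simp)
    then show "sigma_finite_measure (density lborel (\<lambda>x. ennreal (1 * f x)))"
      by (simp add: finite_measure_def)
  qed auto
  then show ?thesis
  proof eventually_elim
    case (elim x)
    then show ?case by (cases "f x \<ge> 0") (auto simp: ennreal_neg)
  qed
qed

lemma lebesgue_on_integral:
  fixes f :: "real^'n \<Rightarrow> 'b::{banach,second_countable_topology}"
  assumes "\<Omega> \<in> sets lebesgue"
  shows "(LINT x|lebesgue_on \<Omega>. f x) = (LINT x|lebesgue. indicator \<Omega> x *\<^sub>R f x)"
  using assms by (intro integral_restrict_space) auto

lemma borel_measurable_lebesgue_onI:
  "f \<in> borel_measurable borel \<Longrightarrow> f \<in> borel_measurable (lebesgue_on \<Omega>)"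
  by (intro measurable_restrict_space1 measurable_completion) simp

text \<open>Bumps supported in a closed box inside \<open>\<Omega>\<close> converge boundedly to the
  indicator of the open box, so \<open>g\<close> has integral zero over it. The box criterion gives
  \<open>g = 0\<close> almost everywhere on each such box, and countably many closed boxes exhaust
  \<open>\<Omega>\<close>.\<close>

lemma du_Bois_Reymond:
  fixes g :: "real^'n \<Rightarrow> complex"
  assumes \<Omega>: "open \<Omega>" "bounded \<Omega>" and g: "g \<in> L2 \<Omega>"
    and zero: "\<And>\<phi>. \<phi> \<in> test_functions \<Omega> \<Longrightarrow> (LINT x|lebesgue_on \<Omega>. g x * \<phi> x) = 0"
  shows "AE x in lebesgue_on \<Omega>. g x = 0"
proof -
  have lm: "\<Omega> \<in> lmeasurable" using \<Omega> by (simp add: lmeasurable_open)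
  then have m\<Omega>: "\<Omega> \<in> sets lebesgue" by auto
  have "(\<lambda>x. 1) \<in> L2 \<Omega>" by (rule L2_bounded[OF lm, of _ 1]) auto
  from L2_mult_integrable[OF g this] have int: "integrable (lebesgue_on \<Omega>) g" by simp
  have [measurable]: "g \<in> borel_measurable (lebesgue_on \<Omega>)" using g by (rule L2_measurable)
  have box: "(LINT x|lebesgue_on \<Omega>. g x * indicator (box a b) x) = 0" if ab: "cbox a b \<subseteq> \<Omega>" for a b
  proof -
    have cont: "continuous_on UNIV (box_bump (inverse (real (Suc m))) a b)" for m
      using box_bump_test_function[OF _ ab, of "inverse (real (Suc m))"]
      by (auto simp: test_functions_def dest: spec[of _ 0])
    have meas: "box_bump (inverse (real (Suc m))) a b \<in> borel_measurable (lebesgue_on \<Omega>)" for m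
      by (rule borel_measurable_lebesgue_onI[OF borel_measurable_continuous_onI[OF cont]])
    have ind: "indicator (box a b) \<in> borel_measurable (lebesgue_on \<Omega>)"
      by (intro borel_measurable_lebesgue_onI borel_measurable_indicator) auto
    have "(\<lambda>m. LINT x|lebesgue_on \<Omega>. g x * box_bump (inverse (real (Suc m))) a b x)
        \<longlonglongrightarrow> (LINT x|lebesgue_on \<Omega>. g x * indicator (box a b) x)"
    proof (rule integral_dominated_convergence[where w = "\<lambda>x. cmod (g x)"])
      show "integrable (lebesgue_on \<Omega>) (\<lambda>x. cmod (g x))" using int by (rule integrable_norm)
      show "AE x in lebesgue_on \<Omega>. (\<lambda>m. g x * box_bump (inverse (real (Suc m))) a b x)
          \<longlonglongrightarrow> g x * indicator (box a b) x"
        by (intro AE_I2 tendsto_mult tendsto_const box_bump_tendsto_indicator)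
      show "AE x in lebesgue_on \<Omega>. norm (g x * box_bump (inverse (real (Suc m))) a b x) \<le> cmod (g x)" for m
        using box_bump_le_1[of "inverse (real (Suc m))" a b]
        by (intro AE_I2) (auto simp: norm_mult intro!: mult_left_le)
    qed (use meas ind in \<open>auto intro!: borel_measurable_times\<close>)
    moreover have "(LINT x|lebesgue_on \<Omega>. g x * box_bump (inverse (real (Suc m))) a b x) = 0" for m
      by (intro zero box_bump_test_function ab) auto
    ultimately show ?thesis by (simp add: LIMSEQ_const_iff)
  qed
  have part: "AE x in lebesgue. x \<in> box a b \<longrightarrow> h (g x) = 0"
    if ab: "cbox a b \<subseteq> \<Omega>" and h: "h = Re \<or> h = Im" for a b and h :: "complex \<Rightarrow> real"
  proof -
    have h_lin: "bounded_linear h" using h bounded_linear_Re bounded_linear_Im by auto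
    \<comment> \<open>Cutting \<open>g\<close> off to one fixed box makes the criterion applicable
      on the whole space: any box meets the fixed one in a box whose closure is still inside
      \<open>\<Omega>\<close>.\<close>
    define f where "f = (\<lambda>x. indicator (box a b) x * h (g x))"
    have sub: "box a b \<subseteq> \<Omega>" using ab box_subset_cbox by blast
    have hint: "integrable (lebesgue_on \<Omega>) (\<lambda>x. h (g x))"
      by (rule integrable_bounded_linear[OF h_lin int])
    then have "integrable lebesgue (\<lambda>x. indicator \<Omega> x *\<^sub>R h (g x))"
      using m\<Omega> by (simp add: integrable_restrict_space)
    then have "integrable lebesgue (\<lambda>x. indicator (box a b) x *\<^sub>R (indicator \<Omega> x *\<^sub>R h (g x)))"
      by (rule integrable_mult_indicator[rotated]) auto
    moreover have "(\<lambda>x. indicator (box a b) x *\<^sub>R (indicator \<Omega> x *\<^sub>R h (g x))) = f"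
      using sub by (auto simp: f_def indicator_def fun_eq_iff)
    ultimately have f: "integrable lebesgue f" by simp
    \<comment> \<open>The criterion is stated for Borel measure, so the Lebesgue measurable
      \<open>f\<close> is replaced by a Borel representative.\<close>
    obtain f' where f': "f' \<in> borel_measurable lborel" "AE x in lborel. f x = f' x"
      using completion_ex_borel_measurable_real[OF borel_measurable_integrable[OF f]] by blast
    have "integrable lebesgue f'"
      by (rule integrable_cong_AE_imp[OF f]) (use f' in \<open>auto intro: measurable_completion AE_completion simp: eq_commute\<close>)
    then have f'int: "integrable lborel f'" using f'(1) by (simp add: integrable_completion)
    have "AE x in lborel. f' x = 0"
    proof (rule AE_zero_if_box_integrals_zero[OF f'int])
      fix c d :: "real^'n"
      obtain p q where pq: "box c d \<inter> box a b = box p q" using box_Int_box by blast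
      have "(LINT x|lborel. indicator (box c d) x * f' x) = (LINT x|lebesgue. indicator (box c d) x * f' x)"
        using f'(1) by (subst integral_completion) auto
      also have "\<dots> = (LINT x|lebesgue. indicator (box c d) x * f x)"
      proof (rule integral_cong_AE)
        show "(\<lambda>x. indicat_real (box c d) x * f' x) \<in> borel_measurable lebesgue"
          using f'(1) by (intro measurable_completion) auto
        show "(\<lambda>x. indicat_real (box c d) x * f x) \<in> borel_measurable lebesgue"
          using f by (intro borel_measurable_times borel_measurable_indicator) auto
        show "AE x in lebesgue. indicat_real (box c d) x * f' x = indicat_real (box c d) x * f x"
          using AE_completion[OF f'(2)] by eventually_elim simp
      qed
      also have "\<dots> = (LINT x|lebesgue. indicator \<Omega> x *\<^sub>R (h (g x * indicator (box p q) x)))"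
      proof (rule Bochner_Integration.integral_cong)
        fix x
        have "x \<in> box p q \<longleftrightarrow> x \<in> box c d \<and> x \<in> box a b" using pq by blast
        then show "indicat_real (box c d) x * f x = indicator \<Omega> x *\<^sub>R (h (g x * indicator (box p q) x))"
          using h sub by (auto simp: f_def indicator_def)
      qed simp
      also have "\<dots> = (LINT x|lebesgue_on \<Omega>. h (g x * indicator (box p q) x))"
        by (rule lebesgue_on_integral[OF m\<Omega>, symmetric])
      also have "\<dots> = h (LINT x|lebesgue_on \<Omega>. g x * indicator (box p q) x)"
      proof (rule integral_bounded_linear[OF h_lin])
        have "indicator (box p q) \<in> L2 \<Omega>"
          by (rule L2_bounded[OF lm _, of _ 1], rule borel_measurable_lebesgue_onI,
              rule borel_measurable_indicator) (simp_all add: indicator_def)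
        from L2_mult_integrable[OF g this]
        show "integrable (lebesgue_on \<Omega>) (\<lambda>x. g x * indicator (box p q) x)" .
      qed
      also have "(LINT x|lebesgue_on \<Omega>. g x * indicator (box p q) x) = 0"
      proof (cases "box p q = {}")
        case False
        have "box p q \<subseteq> cbox a b" using pq box_subset_cbox by blast
        then have "closure (box p q) \<subseteq> cbox a b" by (intro closure_minimal) auto
        then have "cbox p q \<subseteq> \<Omega>" using closure_box[OF False] ab by simp
        then show ?thesis by (rule box)
      qed simp
      finally show "(LINT x|lborel. indicator (box c d) x * f' x) = 0" using h by auto
    qed
    with f'(2) have "AE x in lborel. x \<in> box a b \<longrightarrow> h (g x) = 0"
      by eventually_elim (auto simp: f_def)
    then show ?thesis by (rule AE_completion)
  qed
  have cb: "AE x in lebesgue. x \<in> cbox a b \<longrightarrow> g x = 0" if ab: "cbox a b \<subseteq> \<Omega>" for a b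
  proof -
    have "cbox a b - box a b \<in> null_sets lebesgue"
      using negligible_frontier_interval[of a b] by (simp add: negligible_iff_null_sets)
    then have "AE x in lebesgue. x \<notin> cbox a b - box a b" by (rule AE_not_in)
    with part[OF ab, of Re] part[OF ab, of Im] show ?thesis
      by (auto simp: complex_eq_iff elim: AE_mp)
  qed
  obtain \<D> where D: "countable \<D>" "\<D> \<subseteq> Pow \<Omega>" "\<And>X. X \<in> \<D> \<Longrightarrow> \<exists>a b. X = cbox a b" "\<Union>\<D> = \<Omega>"
    using open_countable_Union_open_cbox[OF \<Omega>(1)] by metis
  have "AE x in lebesgue. \<forall>X\<in>\<D>. x \<in> X \<longrightarrow> g x = 0"
    unfolding AE_ball_countable[OF D(1)]
  proof
    fix X assume X: "X \<in> \<D>"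
    then obtain a b where "X = cbox a b" using D(3) by blast
    with X D(2) cb show "AE x in lebesgue. x \<in> X \<longrightarrow> g x = 0" by auto
  qed
  then have "AE x in lebesgue. x \<in> \<Omega> \<longrightarrow> g x = 0"
    by eventually_elim (use D(4) in blast)
  then show ?thesis using m\<Omega> by (subst AE_restrict_space_iff) auto
qed

section \<open>Test functions as elements of L2\<close>

lemma closure_support_bounded_continuous:
  fixes f :: "'a::topological_space \<Rightarrow> complex"
  assumes "continuous_on UNIV f" "compact K" "\<And>x. x \<notin> K \<Longrightarrow> f x = 0"
  shows "\<exists>B. \<forall>x. cmod (f x) \<le> B"
proof -
  have "bounded (f ` K)"
    using assms by (intro compact_imp_bounded compact_continuous_image) (auto intro: continuous_on_subset)
  then obtain B where B: "\<And>x. x \<in> K \<Longrightarrow> cmod (f x) \<le> B" by (auto simp: bounded_iff)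
  have "cmod (f x) \<le> max B 0" for x using B[of x] assms(3)[of x] by (cases "x \<in> K") auto
  then show ?thesis by blast
qed

lemma test_function_support:
  assumes "\<phi> \<in> test_functions \<Omega>"
  shows "compact (closure {x. \<phi> x \<noteq> 0})" "closure {x. \<phi> x \<noteq> 0} \<subseteq> \<Omega>"
  using assms by (auto simp: test_functions_def)

lemma test_function_differentiable:
  assumes "\<phi> \<in> test_functions \<Omega>"
  shows "\<phi> differentiable (at x)" "continuous_on UNIV \<phi>" "continuous_on UNIV (partial_deriv i \<phi>)"
proof -
  have "continuously_diff (Suc 0) \<phi>" "continuously_diff 0 \<phi>"
    using assms by (simp_all only: test_functions_def mem_Collect_eq)
  then show "\<phi> differentiable (at x)" "continuous_on UNIV \<phi>" "continuous_on UNIV (partial_deriv i \<phi>)"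
    by simp_all
qed

lemma partial_deriv_outside_support:
  assumes "x \<notin> closure {x. \<phi> x \<noteq> 0}"
  shows "partial_deriv i \<phi> x = 0"
proof -
  have "((\<lambda>_. 0) has_derivative (\<lambda>_. 0)) (at x)" by simp
  then have "(\<phi> has_derivative (\<lambda>_. 0)) (at x)"
    by (rule has_derivative_transform_within_open[of _ _ _ _ "- closure {x. \<phi> x \<noteq> 0}"])
       (use assms closure_subset[of "{x. \<phi> x \<noteq> 0}"] in auto)
  then show ?thesis by (simp add: partial_deriv_def frechet_derivative_at[symmetric])
qed

lemma test_function_bounded:
  assumes "\<phi> \<in> test_functions \<Omega>"
  shows "\<exists>B. \<forall>x. cmod (\<phi> x) \<le> B" "\<exists>B. \<forall>x. cmod (partial_deriv i \<phi> x) \<le> B"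
  using closure_subset[of "{x. \<phi> x \<noteq> 0}"]
  by (intro closure_support_bounded_continuous[OF _ test_function_support(1)[OF assms]]
      test_function_differentiable[OF assms]; auto intro: partial_deriv_outside_support)+

lemma L2_bounded_continuous:
  assumes "open \<Omega>" "bounded \<Omega>" "continuous_on UNIV f" "\<exists>B. \<forall>x. cmod (f x) \<le> B"
  shows "f \<in> L2 \<Omega>"
proof -
  obtain B where "\<And>x. cmod (f x) \<le> B" using assms(4) by blast
  moreover have "f \<in> borel_measurable (lebesgue_on \<Omega>)"
    by (rule borel_measurable_lebesgue_onI[OF borel_measurable_continuous_onI[OF assms(3)]])
  ultimately show ?thesis using assms by (intro L2_bounded[of _ _ B]) (auto simp: lmeasurable_open)
qed

lemma test_function_L2:
  assumes "open \<Omega>" "bounded \<Omega>" "\<phi> \<in> test_functions \<Omega>"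
  shows "\<phi> \<in> L2 \<Omega>" "partial_deriv i \<phi> \<in> L2 \<Omega>"
  using assms by (intro L2_bounded_continuous test_function_differentiable test_function_bounded; simp)+

text \<open>The conjugates on the test functions cancel the one inside \<open>L2_inner\<close>.
  Linearity and closedness of weak differentiation thereby reduce to facts about the form.\<close>

lemma is_weak_partial_iff_L2_inner:
  "is_weak_partial \<Omega> i u g \<longleftrightarrow> (\<forall>\<phi>\<in>test_functions \<Omega>.
     L2_inner \<Omega> u (\<lambda>x. cnj (partial_deriv i \<phi> x)) = - L2_inner \<Omega> g (\<lambda>x. cnj (\<phi> x)))"
  by (simp add: is_weak_partial_def L2_inner_def)

section \<open>The Sobolev space as a Hilbert space\<close>

locale bounded_open =
  fixes \<Omega> :: "(real^'n) set"
  assumes open_dom: "open \<Omega>" and bounded_dom: "bounded \<Omega>"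
begin

lemma lmeasurable_dom: "\<Omega> \<in> lmeasurable"
  using open_dom bounded_dom by (rule lmeasurable_open[rotated])

lemma lebesgue_dom: "\<Omega> \<in> sets lebesgue"
  using lmeasurable_dom by auto

lemma test_L2 [simp]:
  assumes "\<phi> \<in> test_functions \<Omega>"
  shows "(\<lambda>x. cnj (\<phi> x)) \<in> L2 \<Omega>" "(\<lambda>x. cnj (partial_deriv i \<phi> x)) \<in> L2 \<Omega>"
  using test_function_L2[OF open_dom bounded_dom assms] by (auto intro: L2_cnj)

lemma is_weak_partial_add:
  assumes "u \<in> L2 \<Omega>" "v \<in> L2 \<Omega>" "g \<in> L2 \<Omega>" "h \<in> L2 \<Omega>"
    "is_weak_partial \<Omega> i u g" "is_weak_partial \<Omega> i v h"
  shows "is_weak_partial \<Omega> i (u + v) (g + h)"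
  using assms by (simp add: is_weak_partial_iff_L2_inner L2.form_add)

lemma is_weak_partial_scale:
  assumes "u \<in> L2 \<Omega>" "g \<in> L2 \<Omega>" "is_weak_partial \<Omega> i u g"
  shows "is_weak_partial \<Omega> i (cscale c u) (cscale c g)"
  using assms by (simp add: is_weak_partial_iff_L2_inner L2.form_scale)

lemma is_weak_partial_zero: "is_weak_partial \<Omega> i 0 0"
  by (simp add: is_weak_partial_iff_L2_inner L2.form_zero)

text \<open>Both sides of the defining identity are continuous in \<open>L2\<close>, so weak
  differentiation is a closed operator; completeness of \<open>W12\<close> rests on this.\<close>

lemma is_weak_partial_tendsto:
  assumes "\<And>m. u m \<in> L2 \<Omega>" "\<And>m. g m \<in> L2 \<Omega>" "v \<in> L2 \<Omega>" "h \<in> L2 \<Omega>"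
    "\<And>m. is_weak_partial \<Omega> i (u m) (g m)"
    "(\<lambda>m. L2.sq \<Omega> (u m - v)) \<longlonglongrightarrow> 0"
    "(\<lambda>m. L2.sq \<Omega> (g m - h)) \<longlonglongrightarrow> 0"
  shows "is_weak_partial \<Omega> i v h"
  unfolding is_weak_partial_iff_L2_inner
proof
  fix \<phi> assume \<phi>: "\<phi> \<in> test_functions \<Omega>"
  have "(\<lambda>m. L2_inner \<Omega> (u m) (\<lambda>x. cnj (partial_deriv i \<phi> x)))
      \<longlonglongrightarrow> L2_inner \<Omega> v (\<lambda>x. cnj (partial_deriv i \<phi> x))"
    by (rule L2.form_tendsto) (use assms \<phi> in auto)
  moreover have "(\<lambda>m. - L2_inner \<Omega> (g m) (\<lambda>x. cnj (\<phi> x))) \<longlonglongrightarrow> - L2_inner \<Omega> h (\<lambda>x. cnj (\<phi> x))"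
    by (intro tendsto_minus L2.form_tendsto) (use assms \<phi> in auto)
  moreover have "L2_inner \<Omega> (u m) (\<lambda>x. cnj (partial_deriv i \<phi> x)) = - L2_inner \<Omega> (g m) (\<lambda>x. cnj (\<phi> x))" for m
    using assms(5) \<phi> by (simp add: is_weak_partial_iff_L2_inner)
  ultimately show "L2_inner \<Omega> v (\<lambda>x. cnj (partial_deriv i \<phi> x)) = - L2_inner \<Omega> h (\<lambda>x. cnj (\<phi> x))"
    using LIMSEQ_unique by auto
qed

lemma is_weak_partial_unique:
  assumes "g \<in> L2 \<Omega>" "h \<in> L2 \<Omega>" "is_weak_partial \<Omega> i u g" "is_weak_partial \<Omega> i u h"
  shows "AE x in lebesgue_on \<Omega>. g x = h x"
proof -
  have "AE x in lebesgue_on \<Omega>. (g - h) x = 0"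
  proof (rule du_Bois_Reymond[OF open_dom bounded_dom])
    show "g - h \<in> L2 \<Omega>" using assms by auto
    fix \<phi> assume \<phi>: "\<phi> \<in> test_functions \<Omega>"
    have "L2_inner \<Omega> (g - h) (\<lambda>x. cnj (\<phi> x)) = 0"
      using assms \<phi> by (simp add: is_weak_partial_iff_L2_inner L2.form_diff)
    then show "(LINT x|lebesgue_on \<Omega>. (g - h) x * \<phi> x) = 0" by (simp add: L2_inner_def)
  qed
  then show ?thesis by eventually_elim simp
qed

lemma W12_L2: "u \<in> W12 \<Omega> \<Longrightarrow> u \<in> L2 \<Omega>"
  by (simp add: W12_def)

lemma W12_I: "\<lbrakk>u \<in> L2 \<Omega>; \<And>i. g i \<in> L2 \<Omega>; \<And>i. is_weak_partial \<Omega> i u (g i)\<rbrakk> \<Longrightarrow> u \<in> W12 \<Omega>"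
  by (auto simp: W12_def)

lemma weak_partial:
  assumes "u \<in> W12 \<Omega>"
  shows "weak_partial \<Omega> i u \<in> L2 \<Omega>" "is_weak_partial \<Omega> i u (weak_partial \<Omega> i u)"
proof -
  have "\<exists>g. g \<in> L2 \<Omega> \<and> is_weak_partial \<Omega> i u g" using assms by (auto simp: W12_def)
  from someI_ex[OF this] show "weak_partial \<Omega> i u \<in> L2 \<Omega>" "is_weak_partial \<Omega> i u (weak_partial \<Omega> i u)"
    by (simp_all add: weak_partial_def)
qed

lemma weak_partial_AE_eq:
  assumes "u \<in> W12 \<Omega>" "g \<in> L2 \<Omega>" "is_weak_partial \<Omega> i u g"
  shows "AE x in lebesgue_on \<Omega>. weak_partial \<Omega> i u x = g x"
  using is_weak_partial_unique[OF weak_partial(1) _ weak_partial(2)] assms by blast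

lemma W12_add:
  assumes "u \<in> W12 \<Omega>" "v \<in> W12 \<Omega>"
  shows "u + v \<in> W12 \<Omega>"
    and "is_weak_partial \<Omega> i (u + v) (weak_partial \<Omega> i u + weak_partial \<Omega> i v)"
proof -
  show weak: "is_weak_partial \<Omega> i (u + v) (weak_partial \<Omega> i u + weak_partial \<Omega> i v)" for i
    by (rule is_weak_partial_add[OF assms[THEN W12_L2] assms[THEN weak_partial(1)] assms[THEN weak_partial(2)]])
  show "u + v \<in> W12 \<Omega>"
    by (rule W12_I[OF L2_add[OF assms[THEN W12_L2]] L2_add[OF assms[THEN weak_partial(1)]] weak])
qed

lemma W12_scale:
  assumes "u \<in> W12 \<Omega>"
  shows "cscale c u \<in> W12 \<Omega>"
    and "is_weak_partial \<Omega> i (cscale c u) (cscale c (weak_partial \<Omega> i u))"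
proof -
  show weak: "is_weak_partial \<Omega> i (cscale c u) (cscale c (weak_partial \<Omega> i u))" for i
    by (rule is_weak_partial_scale[OF assms[THEN W12_L2] assms[THEN weak_partial(1)] assms[THEN weak_partial(2)]])
  show "cscale c u \<in> W12 \<Omega>"
    by (rule W12_I[OF L2_scale[OF assms[THEN W12_L2]] L2_scale[OF assms[THEN weak_partial(1)]] weak])
qed

lemma W12_zero: "0 \<in> W12 \<Omega>"
  by (rule W12_I[OF L2_zero L2_zero is_weak_partial_zero])

lemma weak_partial_add:
  assumes "u \<in> W12 \<Omega>" "v \<in> W12 \<Omega>"
  shows "AE x in lebesgue_on \<Omega>. weak_partial \<Omega> i (u + v) x = (weak_partial \<Omega> i u + weak_partial \<Omega> i v) x"
  by (rule weak_partial_AE_eq[OF W12_add(1)[OF assms] L2_add[OF assms[THEN weak_partial(1)]] W12_add(2)[OF assms]])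

lemma weak_partial_scale:
  assumes "u \<in> W12 \<Omega>"
  shows "AE x in lebesgue_on \<Omega>. weak_partial \<Omega> i (cscale c u) x = cscale c (weak_partial \<Omega> i u) x"
  by (rule weak_partial_AE_eq[OF W12_scale(1)[OF assms] L2_scale[OF weak_partial(1)[OF assms]] W12_scale(2)[OF assms]])

lemma dirichlet_form_eq_sum:
  assumes "u \<in> W12 \<Omega>" "v \<in> W12 \<Omega>"
  shows "dirichlet_form \<Omega> u v = (\<Sum>i\<in>UNIV. L2_inner \<Omega> (weak_partial \<Omega> i u) (weak_partial \<Omega> i v))"
  unfolding dirichlet_form_def L2_inner_def
  using assms by (intro Bochner_Integration.integral_sum L2_mult_cnj_integrable weak_partial)

text \<open>Frees the Dirichlet form from the choice made in \<open>weak_partial\<close>: any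
  representatives of the gradients may be inserted, in particular sums and multiples of chosen
  ones.\<close>

lemma dirichlet_form_eqI:
  assumes "u \<in> W12 \<Omega>" "v \<in> W12 \<Omega>" "\<And>i. g i \<in> L2 \<Omega>" "\<And>i. h i \<in> L2 \<Omega>"
    "\<And>i. AE x in lebesgue_on \<Omega>. weak_partial \<Omega> i u x = g i x"
    "\<And>i. AE x in lebesgue_on \<Omega>. weak_partial \<Omega> i v x = h i x"
  shows "dirichlet_form \<Omega> u v = (\<Sum>i\<in>UNIV. L2_inner \<Omega> (g i) (h i))"
  unfolding dirichlet_form_eq_sum[OF assms(1,2)]
  by (intro sum.cong refl L2_inner_cong_AE weak_partial assms)

lemma hermitian_form_dirichlet_form: "hermitian_form cscale (W12 \<Omega>) (dirichlet_form \<Omega>)"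
proof -
  interpret vector_space cscale by (rule vector_space_cscale)
  show ?thesis
  proof
    show "subspace (W12 \<Omega>)" by (simp add: subspace_def W12_add W12_scale W12_zero)
  next
    fix u v w assume *: "u \<in> W12 \<Omega>" "v \<in> W12 \<Omega>" "w \<in> W12 \<Omega>"
    have "dirichlet_form \<Omega> (u + v) w
        = (\<Sum>i\<in>UNIV. L2_inner \<Omega> (weak_partial \<Omega> i u + weak_partial \<Omega> i v) (weak_partial \<Omega> i w))"
      by (rule dirichlet_form_eqI[OF W12_add(1)[OF *(1,2)] *(3) L2_add weak_partial(1)[OF *(3)]
            weak_partial_add[OF *(1,2)]]) (auto intro: weak_partial(1) *)
    also have "\<dots> = dirichlet_form \<Omega> u w + dirichlet_form \<Omega> v w"
      using * by (simp add: dirichlet_form_eq_sum L2.form_add weak_partial sum.distrib)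
    finally show "dirichlet_form \<Omega> (u + v) w = dirichlet_form \<Omega> u w + dirichlet_form \<Omega> v w" .
  next
    fix u w c assume *: "u \<in> W12 \<Omega>" "w \<in> W12 \<Omega>"
    have "dirichlet_form \<Omega> (cscale c u) w
        = (\<Sum>i\<in>UNIV. L2_inner \<Omega> (cscale c (weak_partial \<Omega> i u)) (weak_partial \<Omega> i w))"
      by (rule dirichlet_form_eqI[OF W12_scale(1)[OF *(1)] *(2) L2_scale weak_partial(1)[OF *(2)]
            weak_partial_scale[OF *(1)]]) (auto intro: weak_partial(1) *)
    also have "\<dots> = c * dirichlet_form \<Omega> u w"
      using * by (simp add: dirichlet_form_eq_sum L2.form_scale weak_partial sum_distrib_left)
    finally show "dirichlet_form \<Omega> (cscale c u) w = c * dirichlet_form \<Omega> u w" .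
  next
    fix u v assume *: "u \<in> W12 \<Omega>" "v \<in> W12 \<Omega>"
    show "dirichlet_form \<Omega> v u = cnj (dirichlet_form \<Omega> u v)"
      using * by (simp add: dirichlet_form_eq_sum)
        (intro sum.cong refl L2.form_herm weak_partial)
  next
    fix u assume "u \<in> W12 \<Omega>"
    then show "0 \<le> Re (dirichlet_form \<Omega> u u)"
      by (simp add: dirichlet_form_eq_sum L2.form_nonneg weak_partial sum_nonneg)
  qed
qed

sublocale dirichlet: hermitian_form cscale "W12 \<Omega>" "dirichlet_form \<Omega>"
  by (rule hermitian_form_dirichlet_form)

lemma hermitian_form_L2_W12: "hermitian_form cscale (W12 \<Omega>) (L2_inner \<Omega>)"
proof unfold_locales
  fix u v assume "u \<in> W12 \<Omega>" "v \<in> W12 \<Omega>"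
  then show "L2_inner \<Omega> v u = cnj (L2_inner \<Omega> u v)" by (intro L2.form_herm W12_L2)
qed (simp_all add: dirichlet.V L2.form_add L2.form_scale W12_L2 L2.form_nonneg)

lemma W12_norm_eq:
  assumes "u \<in> W12 \<Omega>"
  shows "W12_norm \<Omega> u = sqrt (dirichlet.sq u + L2.sq \<Omega> u)"
proof -
  have int: "integrable (lebesgue_on \<Omega>) (\<lambda>x. (cmod (weak_partial \<Omega> i u x))\<^sup>2)" for i
    by (rule L2_integrable[OF weak_partial(1)[OF assms]])
  have "(LINT x|lebesgue_on \<Omega>. (\<Sum>i\<in>UNIV. (cmod (weak_partial \<Omega> i u x))\<^sup>2) + (cmod (u x))\<^sup>2)
      = (\<Sum>i\<in>UNIV. LINT x|lebesgue_on \<Omega>. (cmod (weak_partial \<Omega> i u x))\<^sup>2) + (LINT x|lebesgue_on \<Omega>. (cmod (u x))\<^sup>2)"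
    by (subst Bochner_Integration.integral_add, intro Bochner_Integration.integrable_sum int,
        rule L2_integrable[OF W12_L2[OF assms]], subst Bochner_Integration.integral_sum) (auto intro: int)
  then show ?thesis
    using assms by (simp add: W12_norm_def dirichlet_form_eq_sum L2_inner_same)
qed

lemma W12_complete:
  assumes u: "\<And>m. u m \<in> W12 \<Omega>"
    and Cauchy: "\<And>\<epsilon>. \<epsilon> > 0 \<Longrightarrow> \<exists>N. \<forall>m\<ge>N. \<forall>l\<ge>N.
      dirichlet.sq (u m - u l) + L2.sq \<Omega> (u m - u l) < \<epsilon>"
  shows "\<exists>w\<in>W12 \<Omega>. (\<lambda>m. dirichlet.sq (u m - w) + L2.sq \<Omega> (u m - w)) \<longlonglongrightarrow> 0"
proof -
  \<comment> \<open>The weak partials \<open>g i\<close> of \<open>w\<close> are arbitrary, because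
    those of the limit arise below as \<open>L2\<close> limits and not as chosen ones.\<close>
  have diff_form: "dirichlet.sq (v - w)
      = (\<Sum>i\<in>UNIV. L2.sq \<Omega> (weak_partial \<Omega> i v - g i))"
    if "v \<in> W12 \<Omega>" "w \<in> W12 \<Omega>" "\<And>i. g i \<in> L2 \<Omega>" "\<And>i. is_weak_partial \<Omega> i w (g i)" for v w g
  proof -
    have vw: "v - w = v + cscale (-1) w" "weak_partial \<Omega> i v - g i = weak_partial \<Omega> i v + cscale (-1) (g i)" for i
      by (auto simp: fun_eq_iff)
    have AE: "AE x in lebesgue_on \<Omega>. weak_partial \<Omega> i (v - w) x = (weak_partial \<Omega> i v - g i) x" for i
      unfolding vw
    proof (rule weak_partial_AE_eq)
      show "v + cscale (-1) w \<in> W12 \<Omega>" using that by (intro W12_add W12_scale)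
      show "weak_partial \<Omega> i v + cscale (-1) (g i) \<in> L2 \<Omega>"
        by (rule L2_add[OF weak_partial(1)[OF that(1)] L2_scale[OF that(3)]])
      show "is_weak_partial \<Omega> i (v + cscale (-1) w) (weak_partial \<Omega> i v + cscale (-1) (g i))"
        by (rule is_weak_partial_add[OF W12_L2[OF that(1)] L2_scale[OF W12_L2[OF that(2)]]
              weak_partial(1)[OF that(1)] L2_scale[OF that(3)] weak_partial(2)[OF that(1)]
              is_weak_partial_scale[OF W12_L2[OF that(2)] that(3,4)]])
    qed
    have "dirichlet_form \<Omega> (v - w) (v - w)
      = (\<Sum>i\<in>UNIV. L2_inner \<Omega> (weak_partial \<Omega> i v - g i) (weak_partial \<Omega> i v - g i))"
      by (rule dirichlet_form_eqI[OF _ _ _ _ AE AE])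
         (intro dirichlet.V_closed(4) L2.V_closed(4) weak_partial(1)[OF that(1)] that)+
    then show ?thesis by simp
  qed
  have uL: "u m \<in> L2 \<Omega>" for m using u by (rule W12_L2)
  have L: "\<exists>N. \<forall>m\<ge>N. \<forall>l\<ge>N. L2.sq \<Omega> (u m - u l) < \<epsilon>" if "\<epsilon> > 0" for \<epsilon>
  proof -
    have "0 \<le> dirichlet.sq (u m - u l)" for m l
      using u by (intro dirichlet.form_nonneg) auto
    then have le: "L2.sq \<Omega> (u m - u l)
        \<le> dirichlet.sq (u m - u l) + L2.sq \<Omega> (u m - u l)" for m l
      by simp
    obtain N where "\<forall>m\<ge>N. \<forall>l\<ge>N.
      dirichlet.sq (u m - u l) + L2.sq \<Omega> (u m - u l) < \<epsilon>"
      using Cauchy[OF \<open>\<epsilon> > 0\<close>] by blast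
    then show ?thesis using order.strict_trans1[OF le] by blast
  qed
  obtain w where w: "w \<in> L2 \<Omega>" "(\<lambda>m. L2.sq \<Omega> (u m - w)) \<longlonglongrightarrow> 0"
    using L2_complete[OF uL L] by blast
  have "\<exists>g\<in>L2 \<Omega>. (\<lambda>m. L2.sq \<Omega> (weak_partial \<Omega> i (u m) - g)) \<longlonglongrightarrow> 0" for i
  proof (rule L2_complete)
    show "weak_partial \<Omega> i (u m) \<in> L2 \<Omega>" for m by (rule weak_partial[OF u])
    fix \<epsilon> :: real assume "\<epsilon> > 0"
    then obtain N where N: "\<forall>m\<ge>N. \<forall>l\<ge>N.
      dirichlet.sq (u m - u l) + L2.sq \<Omega> (u m - u l) < \<epsilon>"
      using Cauchy by blast
    have le: "L2.sq \<Omega> (weak_partial \<Omega> i (u m) - weak_partial \<Omega> i (u l))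
        \<le> dirichlet.sq (u m - u l) + L2.sq \<Omega> (u m - u l)" for m l
    proof -
      have "0 \<le> L2.sq \<Omega> (u m - u l)" using uL by (intro L2.form_nonneg) auto
      moreover have "L2.sq \<Omega> (weak_partial \<Omega> i (u m) - weak_partial \<Omega> i (u l))
        \<le> dirichlet.sq (u m - u l)"
        unfolding diff_form[OF u u weak_partial(1)[OF u] weak_partial(2)[OF u]]
      proof (rule member_le_sum)
        show "0 \<le> L2.sq \<Omega> (weak_partial \<Omega> j (u m) - weak_partial \<Omega> j (u l))" for j
          by (rule L2.form_nonneg[OF L2.V_closed(4)[OF weak_partial(1)[OF u] weak_partial(1)[OF u]]])
      qed auto
      ultimately show ?thesis by linarith
    qed
    show "\<exists>N. \<forall>m\<ge>N. \<forall>l\<ge>N. L2.sq \<Omega> (weak_partial \<Omega> i (u m) - weak_partial \<Omega> i (u l)) < \<epsilon>"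
      using N order.strict_trans1[OF le] by blast
  qed
  then have "\<forall>i. \<exists>g. g \<in> L2 \<Omega> \<and>
      (\<lambda>m. L2.sq \<Omega> (weak_partial \<Omega> i (u m) - g)) \<longlonglongrightarrow> 0"
    by (simp only: Bex_def) blast
  then obtain g where g: "\<And>i. g i \<in> L2 \<Omega>"
    "\<And>i. (\<lambda>m. L2.sq \<Omega> (weak_partial \<Omega> i (u m) - g i)) \<longlonglongrightarrow> 0"
    unfolding choice_iff by blast
  have wp: "is_weak_partial \<Omega> i w (g i)" for i
    by (rule is_weak_partial_tendsto[OF uL weak_partial(1)[OF u] w(1) g(1) weak_partial(2)[OF u] w(2) g(2)])
  have wW: "w \<in> W12 \<Omega>" by (rule W12_I[OF w(1) g(1) wp])
  have "(\<lambda>m. (\<Sum>i\<in>UNIV. L2.sq \<Omega> (weak_partial \<Omega> i (u m) - g i))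
      + L2.sq \<Omega> (u m - w)) \<longlonglongrightarrow> (\<Sum>i\<in>(UNIV::'n set). 0) + 0"
    by (intro tendsto_add tendsto_sum g(2) w(2))
  then show ?thesis using wW by (intro bexI[of _ w]) (simp_all only: diff_form[OF u wW g(1) wp] sum.neutral_const add_0_left)
qed

lemma W12_compact:
  assumes "compact_embedding \<Omega>" and u: "\<And>m. u m \<in> W12 \<Omega>"
    and bound: "\<And>m. dirichlet.sq (u m) + L2.sq \<Omega> (u m) \<le> C"
  shows "\<exists>r :: nat \<Rightarrow> nat. strict_mono r \<and>
    (\<forall>\<epsilon>>0. \<exists>N. \<forall>m\<ge>N. \<forall>l\<ge>N. L2.sq \<Omega> (u (r m) - u (r l)) < \<epsilon>)"
proof -
  have "\<exists>C. \<forall>m. W12_norm \<Omega> (u m) \<le> C"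
  proof (intro exI allI)
    show "W12_norm \<Omega> (u m) \<le> sqrt C" for m
      unfolding W12_norm_eq[OF u] by (rule real_sqrt_le_mono[OF bound])
  qed
  with u have "(\<forall>m. u m \<in> W12 \<Omega>) \<and> (\<exists>C. \<forall>m. W12_norm \<Omega> (u m) \<le> C)" by simp
  from assms(1)[unfolded compact_embedding_def, THEN spec, THEN mp, OF this]
  obtain r v where r: "strict_mono (r :: nat \<Rightarrow> nat)" and v: "v \<in> L2 \<Omega>"
    and lim: "(\<lambda>m. L2_norm \<Omega> (\<lambda>x. u (r m) x - v x)) \<longlonglongrightarrow> 0"
    by blast
  have uL: "u m \<in> L2 \<Omega>" for m using u by (rule W12_L2)
  have "(\<lambda>m. (L2_norm \<Omega> (\<lambda>x. u (r m) x - v x))\<^sup>2) \<longlonglongrightarrow> 0\<^sup>2"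
    by (intro tendsto_power lim)
  moreover have "(L2_norm \<Omega> (\<lambda>x. u (r m) x - v x))\<^sup>2 = L2.sq \<Omega> (u (r m) - v)" for m
    by (simp add: L2_norm_def L2_inner_same)
  ultimately have lim': "(\<lambda>m. L2.sq \<Omega> (u (r m) - v)) \<longlonglongrightarrow> 0" by simp
  have "\<exists>N. \<forall>m\<ge>N. \<forall>l\<ge>N. L2.sq \<Omega> (u (r m) - u (r l)) < \<epsilon>" if "\<epsilon> > 0" for \<epsilon>
  proof -
    obtain N where N: "\<And>m. m \<ge> N \<Longrightarrow> L2.sq \<Omega> (u (r m) - v) < \<epsilon> / 4"
      using order_tendstoD(2)[OF lim', of "\<epsilon> / 4"] \<open>\<epsilon> > 0\<close> unfolding eventually_sequentially by auto
    have "L2.sq \<Omega> (u (r m) - u (r l)) < \<epsilon>" if "m \<ge> N" "l \<ge> N" for m l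
    proof -
      \<comment> \<open>The embedding yields an \<open>L2\<close> limit \<open>v\<close> that may
        lie outside \<open>W12\<close>; measuring from \<open>v\<close> turns convergence into the
        Cauchy property.\<close>
      define p q where "p = u (r m) - v" and "q = u (r l) - v"
      have pq: "p \<in> L2 \<Omega>" "q \<in> L2 \<Omega>" using uL v by (auto simp: p_def q_def)
      have "u (r m) - u (r l) = p - q" by (simp add: p_def q_def)
      then have "L2.sq \<Omega> (u (r m) - u (r l))
          \<le> 2 * L2.sq \<Omega> p + 2 * L2.sq \<Omega> q"
        using L2.parallelogram[OF pq] L2.form_nonneg[of "p + q" \<Omega>] pq by auto
      then show ?thesis using N[OF that(1)] N[OF that(2)] by (simp add: p_def q_def)
    qed
    then show ?thesis by blast
  qed
  then show ?thesis using r by blast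
qed

end

section \<open>Isometries and Lipschitz functions\<close>

text \<open>A Fubini argument: both sides of \<open>M A \<cdot> \<lambda> B = M B \<cdot> \<lambda> A\<close> are the integral of
  \<open>1\<^sub>A(x) 1\<^sub>B(y + x)\<close> with respect to \<open>M \<otimes> \<lambda>\<close>.\<close>

lemma translation_invariant_eq_lborel:
  fixes M :: "'a::euclidean_space measure"
  assumes sets [measurable_cong]: "sets M = sets borel" and sf: "sigma_finite_measure M"
    and inv: "\<And>a. distr M borel ((+) a) = M"
    and B [measurable]: "B \<in> sets borel"
    and B_eq: "emeasure M B = emeasure lborel B" "emeasure lborel B \<noteq> 0" "emeasure lborel B \<noteq> \<infinity>"
  shows "M = lborel"
proof (rule measure_eqI)
  show "sets M = sets lborel" using sets by simp
  interpret sigma_finite_measure M by (rule sf)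
  interpret P: pair_sigma_finite M lborel ..
  have shift: "(\<integral>\<^sup>+x. f (a + x) \<partial>N) = (\<integral>\<^sup>+x. f x \<partial>N)"
    if [measurable]: "f \<in> borel_measurable borel" and N: "sets N = sets borel" "distr N borel ((+) a) = N"
    for f :: "'a \<Rightarrow> ennreal" and a N
  proof -
    have "(\<integral>\<^sup>+x. f x \<partial>N) = (\<integral>\<^sup>+x. f x \<partial>distr N borel ((+) a))" by (simp add: N(2))
    also have "\<dots> = (\<integral>\<^sup>+x. f (a + x) \<partial>N)"
      by (rule nn_integral_distr) (auto simp: measurable_cong_sets[OF N(1) refl])
    finally show ?thesis by simp
  qed
  fix A assume "A \<in> sets M"
  then have A [measurable]: "A \<in> sets borel" using sets by simp
  define f where "f = (\<lambda>x y. indicator A x * indicator B (y + x) :: ennreal)"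
  have "emeasure M A * emeasure lborel B = (\<integral>\<^sup>+x. indicator A x * emeasure lborel B \<partial>M)"
    using sets by (simp add: nn_integral_multc)
  also have "\<dots> = (\<integral>\<^sup>+x. \<integral>\<^sup>+y. f x y \<partial>lborel \<partial>M)"
  proof (intro nn_integral_cong)
    fix x
    have "(\<integral>\<^sup>+y. f x y \<partial>lborel) = indicator A x * (\<integral>\<^sup>+y. indicator B (x + y) \<partial>lborel)"
      unfolding f_def by (subst nn_integral_cmult[symmetric]) (auto simp: add.commute)
    also have "(\<integral>\<^sup>+y. indicator B (x + y) \<partial>lborel) = emeasure lborel B"
      by (subst shift) (auto simp: lborel_distr_plus)
    finally show "indicator A x * emeasure lborel B = (\<integral>\<^sup>+y. f x y \<partial>lborel)" by simp
  qed
  also have "\<dots> = (\<integral>\<^sup>+y. \<integral>\<^sup>+x. f x y \<partial>M \<partial>lborel)"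
    unfolding f_def by (rule P.Fubini'[symmetric]) measurable
  also have "\<dots> = (\<integral>\<^sup>+y. \<integral>\<^sup>+x. indicator A (x - y) * indicator B x \<partial>M \<partial>lborel)"
  proof (rule nn_integral_cong)
    fix y
    have "(\<integral>\<^sup>+x. f x y \<partial>M) = (\<integral>\<^sup>+x. indicator A ((y + x) - y) * indicator B (y + x) \<partial>M)"
      by (simp add: f_def)
    also have "\<dots> = (\<integral>\<^sup>+x. indicator A (x - y) * indicator B x \<partial>M)"
      by (rule shift[of "\<lambda>x. indicator A (x - y) * indicator B x"]) (use sets inv in auto)
    finally show "(\<integral>\<^sup>+x. f x y \<partial>M) = (\<integral>\<^sup>+x. indicator A (x - y) * indicator B x \<partial>M)" .
  qed
  also have "\<dots> = (\<integral>\<^sup>+x. \<integral>\<^sup>+y. indicator A (x - y) * indicator B x \<partial>lborel \<partial>M)"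
    by (rule P.Fubini') measurable
  also have "\<dots> = (\<integral>\<^sup>+x. indicator B x * emeasure lborel A \<partial>M)"
  proof (intro nn_integral_cong)
    fix x :: 'a
    \<comment> \<open>Reflection \<open>y \<mapsto> x - y\<close> preserves Lebesgue measure, which
      removes the dependence of the inner integral on \<open>x\<close>.\<close>
    have reflect: "distr lborel borel (\<lambda>y. x + (-1) *\<^sub>R y) = lborel"
      using lborel_affine[of "-1" x] by (simp add: density_1 one_ennreal_def[symmetric])
    have "emeasure lborel A = (\<integral>\<^sup>+y. indicator A y \<partial>distr lborel borel (\<lambda>y. x + (-1) *\<^sub>R y))"
      unfolding reflect by simp
    also have "\<dots> = (\<integral>\<^sup>+y. indicator A (x - y) \<partial>lborel)"
      by (subst nn_integral_distr) auto
    finally show "(\<integral>\<^sup>+y. indicator A (x - y) * indicator B x \<partial>lborel) = indicator B x * emeasure lborel A"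
      by (subst nn_integral_multc) (auto simp: mult.commute)
  qed
  also have "\<dots> = emeasure lborel A * emeasure lborel B"
    using sets B_eq(1) by (simp add: nn_integral_multc mult.commute)
  finally show "emeasure M A = emeasure lborel A"
    using B_eq by (auto simp: mult.commute[of _ "emeasure lborel B"] ennreal_mult_cancel_left)
qed

lemma isometry_continuous:
  fixes T :: "'a::metric_space \<Rightarrow> 'b::metric_space"
  assumes "\<And>x y. dist (T x) (T y) = dist x y"
  shows "continuous_on S T"
  unfolding continuous_on_iff assms by blast

lemma isometry_borel:
  fixes T :: "'a::euclidean_space \<Rightarrow> 'a"
  assumes "\<And>x y. dist (T x) (T y) = dist x y"
  shows "T \<in> borel_measurable borel"
  by (rule borel_measurable_continuous_onI[OF isometry_continuous[OF assms]])

text \<open>The image measure is again translation invariant, and the two measures agree on the unit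
  ball, which \<open>A\<close> maps to itself. Uniqueness of invariant measures then
  applies.\<close>

lemma lborel_distr_orthogonal_transformation:
  fixes A :: "'a::euclidean_space \<Rightarrow> 'a"
  assumes A: "orthogonal_transformation A"
  shows "distr lborel borel A = lborel"
proof (rule translation_invariant_eq_lborel)
  have lin: "linear A" using A by (rule orthogonal_transformation_linear)
  have [measurable]: "A \<in> borel_measurable borel"
    using lin by (intro borel_measurable_continuous_onI linear_continuous_on linear_conv_bounded_linear[THEN iffD1])
  have ball: "A -` ball (0::'a) r = ball (0::'a) r" for r
    using orthogonal_transformation_norm[OF A] by auto
  have em: "emeasure (distr lborel borel A) (ball (0::'a) r) = emeasure lborel (ball (0::'a) r)" for r
    by (subst emeasure_distr) (auto simp: ball)
  show "emeasure (distr lborel borel A) (ball (0::'a) 1) = emeasure lborel (ball (0::'a) 1)" by (rule em)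
  show "emeasure lborel (ball (0::'a) 1) \<noteq> 0"
  proof -
    have "unit_ball_vol (real DIM('a)) \<noteq> 0" by (rule less_imp_neq[symmetric]) simp
    then show ?thesis by (simp add: emeasure_ball)
  qed
  show "emeasure lborel (ball (0::'a) 1) \<noteq> \<infinity>"
    using emeasure_lborel_ball_finite[of "0::'a" 1] by simp
  show "sigma_finite_measure (distr lborel borel A)"
  proof (intro sigma_finite_measure.intro exI conjI)
    show "countable (range (\<lambda>n::nat. ball (0::'a) (real n)))" by simp
    show "range (\<lambda>n::nat. ball (0::'a) (real n)) \<subseteq> sets (distr lborel borel A)" by auto
    show "\<Union> (range (\<lambda>n::nat. ball (0::'a) (real n))) = space (distr lborel borel A)"
      by (auto simp: reals_Archimedean2)
    show "\<forall>a\<in>range (\<lambda>n::nat. ball (0::'a) (real n)). emeasure (distr lborel borel A) a \<noteq> \<infinity>"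
      using emeasure_lborel_ball_finite[THEN less_imp_neq, of "0::'a"] by (auto simp: em)
  qed
  fix a :: 'a
  \<comment> \<open>Translation by \<open>a\<close> after \<open>A\<close> equals \<open>A\<close>
    after translation by the preimage \<open>a'\<close> of \<open>a\<close>, so the invariance of
    Lebesgue measure passes to the image.\<close>
  obtain a' where a': "A a' = a" using orthogonal_transformation_surj[OF A] by (metis surjD)
  have "distr (distr lborel borel A) borel ((+) a) = distr lborel borel ((+) a \<circ> A)"
    by (rule distr_distr) auto
  also have "(+) a \<circ> A = A \<circ> (+) a'" using lin by (auto simp: a' linear_add)
  also have "distr lborel borel (A \<circ> (+) a') = distr (distr lborel borel ((+) a')) borel A"
    by (rule distr_distr[symmetric]) auto
  also have "\<dots> = distr lborel borel A" by (simp only: lborel_distr_plus)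
  finally show "distr (distr lborel borel A) borel ((+) a) = distr lborel borel A" .
qed auto

text \<open>Tiles are images under maps only known to preserve distances. Subtracting the value at 0
  leaves an isometry fixing the origin, and such a map is linear.\<close>

lemma isometry_orthogonal:
  fixes T :: "'a::euclidean_space \<Rightarrow> 'a"
  assumes "\<And>x y. dist (T x) (T y) = dist x y"
  obtains A where "orthogonal_transformation A" "T = (\<lambda>x. T 0 + A x)"
proof
  show "orthogonal_transformation (\<lambda>x. T x - T 0)"
    using assms by (simp add: orthogonal_transformation_isometry dist_norm)
qed simp

lemma lborel_distr_isometry:
  fixes T :: "'a::euclidean_space \<Rightarrow> 'a"
  assumes T: "\<And>x y. dist (T x) (T y) = dist x y"
  shows "distr lborel borel T = lborel"
proof -
  obtain A where A: "orthogonal_transformation A" "T = (\<lambda>x. T 0 + A x)"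
    using isometry_orthogonal[OF T] by blast
  have [measurable]: "A \<in> borel_measurable borel"
    using orthogonal_transformation_linear[OF A(1)]
    by (intro borel_measurable_continuous_onI linear_continuous_on linear_conv_bounded_linear[THEN iffD1])
  have "distr lborel borel T = distr lborel borel ((+) (T 0) \<circ> A)" using A(2) by (simp add: comp_def)
  also have "\<dots> = distr (distr lborel borel A) borel ((+) (T 0))"
    by (rule distr_distr[symmetric]) auto
  also have "\<dots> = lborel" by (simp only: lborel_distr_orthogonal_transformation[OF A(1)] lborel_distr_plus)
  finally show ?thesis .
qed

lemma isometry_bij:
  fixes T :: "'a::euclidean_space \<Rightarrow> 'a"
  assumes T: "\<And>x y. dist (T x) (T y) = dist x y"
  shows "bij T"
proof -
  obtain A where A: "orthogonal_transformation A" "T = (\<lambda>x. T 0 + A x)"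
    using isometry_orthogonal[OF T] by blast
  have "inj T" by (rule injI) (metis T dist_eq_0_iff)
  moreover have "\<exists>x. y = T x" for y
  proof -
    obtain x where "A x = y - T 0" using orthogonal_transformation_surj[OF A(1)] by (metis surjD)
    then have "y = T x" by (subst A(2)) simp
    then show ?thesis ..
  qed
  then have "surj T" unfolding surj_def by blast
  ultimately show ?thesis by (simp add: bij_def)
qed

lemma isometry_open_image:
  fixes T :: "'a::euclidean_space \<Rightarrow> 'a"
  assumes T: "\<And>x y. dist (T x) (T y) = dist x y" and "open S"
  shows "open (T ` S)"
proof -
  have b: "bij T" by (rule isometry_bij[OF T])
  have "dist (inv T x) (inv T y) = dist x y" for x y
    using T[of "inv T x" "inv T y"] b by (simp add: bij_is_surj surj_f_inv_f)
  then have "continuous_on UNIV (inv T)" by (rule isometry_continuous)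
  then have "open (inv T -` S)" using assms(2) by (simp add: open_vimage)
  then show ?thesis using b by (simp add: bij_vimage_eq_inv_image[OF bij_imp_bij_inv] inv_inv_eq)
qed

section \<open>Integration by parts for Lipschitz functions\<close>

lemma has_derivative_directional_limit:
  fixes F :: "'a::real_normed_vector \<Rightarrow> 'b::real_normed_vector"
  assumes "(F has_derivative D) (at x)"
  shows "(\<lambda>m. real (Suc m) *\<^sub>R (F (x + inverse (real (Suc m)) *\<^sub>R v) - F x)) \<longlonglongrightarrow> D v"
proof -
  have D: "bounded_linear D" using assms by (rule has_derivative_bounded_linear)
  have "((\<lambda>t. x + t *\<^sub>R v) has_derivative (\<lambda>t. t *\<^sub>R v)) (at 0)"
    by (auto intro!: derivative_eq_intros)
  from has_derivative_compose[OF this, of F D] assms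
  have "((\<lambda>t. F (x + t *\<^sub>R v)) has_derivative (\<lambda>t. D (t *\<^sub>R v))) (at 0)" by simp
  then have "((\<lambda>t. norm (F (x + t *\<^sub>R v) - F x - D (t *\<^sub>R v)) / norm t) \<longlongrightarrow> 0) (at 0)"
    by (simp add: has_derivative_iff_norm)
  moreover have "filterlim (\<lambda>m. inverse (real (Suc m))) (at 0) sequentially"
    by (auto simp: filterlim_at intro!: LIMSEQ_inverse_real_of_nat simp del: of_nat_Suc)
  ultimately have "(\<lambda>m. norm (F (x + inverse (real (Suc m)) *\<^sub>R v) - F x - D (inverse (real (Suc m)) *\<^sub>R v))
      / norm (inverse (real (Suc m)))) \<longlonglongrightarrow> 0"
    by (rule filterlim_compose)
  moreover have "norm (F (x + inverse (real (Suc m)) *\<^sub>R v) - F x - D (inverse (real (Suc m)) *\<^sub>R v))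
      / norm (inverse (real (Suc m)))
      = norm (real (Suc m) *\<^sub>R (F (x + inverse (real (Suc m)) *\<^sub>R v) - F x) - D v)" for m
  proof -
    define c where "c = real (Suc m)"
    have c: "c > 0" by (simp add: c_def)
    have "c *\<^sub>R (F (x + inverse c *\<^sub>R v) - F x) - D v
        = c *\<^sub>R (F (x + inverse c *\<^sub>R v) - F x - D (inverse c *\<^sub>R v))"
      using c by (simp add: scaleR_right_diff_distrib linear_simps(5)[OF D])
    then have "norm (c *\<^sub>R (F (x + inverse c *\<^sub>R v) - F x) - D v)
        = c * norm (F (x + inverse c *\<^sub>R v) - F x - D (inverse c *\<^sub>R v))"
      using c by simp
    then show ?thesis using c unfolding c_def[symmetric] by (simp add: divide_inverse mult.commute)
  qed
  ultimately have "(\<lambda>m. norm (real (Suc m) *\<^sub>R (F (x + inverse (real (Suc m)) *\<^sub>R v) - F x) - D v)) \<longlonglongrightarrow> 0"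
    by simp
  then show ?thesis by (simp add: LIM_zero_iff tendsto_norm_zero_iff)
qed

lemma lipschitz_continuous:
  fixes F :: "'a::real_normed_vector \<Rightarrow> 'b::real_normed_vector"
  assumes "\<And>x y. norm (F x - F y) \<le> L * norm (x - y)"
  shows "continuous_on S F"
proof (rule lipschitz_on_continuous_on)
  show "(max L 0)-lipschitz_on S F"
  proof (rule lipschitz_onI)
    fix x y :: 'a
    have "L * norm (x - y) \<le> max L 0 * norm (x - y)" by (intro mult_right_mono) auto
    then show "dist (F x) (F y) \<le> max L 0 * dist x y"
      using assms[of x y] by (simp add: dist_norm)
  qed simp
qed

lemma lipschitz_bounded_support:
  fixes F :: "'a::euclidean_space \<Rightarrow> 'b::real_normed_vector"
  assumes lip: "\<And>x y. norm (F x - F y) \<le> L * norm (x - y)"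
    and supp: "\<And>x. x \<notin> cball 0 R \<Longrightarrow> F x = 0"
  obtains B where "\<And>x. norm (F x) \<le> B"
proof -
  have "bounded (F ` cball 0 R)"
    by (intro compact_imp_bounded compact_continuous_image lipschitz_continuous[OF lip]) auto
  then obtain B where B: "\<And>x. x \<in> cball 0 R \<Longrightarrow> norm (F x) \<le> B" unfolding bounded_iff by blast
  have "norm (F x) \<le> max B 0" for x using B[of x] supp[of x] by (cases "x \<in> cball 0 R") auto
  then show ?thesis by (rule that)
qed

lemma integrable_bounded_support:
  fixes F :: "'a::euclidean_space \<Rightarrow> 'b::{banach,second_countable_topology}"
  assumes "F \<in> borel_measurable borel" "\<And>x. norm (F x) \<le> B" "\<And>x. x \<notin> cball 0 R \<Longrightarrow> F x = 0"
  shows "integrable lborel F"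
proof (rule Bochner_Integration.integrable_bound)
  show "integrable lborel (\<lambda>x::'a. B * indicator (cball 0 R) x)"
    using emeasure_lborel_cball_finite[of "0::'a" R] by (auto simp: less_top)
  show "AE x in lborel. norm (F x) \<le> norm (B * indicator (cball 0 R) x)"
    using assms(2,3) by (intro AE_I2) (auto simp: indicator_def intro: order_trans[OF _ abs_ge_self])
qed (use assms(1) in simp)

text \<open>The difference quotients have integral zero by translation invariance.\<close>

lemma integral_directional_derivative_eq_0:
  fixes F :: "'a::euclidean_space \<Rightarrow> 'b::{banach,second_countable_topology}"
  assumes lip: "\<And>x y. norm (F x - F y) \<le> L * norm (x - y)"
    and supp: "\<And>x. x \<notin> cball 0 R \<Longrightarrow> F x = 0"
    and F' [measurable]: "F' \<in> borel_measurable borel"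
    and deriv: "AE x in lborel. \<exists>D. (F has_derivative D) (at x) \<and> D v = F' x"
  shows "(LINT x|lborel. F' x) = 0"
proof -
  have [measurable]: "F \<in> borel_measurable borel"
    by (rule borel_measurable_continuous_onI[OF lipschitz_continuous[OF lip]])
  obtain B where B: "\<And>x. norm (F x) \<le> B" using lipschitz_bounded_support[OF lip supp] by blast
  have int: "integrable lborel F" by (rule integrable_bounded_support[OF _ B supp]) auto
  have shift: "integrable lborel (\<lambda>x. F (x + h))" "(LINT x|lborel. F (x + h)) = (LINT x|lborel. F x)" for h
  proof -
    have "integrable (distr lborel borel ((+) h)) F" using int by (simp add: lborel_distr_plus)
    then show "integrable lborel (\<lambda>x. F (x + h))" by (subst (asm) integrable_distr_eq) (auto simp: add.commute)
    have "(LINT x|lborel. F x) = (LINT x|distr lborel borel ((+) h). F x)" by (simp add: lborel_distr_plus)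
    also have "\<dots> = (LINT x|lborel. F (h + x))" by (rule integral_distr) auto
    finally show "(LINT x|lborel. F (x + h)) = (LINT x|lborel. F x)" by (simp add: add.commute)
  qed
  define q where "q = (\<lambda>m x. real (Suc m) *\<^sub>R (F (x + inverse (real (Suc m)) *\<^sub>R v) - F x))"
  have "(\<lambda>m. LINT x|lborel. q m x) \<longlonglongrightarrow> (LINT x|lborel. F' x)"
  proof (rule integral_dominated_convergence)
    \<comment> \<open>The steps are at most \<open>v\<close> in length, so every quotient vanishes
      outside a ball enlarged by \<open>norm v\<close>, and the Lipschitz constant bounds it
      there.\<close>
    show "integrable lborel (\<lambda>x::'a. (\<bar>L\<bar> * norm v) * indicator (cball 0 (R + norm v)) x)"
      using emeasure_lborel_cball_finite[of "0::'a" "R + norm v"] by (auto simp: less_top)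
    show "AE x in lborel. (\<lambda>m. q m x) \<longlonglongrightarrow> F' x"
      using deriv
    proof eventually_elim
      case (elim x)
      then obtain D where "(F has_derivative D) (at x)" "D v = F' x" by blast
      then show ?case unfolding q_def using has_derivative_directional_limit[of F D x v] by simp
    qed
    show "AE x in lborel. norm (q m x) \<le> (\<bar>L\<bar> * norm v) * indicator (cball 0 (R + norm v)) x" for m
    proof (intro AE_I2)
      fix x
      define c where "c = real (Suc m)"
      have c: "c \<ge> 1" by (simp add: c_def)
      show "norm (q m x) \<le> (\<bar>L\<bar> * norm v) * indicator (cball 0 (R + norm v)) x"
      proof (cases "x \<in> cball 0 (R + norm v)")
        case True
        have "norm (F (x + inverse c *\<^sub>R v) - F x) \<le> L * norm ((x + inverse c *\<^sub>R v) - x)" by (rule lip)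
        also have "\<dots> \<le> \<bar>L\<bar> * norm ((x + inverse c *\<^sub>R v) - x)" by (intro mult_right_mono) auto
        also have "norm ((x + inverse c *\<^sub>R v) - x) = inverse c * norm v" using c by simp
        finally have "c * norm (F (x + inverse c *\<^sub>R v) - F x) \<le> c * (\<bar>L\<bar> * (inverse c * norm v))"
          using c by (intro mult_left_mono) auto
        also have "c * (\<bar>L\<bar> * (inverse c * norm v)) = \<bar>L\<bar> * norm v" using c by simp
        finally show ?thesis using True c unfolding q_def c_def[symmetric] by simp
      next
        case False
        have "norm (inverse c *\<^sub>R v) \<le> norm v" using c by (simp add: mult_left_le_one_le inverse_le_1_iff)
        moreover have "norm x \<le> norm (x + inverse c *\<^sub>R v) + norm (inverse c *\<^sub>R v)"
          by (metis add_diff_cancel_right' norm_triangle_ineq4)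
        moreover have "norm x > R + norm v" using False by simp
        ultimately have "norm x > R" "norm (x + inverse c *\<^sub>R v) > R"
          using norm_ge_zero[of v] by linarith+
        then have "F x = 0" "F (x + inverse c *\<^sub>R v) = 0" by (simp_all add: supp)
        then show ?thesis unfolding q_def c_def[symmetric] by simp
      qed
    qed
  qed (auto simp: q_def)
  moreover have "(LINT x|lborel. q m x) = 0" for m
    unfolding q_def using shift int by simp
  ultimately show ?thesis by (simp add: LIMSEQ_const_iff)
qed

lemma test_function_lipschitz:
  fixes \<phi> :: "real^'n \<Rightarrow> complex"
  assumes \<phi>: "\<phi> \<in> test_functions \<Omega>"
  obtains K where "\<And>x y. cmod (\<phi> x - \<phi> y) \<le> K * norm (x - y)"
proof -
  have "\<forall>i. \<exists>B. \<forall>x. cmod (partial_deriv i \<phi> x) \<le> B" using test_function_bounded(2)[OF \<phi>] by blast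
  then obtain B where B: "\<And>i x. cmod (partial_deriv i \<phi> x) \<le> B i" unfolding choice_iff by blast
  have "cmod (\<phi> x - \<phi> y) \<le> (\<Sum>i\<in>UNIV. B i) * norm (x - y)" for x y
  proof (rule differentiable_bound[of UNIV \<phi> "\<lambda>x. frechet_derivative \<phi> (at x)"])
    fix x
    show der: "(\<phi> has_derivative frechet_derivative \<phi> (at x)) (at x within UNIV)"
      using test_function_differentiable(1)[OF \<phi>] by (simp add: frechet_derivative_works)
    then have lin: "linear (frechet_derivative \<phi> (at x))" by (rule has_derivative_linear)
    show "onorm (frechet_derivative \<phi> (at x)) \<le> (\<Sum>i\<in>UNIV. B i)"
    proof (rule onorm_bound)
      show "0 \<le> (\<Sum>i\<in>UNIV. B i)" using order_trans[OF norm_ge_zero B] by (intro sum_nonneg)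
      fix v :: "real^'n"
      have "frechet_derivative \<phi> (at x) v = frechet_derivative \<phi> (at x) (\<Sum>i\<in>UNIV. v $ i *\<^sub>R axis i 1)"
        by (subst basis_expansion[of v, symmetric]) (simp add: scalar_mult_eq_scaleR)
      also have "\<dots> = (\<Sum>i\<in>UNIV. v $ i *\<^sub>R partial_deriv i \<phi> x)"
        using lin by (simp add: linear_sum linear_scale partial_deriv_def)
      finally have "cmod (frechet_derivative \<phi> (at x) v) \<le> (\<Sum>i\<in>UNIV. cmod (v $ i *\<^sub>R partial_deriv i \<phi> x))"
        using norm_sum[of "\<lambda>i. v $ i *\<^sub>R partial_deriv i \<phi> x" UNIV] by simp
      also have "\<dots> \<le> (\<Sum>i\<in>UNIV. norm v * B i)"
        by (rule sum_mono) (auto intro!: mult_mono B component_le_norm_cart)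
      finally show "cmod (frechet_derivative \<phi> (at x) v) \<le> (\<Sum>i\<in>UNIV. B i) * norm v"
        by (simp add: sum_distrib_left mult.commute)
    qed
  qed auto
  then show ?thesis by (rule that)
qed

lemma (in bounded_open) L2_bounded_borel:
  assumes "u \<in> borel_measurable borel" "\<And>x. cmod (u x) \<le> B"
  shows "u \<in> L2 \<Omega>"
  using assms by (intro L2_bounded[OF lmeasurable_dom, of _ B] borel_measurable_lebesgue_onI) auto

text \<open>The product of \<open>u\<close> with a test function is Lipschitz with bounded support,
  so the integral of its directional derivative vanishes; the product rule turns this into the weak
  identity. Differentiability almost everywhere is a hypothesis because the functions in question
  are explicit.\<close>

lemma (in bounded_open) lipschitz_is_weak_partial:
  fixes u :: "real^'n \<Rightarrow> complex"
  assumes lip: "\<And>x y. cmod (u x - u y) \<le> K * norm (x - y)"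
    and bound: "\<And>x. cmod (u x) \<le> B"
    and g [measurable]: "g \<in> borel_measurable borel" and g_bound: "\<And>x. cmod (g x) \<le> B'"
    and deriv: "AE x in lborel. \<exists>D. (u has_derivative D) (at x) \<and> D (axis i 1) = g x"
  shows "is_weak_partial \<Omega> i u g"
  unfolding is_weak_partial_def
proof
  fix \<phi> assume \<phi>: "\<phi> \<in> test_functions \<Omega>"
  define C where "C = closure {x. \<phi> x \<noteq> 0}"
  have C: "compact C" "C \<subseteq> \<Omega>" using test_function_support[OF \<phi>] by (simp_all add: C_def)
  have out: "\<phi> x = 0" "partial_deriv i \<phi> x = 0" if "x \<notin> C" for x
    using that closure_subset[of "{x. \<phi> x \<noteq> 0}"] partial_deriv_outside_support[of x \<phi> i]
    by (auto simp: C_def)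
  obtain R where R: "C \<subseteq> cball 0 R"
    using compact_imp_bounded[OF C(1)] by (auto simp: bounded_iff subset_iff)
  obtain K' where K': "\<And>x y. cmod (\<phi> x - \<phi> y) \<le> K' * norm (x - y)"
    using test_function_lipschitz[OF \<phi>] by blast
  obtain M where M: "\<And>x. cmod (\<phi> x) \<le> M" using test_function_bounded(1)[OF \<phi>] by blast
  have [measurable]: "u \<in> borel_measurable borel" "\<phi> \<in> borel_measurable borel"
    "partial_deriv i \<phi> \<in> borel_measurable borel"
    using lipschitz_continuous[OF lip] test_function_differentiable(2,3)[OF \<phi>]
    by (auto intro: borel_measurable_continuous_onI)
  define F' where "F' = (\<lambda>x. u x * partial_deriv i \<phi> x + g x * \<phi> x)"
  have "(LINT x|lborel. F' x) = 0"
  proof (rule integral_directional_derivative_eq_0[where F = "\<lambda>x. u x * \<phi> x" and R = R and v = "axis i 1"])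
    fix x y
    have "cmod (u x * \<phi> x - u y * \<phi> y) = cmod (u x * (\<phi> x - \<phi> y) + (u x - u y) * \<phi> y)"
      by (simp add: algebra_simps)
    also have "\<dots> \<le> cmod (u x) * cmod (\<phi> x - \<phi> y) + cmod (u x - u y) * cmod (\<phi> y)"
      by (rule order_trans[OF norm_triangle_ineq]) (simp add: norm_mult)
    also have "\<dots> \<le> B * (K' * norm (x - y)) + (K * norm (x - y)) * M"
      using order_trans[OF norm_ge_zero bound] order_trans[OF norm_ge_zero lip]
      by (intro add_mono mult_mono bound K' lip M) auto
    finally show "cmod (u x * \<phi> x - u y * \<phi> y) \<le> (B * K' + K * M) * norm (x - y)"
      by (simp add: algebra_simps)
  next
    show "u x * \<phi> x = 0" if "x \<notin> cball 0 R" for x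
    proof -
      have "x \<notin> C" using that R by blast
      then show ?thesis by (simp add: out)
    qed
    show "F' \<in> borel_measurable borel" unfolding F'_def by measurable
    show "AE x in lborel. \<exists>D. ((\<lambda>x. u x * \<phi> x) has_derivative D) (at x) \<and> D (axis i 1) = F' x"
      using deriv
    proof eventually_elim
      case (elim x)
      then obtain D where D: "(u has_derivative D) (at x)" "D (axis i 1) = g x" by blast
      have "(\<phi> has_derivative frechet_derivative \<phi> (at x)) (at x)"
        using test_function_differentiable(1)[OF \<phi>] by (simp add: frechet_derivative_works)
      from has_derivative_mult[OF D(1) this]
      show ?case
        by (intro exI[of _ "\<lambda>h. u x * frechet_derivative \<phi> (at x) h + D h * \<phi> x"] conjI)
           (simp_all add: F'_def partial_deriv_def D(2))
    qed
  qed
  moreover have "(LINT x|lborel. F' x) = (LINT x|lebesgue_on \<Omega>. F' x)"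
  proof -
    have "(LINT x|lborel. F' x) = (LINT x|lebesgue. F' x)"
      by (rule integral_completion[symmetric]) (simp add: F'_def)
    also have "\<dots> = (LINT x|lebesgue. indicator \<Omega> x *\<^sub>R F' x)"
    proof (rule Bochner_Integration.integral_cong)
      show "F' x = indicator \<Omega> x *\<^sub>R F' x" for x
        using C(2) out[of x] by (cases "x \<in> C") (auto simp: F'_def indicator_def)
    qed simp
    finally show ?thesis by (simp add: lebesgue_on_integral[OF lebesgue_dom])
  qed
  moreover have "(LINT x|lebesgue_on \<Omega>. F' x)
      = (LINT x|lebesgue_on \<Omega>. u x * partial_deriv i \<phi> x) + (LINT x|lebesgue_on \<Omega>. g x * \<phi> x)"
    unfolding F'_def
    by (intro Bochner_Integration.integral_add L2_mult_integrable test_function_L2[OF open_dom bounded_dom \<phi>])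
       (auto intro: L2_bounded_borel bound g_bound)
  ultimately show "(LINT x|lebesgue_on \<Omega>. u x * partial_deriv i \<phi> x) = - (LINT x|lebesgue_on \<Omega>. g x * \<phi> x)"
    by (simp add: add_eq_0_iff2)
qed

section \<open>Dirichlet eigenfunctions of a cube\<close>

definition tensor :: "('n::finite \<Rightarrow> real \<Rightarrow> real) \<Rightarrow> real^'n \<Rightarrow> real" where
  "tensor \<tau> x = (\<Prod>k\<in>UNIV. \<tau> k (x $ k))"

definition tensor_deriv :: "('n::finite \<Rightarrow> real \<Rightarrow> real) \<Rightarrow> ('n \<Rightarrow> real \<Rightarrow> real) \<Rightarrow> 'n \<Rightarrow> real^'n \<Rightarrow> real" where
  "tensor_deriv \<tau> \<tau>' k x = \<tau>' k (x $ k) * (\<Prod>l\<in>UNIV - {k}. \<tau> l (x $ l))"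

text \<open>Contains all kinks of the zero extensions. Taking whole hyperplanes instead of faces
  makes every factor differentiable at the corresponding coordinate of a point off the set.\<close>

definition grid :: "real \<Rightarrow> (real^'n) set" where
  "grid R = {x. \<exists>k. x $ k = 0 \<or> x $ k = R}"

lemma grid_null: "(grid R :: (real^'n) set) \<in> null_sets lborel"
proof -
  have "{x :: real^'n. x $ k = c} \<in> null_sets lborel" for k c
  proof -
    have "negligible {x :: real^'n. x $ k = c}"
      using negligible_standard_hyperplane[of "axis k 1 :: real^'n" c] by (simp add: inner_axis axis_in_Basis_iff)
    then have "{x :: real^'n. x $ k = c} \<in> null_sets lebesgue" by (simp add: negligible_iff_null_sets)
    moreover have "{x :: real^'n. x $ k = c} \<in> sets borel" by measurable
    ultimately show ?thesis by (auto simp: null_sets_def)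
  qed
  then have "(\<Union>k\<in>UNIV. {x :: real^'n. x $ k = 0} \<union> {x. x $ k = R}) \<in> null_sets lborel"
    by (intro null_sets_UN' null_sets.Un) (auto simp: countable_finite)
  moreover have "(\<Union>k\<in>UNIV. {x :: real^'n. x $ k = 0} \<union> {x. x $ k = R}) = grid R"
    by (auto simp: grid_def)
  ultimately show ?thesis by simp
qed

lemma tensor_bound:
  assumes "\<And>k t. \<bar>\<tau> k t\<bar> \<le> 1"
  shows "\<bar>tensor \<tau> x\<bar> \<le> 1"
  unfolding tensor_def abs_prod using assms by (intro prod_le_1) auto

lemma tensor_lipschitz:
  assumes "\<And>k t. \<bar>\<tau> k t\<bar> \<le> 1" "\<And>k s t. \<bar>\<tau> k s - \<tau> k t\<bar> \<le> K k * \<bar>s - t\<bar>"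
  shows "\<bar>tensor \<tau> x - tensor \<tau> y\<bar> \<le> (\<Sum>k\<in>UNIV. K k) * norm (x - y)"
proof -
  have K: "0 \<le> K k" for k using assms(2)[of k 0 1] by simp
  have "\<bar>tensor \<tau> x - tensor \<tau> y\<bar> \<le> (\<Sum>k\<in>UNIV. \<bar>\<tau> k (x $ k) - \<tau> k (y $ k)\<bar>)"
    unfolding tensor_def real_norm_def[symmetric] using assms(1) by (intro norm_prod_diff) auto
  also have "\<dots> \<le> (\<Sum>k\<in>UNIV. K k * norm (x - y))"
  proof (rule sum_mono)
    fix k
    have "\<bar>\<tau> k (x $ k) - \<tau> k (y $ k)\<bar> \<le> K k * \<bar>x $ k - y $ k\<bar>" by (rule assms(2))
    also have "\<dots> \<le> K k * norm (x - y)"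
      using component_le_norm_cart[of "x - y" k] K by (intro mult_left_mono) auto
    finally show "\<bar>\<tau> k (x $ k) - \<tau> k (y $ k)\<bar> \<le> K k * norm (x - y)" .
  qed
  finally show ?thesis by (simp add: sum_distrib_right)
qed

lemma tensor_has_derivative:
  assumes "\<And>k. (\<tau> k has_real_derivative \<tau>' k (x $ k)) (at (x $ k))"
  shows "(tensor \<tau> has_derivative (\<lambda>v. \<Sum>k\<in>UNIV. v $ k * tensor_deriv \<tau> \<tau>' k x)) (at x)"
proof -
  have "((\<lambda>x. \<tau> k (x $ k)) has_derivative (\<lambda>v. \<tau>' k (x $ k) * v $ k)) (at x)" for k
    using has_derivative_compose[OF bounded_linear_imp_has_derivative[OF bounded_linear_vec_nth] assms[of k, unfolded has_field_derivative_def]] .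
  then have "((\<lambda>x. \<Prod>k\<in>UNIV. \<tau> k (x $ k)) has_derivative
      (\<lambda>v. \<Sum>k\<in>UNIV. (\<tau>' k (x $ k) * v $ k) * (\<Prod>l\<in>UNIV - {k}. \<tau> l (x $ l)))) (at x)"
    by (intro has_derivative_prod) auto
  then show ?thesis by (simp add: tensor_def[abs_def] tensor_deriv_def mult_ac)
qed

lemma tensor_borel [measurable]:
  assumes [measurable]: "\<And>k. \<tau> k \<in> borel_measurable borel" "\<And>k. \<tau>' k \<in> borel_measurable borel"
  shows "tensor \<tau> \<in> borel_measurable borel" "tensor_deriv \<tau> \<tau>' k \<in> borel_measurable borel"
  unfolding tensor_def[abs_def] tensor_deriv_def[abs_def] by measurable

lemma tensor_outside:
  assumes "\<And>k t. t \<notin> {0..R} \<Longrightarrow> \<tau> k t = 0" "x \<notin> cbox 0 (\<chi> k. R)"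
  shows "tensor \<tau> x = 0"
proof -
  obtain k where "x $ k \<notin> {0..R}" using assms(2) by (auto simp: mem_box_cart)
  then show ?thesis using assms(1) unfolding tensor_def by (intro prod_zero) auto
qed

lemma cube_subset_cball: "\<exists>M. cbox (0::real^'n) (\<chi> k. R) \<subseteq> cball 0 M"
  using bounded_cbox[of "0::real^'n" "\<chi> k. R"] by (auto simp: bounded_iff subset_iff)

text \<open>Allows integration by parts in one coordinate of a product function without Fubini's
  theorem: the product itself is Lipschitz, has bounded support and is differentiable off
  \<open>grid R\<close>.\<close>

lemma integral_tensor_deriv_eq_0:
  fixes \<tau> \<tau>' :: "'n::finite \<Rightarrow> real \<Rightarrow> real"
  assumes "\<And>k t. \<bar>\<tau> k t\<bar> \<le> 1" "\<And>k s t. \<bar>\<tau> k s - \<tau> k t\<bar> \<le> K k * \<bar>s - t\<bar>"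
    and "\<And>k t. t \<notin> {0..R} \<Longrightarrow> \<tau> k t = 0"
    and [measurable]: "\<And>k. \<tau>' k \<in> borel_measurable borel"
    and der: "\<And>k t. t \<noteq> 0 \<Longrightarrow> t \<noteq> R \<Longrightarrow> (\<tau> k has_real_derivative \<tau>' k t) (at t)"
  shows "(LINT x|lborel. tensor_deriv \<tau> \<tau>' k x) = 0"
proof -
  obtain M where M: "cbox (0::real^'n) (\<chi> k. R) \<subseteq> cball 0 M" using cube_subset_cball by blast
  have [measurable]: "\<tau> k \<in> borel_measurable borel" for k
    using lipschitz_continuous[of "\<tau> k" "K k"] assms(2) by (intro borel_measurable_continuous_onI) auto
  show ?thesis
  proof (rule integral_directional_derivative_eq_0[where F = "tensor \<tau>" and v = "axis k 1" and R = M])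
    show "norm (tensor \<tau> x - tensor \<tau> y) \<le> (\<Sum>k\<in>UNIV. K k) * norm (x - y)" for x y
      using tensor_lipschitz[of \<tau> K x y] assms(1,2) by simp
    show "tensor \<tau> x = 0" if "x \<notin> cball 0 M" for x
      by (rule tensor_outside[of R \<tau> x]) (use assms(3) that M in auto)
    show "tensor_deriv \<tau> \<tau>' k \<in> borel_measurable borel" by measurable
    show "AE x in lborel. \<exists>D. (tensor \<tau> has_derivative D) (at x) \<and> D (axis k 1) = tensor_deriv \<tau> \<tau>' k x"
      using AE_not_in[OF grid_null[of R]]
    proof eventually_elim
      case (elim x)
      then have "(tensor \<tau> has_derivative (\<lambda>v. \<Sum>k\<in>UNIV. v $ k * tensor_deriv \<tau> \<tau>' k x)) (at x)"
        by (intro tensor_has_derivative der) (auto simp: grid_def)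
      moreover have "(\<Sum>l\<in>UNIV. (axis k 1 :: real^'n) $ l * tensor_deriv \<tau> \<tau>' l x) = tensor_deriv \<tau> \<tau>' k x"
        by (simp add: axis_def if_distrib[of "\<lambda>c. c * _"] cong: if_cong)
      ultimately show ?case by blast
    qed
  qed
qed

text \<open>Clamping the argument to \<open>[0, R]\<close> extends the sine by zero, since it
  vanishes at both ends, and makes the Lipschitz estimate immediate.\<close>

definition sine :: "real \<Rightarrow> nat \<Rightarrow> real \<Rightarrow> real" where
  "sine R m t = sin (pi * real m / R * max 0 (min R t))"

definition sine_deriv :: "real \<Rightarrow> nat \<Rightarrow> real \<Rightarrow> real" where
  "sine_deriv R m t = (if 0 < t \<and> t < R then pi * real m / R * cos (pi * real m / R * t) else 0)"

lemma sine_eq: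
  assumes "R > 0"
  shows "sine R m t = (if 0 < t \<and> t < R then sin (pi * real m / R * t) else 0)"
  using assms by (auto simp: sine_def max_def min_def sin_npi2)

lemma sine_outside: "\<lbrakk>R > 0; t \<notin> {0..R}\<rbrakk> \<Longrightarrow> sine R m t = 0"
  by (auto simp: sine_eq)

lemma sine_bound: "\<bar>sine R m t\<bar> \<le> 1" by (simp add: sine_def)

lemma abs_sin_diff_le: "\<bar>sin x - sin y\<bar> \<le> \<bar>x - y\<bar>" for x y :: real
proof -
  have "\<bar>sin x - sin y\<bar> = 2 * (\<bar>sin ((x - y) / 2)\<bar> * \<bar>cos ((x + y) / 2)\<bar>)"
    by (simp add: sin_diff_sin abs_mult)
  also have "\<dots> \<le> 2 * (\<bar>(x - y) / 2\<bar> * 1)"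
    by (intro mult_left_mono mult_mono abs_sin_x_le_abs_x abs_cos_le_one) auto
  finally show ?thesis by simp
qed

lemma sine_lipschitz: "\<bar>sine R m s - sine R m t\<bar> \<le> \<bar>pi * real m / R\<bar> * \<bar>s - t\<bar>"
proof -
  have "\<bar>sine R m s - sine R m t\<bar> \<le> \<bar>pi * real m / R * max 0 (min R s) - pi * real m / R * max 0 (min R t)\<bar>"
    unfolding sine_def by (rule abs_sin_diff_le)
  also have "\<dots> = \<bar>pi * real m / R\<bar> * \<bar>max 0 (min R s) - max 0 (min R t)\<bar>"
    by (simp only: abs_mult right_diff_distrib[symmetric])
  also have "\<dots> \<le> \<bar>pi * real m / R\<bar> * \<bar>s - t\<bar>" by (intro mult_left_mono) auto
  finally show ?thesis .
qed

lemma sine_has_derivative: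
  assumes "R > 0" "t \<noteq> 0" "t \<noteq> R"
  shows "(sine R m has_real_derivative sine_deriv R m t) (at t)"
proof (cases "0 < t \<and> t < R")
  case True
  have "((\<lambda>t. sin (pi * real m / R * t)) has_real_derivative sine_deriv R m t) (at t)"
    using True by (auto intro!: derivative_eq_intros simp: sine_deriv_def)
  then show ?thesis
    by (rule has_field_derivative_transform_within_open[of _ _ _ "{0<..<R}"])
       (use True assms in \<open>auto simp: sine_eq\<close>)
next
  case False
  have "((\<lambda>_. 0) has_real_derivative 0) (at t)" by simp
  then have "(sine R m has_real_derivative 0) (at t)"
    by (rule has_field_derivative_transform_within_open[of _ _ _ "- {0..R}"])
       (use False assms in \<open>auto simp: sine_eq open_Compl\<close>)
  then show ?thesis using False by (auto simp: sine_deriv_def)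
qed

lemma sine_borel [measurable]: "sine R m \<in> borel_measurable borel"
  unfolding sine_def[abs_def] by measurable

lemma sine_deriv_borel [measurable]: "sine_deriv R m \<in> borel_measurable borel"
  unfolding sine_deriv_def[abs_def] by measurable

lemma sine_deriv_bound: "\<bar>sine_deriv R m t\<bar> \<le> \<bar>pi * real m / R\<bar>"
  using abs_cos_le_one by (auto simp: sine_deriv_def abs_mult abs_divide intro!: mult_left_le divide_right_mono)

text \<open>The Dirichlet eigenfunctions of the cube \<open>(0, R)\<^sup>n\<close>, extended by zero, and their
  partial derivatives.\<close>

definition sines :: "real \<Rightarrow> ('n::finite \<Rightarrow> nat) \<Rightarrow> real^'n \<Rightarrow> real" where
  "sines R m = tensor (\<lambda>k. sine R (m k))"

definition dsines :: "real \<Rightarrow> ('n::finite \<Rightarrow> nat) \<Rightarrow> 'n \<Rightarrow> real^'n \<Rightarrow> real" where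
  "dsines R m = tensor_deriv (\<lambda>k. sine R (m k)) (\<lambda>k. sine_deriv R (m k))"

lemma sines_borel [measurable]: "sines R m \<in> borel_measurable borel" "dsines R m k \<in> borel_measurable borel"
  unfolding sines_def dsines_def by measurable

lemma sines_bound: "\<bar>sines R m x\<bar> \<le> 1"
  unfolding sines_def by (rule tensor_bound) (rule sine_bound)

lemma dsines_bound: "\<bar>dsines R m k x\<bar> \<le> \<bar>pi * real (m k) / R\<bar>"
proof -
  have "\<bar>\<Prod>l\<in>UNIV - {k}. sine R (m l) (x $ l)\<bar> \<le> 1"
    unfolding abs_prod by (rule prod_le_1) (use sine_bound in auto)
  then have "\<bar>sine_deriv R (m k) (x $ k)\<bar> * \<bar>\<Prod>l\<in>UNIV - {k}. sine R (m l) (x $ l)\<bar> \<le> \<bar>pi * real (m k) / R\<bar> * 1"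
    by (intro mult_mono sine_deriv_bound) auto
  then show ?thesis by (simp add: dsines_def tensor_deriv_def abs_mult)
qed

lemma sines_outside:
  assumes "R > 0" "x \<notin> cbox 0 (\<chi> k. R)"
  shows "sines R m x = 0" "dsines R m k x = 0"
proof -
  show "sines R m x = 0"
    unfolding sines_def by (rule tensor_outside[OF sine_outside[OF assms(1)] assms(2)])
  obtain l where l: "x $ l \<notin> {0..R}" using assms(2) by (auto simp: mem_box_cart)
  show "dsines R m k x = 0"
  proof (cases "l = k")
    case True
    then show ?thesis using l by (auto simp: dsines_def tensor_deriv_def sine_deriv_def)
  next
    case False
    then have "(\<Prod>l\<in>UNIV - {k}. sine R (m l) (x $ l)) = 0"
      using l assms(1) by (intro prod_zero bexI[of _ l]) (auto intro: sine_outside)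
    then show ?thesis by (simp add: dsines_def tensor_deriv_def)
  qed
qed

lemma sines_lipschitz:
  "\<bar>sines R m x - sines R m y\<bar> \<le> (\<Sum>k\<in>UNIV. \<bar>pi * real (m k) / R\<bar>) * norm (x - y)"
  unfolding sines_def by (rule tensor_lipschitz[OF sine_bound sine_lipschitz])

lemma sines_has_derivative:
  assumes "R > 0" "x \<notin> grid R"
  shows "(sines R m has_derivative (\<lambda>v. \<Sum>k\<in>UNIV. v $ k * dsines R m k x)) (at x)"
  unfolding sines_def dsines_def
  by (rule tensor_has_derivative, rule sine_has_derivative) (use assms in \<open>auto simp: grid_def\<close>)

lemma integrable_on_cube:
  fixes f :: "real^'n \<Rightarrow> real"
  assumes "f \<in> borel_measurable borel" "\<And>x. \<bar>f x\<bar> \<le> B" "\<And>x. x \<notin> cbox 0 (\<chi> k. R) \<Longrightarrow> f x = 0"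
  shows "integrable lborel f"
proof -
  obtain M where "cbox (0::real^'n) (\<chi> k. R) \<subseteq> cball 0 M" using cube_subset_cball by blast
  then have "f x = 0" if "x \<notin> cball 0 M" for x using that assms(3) by blast
  then show ?thesis using assms(1,2) by (intro integrable_bounded_support[of f B M]) auto
qed

lemma sines_mult_integrable:
  assumes "R > 0"
  shows "integrable lborel (\<lambda>x. sines R m x * sines R n x)"
    "integrable lborel (\<lambda>x. dsines R m k x * dsines R n k x)"
proof -
  show "integrable lborel (\<lambda>x. sines R m x * sines R n x)"
    by (rule integrable_on_cube[of _ 1 R])
       (auto simp: sines_outside assms abs_mult intro!: mult_le_one sines_bound)
  show "integrable lborel (\<lambda>x. dsines R m k x * dsines R n k x)"
  proof (rule integrable_on_cube)
    show "\<bar>dsines R m k x * dsines R n k x\<bar> \<le> \<bar>pi * real (m k) / R\<bar> * \<bar>pi * real (n k) / R\<bar>" for x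
      unfolding abs_mult[of "dsines R m k x"] by (intro mult_mono dsines_bound) auto
    show "dsines R m k x * dsines R n k x = 0" if "x \<notin> cbox 0 (\<chi> k. R)" for x
      using sines_outside(2)[OF assms that] by simp
  qed measurable
qed

text \<open>Integration by parts in direction \<open>k\<close>, moving the derivative of the first
  product onto the second, where differentiating the sine twice gives \<open>-w^2\<close> times
  itself.\<close>

lemma dsines_inner:
  fixes m n :: "'n::finite \<Rightarrow> nat"
  assumes R: "R > 0"
  shows "(LINT x|lborel. dsines R m k x * dsines R n k x)
    = (pi * real (n k) / R)\<^sup>2 * (LINT x|lborel. sines R m x * sines R n x)"
proof -
  define w where "w = pi * real (n k) / R"
  \<comment> \<open>In direction \<open>k\<close> the factor is sine times cosine; the cosine alone
    does not vanish outside the interval, but the clamped sine makes the product do so. Multiplied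
    by \<open>w\<close>, the cosine is the derivative of the second sine.\<close>
  define \<tau> where "\<tau> = (\<lambda>l t. sine R (m l) t * (if l = k then cos (w * t) else sine R (n l) t))"
  define \<tau>' where "\<tau>' = (\<lambda>l t. sine_deriv R (m l) t * (if l = k then cos (w * t) else sine R (n l) t)
     + sine R (m l) t * (if l = k then - w * sin (w * t) else sine_deriv R (n l) t))"
  define c where "c = (\<lambda>l t. if l = k then cos (w * t) else sine R (n l) t)"
  have c_lip: "\<bar>c l s - c l t\<bar> \<le> \<bar>pi * real (n l) / R\<bar> * \<bar>s - t\<bar>" for l s t
  proof (cases "l = k")
    case True
    have "\<bar>cos (w * s) - cos (w * t)\<bar> = \<bar>sin (w * s + pi / 2) - sin (w * t + pi / 2)\<bar>"
      by (simp add: sin_add)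
    also have "\<dots> \<le> \<bar>(w * s + pi / 2) - (w * t + pi / 2)\<bar>" by (rule abs_sin_diff_le)
    also have "\<dots> = \<bar>w\<bar> * \<bar>s - t\<bar>" by (simp add: abs_mult[symmetric] right_diff_distrib)
    finally show ?thesis using True by (simp add: c_def w_def)
  next
    case False
    then show ?thesis using sine_lipschitz[of R "n l" s t] unfolding c_def by simp
  qed
  have c_bound: "\<bar>c l t\<bar> \<le> 1" for l t by (simp add: c_def sine_bound)
  have zero: "(LINT x|lborel. tensor_deriv \<tau> \<tau>' k x) = 0"
  proof (rule integral_tensor_deriv_eq_0[where R = R and K = "\<lambda>l. \<bar>pi * real (m l) / R\<bar> + \<bar>pi * real (n l) / R\<bar>"])
    fix l s t
    show "\<bar>\<tau> l t\<bar> \<le> 1"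
      unfolding \<tau>_def c_def[symmetric] abs_mult using c_bound by (intro mult_le_one) (auto simp: sine_bound c_def)
    have "\<tau> l s - \<tau> l t = sine R (m l) s * (c l s - c l t) + (sine R (m l) s - sine R (m l) t) * c l t"
      by (simp add: \<tau>_def c_def algebra_simps)
    then have "\<bar>\<tau> l s - \<tau> l t\<bar> \<le> \<bar>sine R (m l) s\<bar> * \<bar>c l s - c l t\<bar> + \<bar>sine R (m l) s - sine R (m l) t\<bar> * \<bar>c l t\<bar>"
      by (simp add: abs_mult[symmetric])
    also have "\<dots> \<le> 1 * (\<bar>pi * real (n l) / R\<bar> * \<bar>s - t\<bar>) + (\<bar>pi * real (m l) / R\<bar> * \<bar>s - t\<bar>) * 1"
      by (intro add_mono mult_mono sine_bound c_lip sine_lipschitz c_bound) auto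
    finally show "\<bar>\<tau> l s - \<tau> l t\<bar> \<le> (\<bar>pi * real (m l) / R\<bar> + \<bar>pi * real (n l) / R\<bar>) * \<bar>s - t\<bar>"
      by (simp add: algebra_simps)
  next
    fix l t assume "t \<notin> {0..R}"
    then show "\<tau> l t = 0" by (simp add: \<tau>_def sine_outside[OF R])
  next
    fix l show "\<tau>' l \<in> borel_measurable borel"
      unfolding \<tau>'_def by (cases "l = k") simp_all
  next
    fix l and t :: real assume t: "t \<noteq> 0" "t \<noteq> R"
    show "(\<tau> l has_real_derivative \<tau>' l t) (at t)"
    proof (cases "l = k")
      case True
      have "((\<lambda>t. cos (w * t)) has_real_derivative (- w * sin (w * t))) (at t)"
        by (auto intro!: derivative_eq_intros)
      note d = DERIV_mult[OF sine_has_derivative[OF R t] this]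
      have e: "\<tau> l = (\<lambda>t. sine R (m l) t * cos (w * t))"
        "\<tau>' l t = sine_deriv R (m l) t * cos (w * t) + (- w * sin (w * t)) * sine R (m l) t"
        using True by (simp_all add: \<tau>_def \<tau>'_def fun_eq_iff)
      show ?thesis unfolding e by (rule d)
    next
      case False
      then have e: "\<tau> l = (\<lambda>t. sine R (m l) t * sine R (n l) t)"
        "\<tau>' l t = sine_deriv R (m l) t * sine R (n l) t + sine_deriv R (n l) t * sine R (m l) t"
        by (simp_all add: \<tau>_def \<tau>'_def fun_eq_iff)
      show ?thesis unfolding e by (rule DERIV_mult[OF sine_has_derivative[OF R t] sine_has_derivative[OF R t]])
    qed
  qed
  have eq: "w * tensor_deriv \<tau> \<tau>' k x = dsines R m k x * dsines R n k x - w\<^sup>2 * (sines R m x * sines R n x)" for x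
  proof -
    define P where "P = (\<Prod>l\<in>UNIV - {k}. sine R (m l) (x $ l) * sine R (n l) (x $ l))"
    have "(\<Prod>l\<in>UNIV - {k}. \<tau> l (x $ l)) = P"
      unfolding P_def by (rule prod.cong) (auto simp: \<tau>_def)
    then have "w * tensor_deriv \<tau> \<tau>' k x = w * \<tau>' k (x $ k) * P" by (simp add: tensor_deriv_def)
    also have "w * \<tau>' k (x $ k) = sine_deriv R (m k) (x $ k) * sine_deriv R (n k) (x $ k)
        - w\<^sup>2 * (sine R (m k) (x $ k) * sine R (n k) (x $ k))"
      using R by (simp add: \<tau>'_def sine_deriv_def sine_eq w_def power2_eq_square algebra_simps)
    also have "\<dots> * P = dsines R m k x * dsines R n k x - w\<^sup>2 * (sines R m x * sines R n x)"
      by (simp add: dsines_def sines_def tensor_deriv_def tensor_def P_def prod.distrib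
          prod.remove[of UNIV k] algebra_simps)
    finally show ?thesis .
  qed
  have "0 = (LINT x|lborel. w * tensor_deriv \<tau> \<tau>' k x)" using zero by simp
  also have "\<dots> = (LINT x|lborel. dsines R m k x * dsines R n k x) - w\<^sup>2 * (LINT x|lborel. sines R m x * sines R n x)"
    unfolding eq
    by (subst Bochner_Integration.integral_diff)
       (simp_all add: sines_mult_integrable[OF R])
  finally show ?thesis by (simp add: w_def)
qed

text \<open>The gradient product is symmetric in \<open>m\<close> and \<open>n\<close>, while
  \<open>dsines_inner\<close> expresses it with the frequency of either one. Where the frequencies
  differ, the inner product must vanish; no trigonometric integral is evaluated.\<close>

lemma sines_orthogonal:
  fixes m n :: "'n::finite \<Rightarrow> nat"
  assumes R: "R > 0" and ne: "m \<noteq> n"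
  shows "(LINT x|lborel. sines R m x * sines R n x) = 0"
    and "(LINT x|lborel. dsines R m k x * dsines R n k x) = 0"
proof -
  obtain l where l: "m l \<noteq> n l" using ne by auto
  define I where "I = (LINT x|lborel. sines R m x * sines R n x)"
  have "(pi * real (n l) / R)\<^sup>2 * I = (pi * real (m l) / R)\<^sup>2 * I"
    using dsines_inner[OF R, of m l n] dsines_inner[OF R, of n l m]
    by (simp add: I_def mult.commute)
  then have "((real (n l))\<^sup>2 - (real (m l))\<^sup>2) * I = 0"
    using R by (simp add: power_divide power_mult_distrib field_simps)
  moreover have "(real (n l))\<^sup>2 \<noteq> (real (m l))\<^sup>2" using l by simp
  ultimately show "(LINT x|lborel. sines R m x * sines R n x) = 0" by (simp add: I_def)
  then show "(LINT x|lborel. dsines R m k x * dsines R n k x) = 0" by (simp add: dsines_inner[OF R])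
qed

lemma sines_norm_pos:
  fixes m :: "'n::finite \<Rightarrow> nat"
  assumes R: "R > 0" and m: "\<And>k. m k \<ge> 1"
  shows "(LINT x|lborel. (sines R m x)\<^sup>2) > 0"
proof -
  have int: "integrable lborel (\<lambda>x. (sines R m x)\<^sup>2)"
    using sines_mult_integrable(1)[OF R, of m m] by (simp add: power2_eq_square)
  define S where "S = {x. sines R m x \<noteq> 0}"
  have "continuous_on UNIV (sines R m)"
    by (rule lipschitz_continuous) (simp only: real_norm_def, rule sines_lipschitz)
  then have op: "open S" unfolding S_def by (rule open_Collect_neq) simp
  \<comment> \<open>The first crest in each coordinate: every sine has argument
    \<open>pi / 2\<close> there.\<close>
  define x0 :: "real^'n" where "x0 = (\<chi> k. R / (2 * real (m k)))"
  have "sine R (m k) (x0 $ k) = 1" for k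
  proof -
    have "R / (2 * real (m k)) < R" using R m[of k] by (simp add: field_simps)
    moreover have "pi * real (m k) / R * (R / (2 * real (m k))) = pi / 2" using R m[of k] by simp
    moreover have "R / (2 * real (m k)) > 0" using R m[of k] by simp
    ultimately show ?thesis by (simp only: sine_eq[OF R] x0_def vec_lambda_beta) simp
  qed
  then have "x0 \<in> S" by (simp add: S_def sines_def tensor_def)
  have "(LINT x|lborel. (sines R m x)\<^sup>2) \<noteq> 0"
  proof
    assume "(LINT x|lborel. (sines R m x)\<^sup>2) = 0"
    then have "AE x in lborel. (sines R m x)\<^sup>2 = 0"
      using integral_nonneg_eq_0_iff_AE[OF int] by simp
    then have "AE x in lborel. x \<notin> S" by eventually_elim (simp add: S_def)
    then have "emeasure lborel S = 0"
      using op by (subst (asm) AE_iff_measurable[of S]) auto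
    then have "S \<in> null_sets lebesgue" using op by (intro null_sets_completionI) (auto simp: null_sets_def)
    then have "negligible S" by (simp add: negligible_iff_null_sets)
    then show False using open_not_negligible[OF op] \<open>x0 \<in> S\<close> by blast
  qed
  moreover have "(LINT x|lborel. (sines R m x)\<^sup>2) \<ge> 0" by simp
  ultimately show ?thesis by linarith
qed

section \<open>Trial functions and their transplantation to the domain\<close>

lemma orthogonal_combination_norm:
  fixes f :: "'i \<Rightarrow> 'a \<Rightarrow> real" and c :: "'i \<Rightarrow> complex"
  assumes int: "\<And>m n. integrable M (\<lambda>x. f m x * f n x)"
    and orth: "\<And>m n. m \<noteq> n \<Longrightarrow> (LINT x|M. f m x * f n x) = 0" and "finite D"
  shows "integrable M (\<lambda>x. (cmod (\<Sum>m\<in>D. c m * of_real (f m x)))\<^sup>2)"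
    and "(LINT x|M. (cmod (\<Sum>m\<in>D. c m * of_real (f m x)))\<^sup>2) = (\<Sum>m\<in>D. (cmod (c m))\<^sup>2 * (LINT x|M. (f m x)\<^sup>2))"
proof -
  have expand: "(cmod (\<Sum>m\<in>D. c m * of_real (f m x)))\<^sup>2
      = (\<Sum>m\<in>D. \<Sum>n\<in>D. Re (c m * cnj (c n)) * (f m x * f n x))" for x
  proof -
    have "(cmod (\<Sum>m\<in>D. c m * of_real (f m x)))\<^sup>2
        = Re ((\<Sum>m\<in>D. c m * of_real (f m x)) * cnj (\<Sum>m\<in>D. c m * of_real (f m x)))"
      by (simp only: complex_norm_square[symmetric] Re_complex_of_real)
    also have "\<dots> = (\<Sum>m\<in>D. \<Sum>n\<in>D. Re ((c m * of_real (f m x)) * cnj (c n * of_real (f n x))))"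
      by (simp only: cnj_sum sum_product Re_sum)
    also have "\<dots> = (\<Sum>m\<in>D. \<Sum>n\<in>D. Re (c m * cnj (c n)) * (f m x * f n x))"
      by (intro sum.cong refl) (simp add: algebra_simps)
    finally show ?thesis .
  qed
  show "integrable M (\<lambda>x. (cmod (\<Sum>m\<in>D. c m * of_real (f m x)))\<^sup>2)"
    unfolding expand by (intro Bochner_Integration.integrable_sum integrable_mult_right int)
  have "(LINT x|M. (cmod (\<Sum>m\<in>D. c m * of_real (f m x)))\<^sup>2)
      = (\<Sum>m\<in>D. \<Sum>n\<in>D. Re (c m * cnj (c n)) * (LINT x|M. f m x * f n x))"
    unfolding expand
    by (subst Bochner_Integration.integral_sum, intro Bochner_Integration.integrable_sum integrable_mult_right int,
        subst Bochner_Integration.integral_sum, intro integrable_mult_right int) simp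
  also have "\<dots> = (\<Sum>m\<in>D. \<Sum>n\<in>D. if n = m then Re (c m * cnj (c m)) * (LINT x|M. f m x * f m x) else 0)"
    by (intro sum.cong refl) (simp add: orth)
  also have "\<dots> = (\<Sum>m\<in>D. (cmod (c m))\<^sup>2 * (LINT x|M. (f m x)\<^sup>2))"
    using \<open>finite D\<close>
    by (simp add: complex_norm_square[symmetric] power2_eq_square[of "f _ _"] complex_mult_cnj cmod_power2)
  finally show "(LINT x|M. (cmod (\<Sum>m\<in>D. c m * of_real (f m x)))\<^sup>2)
      = (\<Sum>m\<in>D. (cmod (c m))\<^sup>2 * (LINT x|M. (f m x)\<^sup>2))" .
qed

definition trial :: "real \<Rightarrow> ('n::finite \<Rightarrow> nat) set \<Rightarrow> (('n \<Rightarrow> nat) \<Rightarrow> complex) \<Rightarrow> real^'n \<Rightarrow> complex" where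
  "trial R D c x = (\<Sum>m\<in>D. c m * of_real (sines R m x))"

definition dtrial :: "real \<Rightarrow> ('n::finite \<Rightarrow> nat) set \<Rightarrow> (('n \<Rightarrow> nat) \<Rightarrow> complex) \<Rightarrow> 'n \<Rightarrow> real^'n \<Rightarrow> complex" where
  "dtrial R D c k x = (\<Sum>m\<in>D. c m * of_real (dsines R m k x))"

lemma trial_borel [measurable]: "trial R D c \<in> borel_measurable borel" "dtrial R D c k \<in> borel_measurable borel"
  unfolding trial_def[abs_def] dtrial_def[abs_def] by measurable

lemma trial_norm:
  assumes "R > 0" "finite D"
  shows "integrable lborel (\<lambda>x. (cmod (trial R D c x))\<^sup>2)"
    "(LINT x|lborel. (cmod (trial R D c x))\<^sup>2) = (\<Sum>m\<in>D. (cmod (c m))\<^sup>2 * (LINT x|lborel. (sines R m x)\<^sup>2))"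
  unfolding trial_def using assms
  by (intro orthogonal_combination_norm sines_mult_integrable sines_orthogonal; simp)+

lemma dtrial_norm:
  fixes D :: "('n::finite \<Rightarrow> nat) set"
  assumes "R > 0" "finite D"
  shows "integrable lborel (\<lambda>x. \<Sum>k\<in>UNIV. (cmod (dtrial R D c k x))\<^sup>2)"
    "(LINT x|lborel. (\<Sum>k\<in>UNIV. (cmod (dtrial R D c k x))\<^sup>2))
      = (\<Sum>m\<in>D. (cmod (c m))\<^sup>2 * ((\<Sum>k\<in>UNIV. (pi * real (m k) / R)\<^sup>2) * (LINT x|lborel. (sines R m x)\<^sup>2)))"
proof -
  have int: "integrable lborel (\<lambda>x. (cmod (dtrial R D c k x))\<^sup>2)" for k
    unfolding dtrial_def using assms
    by (intro orthogonal_combination_norm sines_mult_integrable sines_orthogonal; simp)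
  then show "integrable lborel (\<lambda>x. \<Sum>k\<in>UNIV. (cmod (dtrial R D c k x))\<^sup>2)"
    by (intro Bochner_Integration.integrable_sum)
  have "(LINT x|lborel. (cmod (dtrial R D c k x))\<^sup>2)
      = (\<Sum>m\<in>D. (cmod (c m))\<^sup>2 * (LINT x|lborel. (dsines R m k x)\<^sup>2))" for k
    unfolding dtrial_def using assms
    by (intro orthogonal_combination_norm sines_mult_integrable sines_orthogonal; simp)
  moreover have "(LINT x|lborel. (dsines R m k x)\<^sup>2) = (pi * real (m k) / R)\<^sup>2 * (LINT x|lborel. (sines R m x)\<^sup>2)" for m and k :: 'n
    using dsines_inner[OF assms(1), of m k m] by (simp add: power2_eq_square)
  ultimately have "(LINT x|lborel. (\<Sum>k\<in>UNIV. (cmod (dtrial R D c k x))\<^sup>2))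
      = (\<Sum>k\<in>UNIV. \<Sum>m\<in>D. (cmod (c m))\<^sup>2 * ((pi * real (m k) / R)\<^sup>2 * (LINT x|lborel. (sines R m x)\<^sup>2)))"
    using int by (subst Bochner_Integration.integral_sum) auto
  also have "\<dots> = (\<Sum>m\<in>D. (cmod (c m))\<^sup>2 * ((\<Sum>k\<in>UNIV. (pi * real (m k) / R)\<^sup>2) * (LINT x|lborel. (sines R m x)\<^sup>2)))"
    by (subst sum.swap) (simp add: sum_distrib_left sum_distrib_right)
  finally show "(LINT x|lborel. (\<Sum>k\<in>UNIV. (cmod (dtrial R D c k x))\<^sup>2))
      = (\<Sum>m\<in>D. (cmod (c m))\<^sup>2 * ((\<Sum>k\<in>UNIV. (pi * real (m k) / R)\<^sup>2) * (LINT x|lborel. (sines R m x)\<^sup>2)))" .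
qed

lemma trial_bound: "cmod (trial R D c x) \<le> (\<Sum>m\<in>D. cmod (c m))"
  unfolding trial_def
  by (intro sum_norm_le) (simp add: norm_mult mult_left_le sines_bound)

lemma dtrial_bound: "cmod (dtrial R D c k x) \<le> (\<Sum>m\<in>D. cmod (c m) * \<bar>pi * real (m k) / R\<bar>)"
  unfolding dtrial_def
  by (intro sum_norm_le) (simp only: norm_mult norm_of_real, intro mult_left_mono dsines_bound norm_ge_zero)

lemma trial_lipschitz:
  fixes D :: "('n::finite \<Rightarrow> nat) set"
  shows "\<exists>K. \<forall>x y. cmod (trial R D c x - trial R D c y) \<le> K * norm (x - y)"
proof (intro exI allI)
  fix x y :: "real^'n"
  have "cmod (trial R D c x - trial R D c y) = cmod (\<Sum>m\<in>D. c m * of_real (sines R m x - sines R m y))"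
    by (simp add: trial_def sum_subtractf[symmetric] algebra_simps)
  also have "\<dots> \<le> (\<Sum>m\<in>D. cmod (c m) * ((\<Sum>k\<in>UNIV. \<bar>pi * real (m k) / R\<bar>) * norm (x - y)))"
    by (intro sum_norm_le) (simp only: norm_mult norm_of_real, intro mult_left_mono sines_lipschitz norm_ge_zero)
  finally show "cmod (trial R D c x - trial R D c y)
      \<le> (\<Sum>m\<in>D. cmod (c m) * (\<Sum>k\<in>UNIV. \<bar>pi * real (m k) / R\<bar>)) * norm (x - y)"
    by (simp add: sum_distrib_right mult.assoc)
qed

lemma trial_has_derivative:
  assumes "R > 0" "x \<notin> grid R"
  shows "(trial R D c has_derivative (\<lambda>v. \<Sum>k\<in>UNIV. of_real (v $ k) * dtrial R D c k x)) (at x)"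
proof -
  have "((\<lambda>x. \<Sum>m\<in>D. c m * of_real (sines R m x)) has_derivative
      (\<lambda>v. \<Sum>m\<in>D. c m * of_real (\<Sum>k\<in>UNIV. v $ k * dsines R m k x))) (at x)"
    by (intro has_derivative_sum has_derivative_mult_right has_derivative_of_real sines_has_derivative assms)
  moreover have "(\<Sum>m\<in>D. c m * of_real (\<Sum>k\<in>UNIV. v $ k * dsines R m k x))
      = (\<Sum>k\<in>UNIV. of_real (v $ k) * dtrial R D c k x)" for v
    unfolding dtrial_def
    by (simp add: sum_distrib_left, subst sum.swap) (simp add: mult_ac)
  ultimately show ?thesis by (simp add: trial_def[abs_def])
qed

lemma trial_outside:
  assumes "R > 0" "x \<notin> cbox 0 (\<chi> k. R)"
  shows "trial R D c x = 0" "dtrial R D c k x = 0"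
  using sines_outside[OF assms] by (simp_all add: trial_def dtrial_def)

text \<open>Invariance of the squared gradient under an orthogonal change of variables. The gradient
  is complex, so the orthonormality of the rows of the matrix is used in place of norm preservation
  on real vectors.\<close>

lemma orthogonal_transformation_sum_norm:
  fixes A :: "real^'n \<Rightarrow> real^'n" and g :: "'n \<Rightarrow> complex"
  assumes "orthogonal_transformation A"
  shows "(\<Sum>i\<in>UNIV. (cmod (\<Sum>k\<in>UNIV. of_real (A (axis i 1) $ k) * g k))\<^sup>2) = (\<Sum>k\<in>UNIV. (cmod (g k))\<^sup>2)"
proof -
  define a where "a = (\<lambda>k i. A (axis i 1) $ k)"
  have "matrix A ** transpose (matrix A) = mat 1"
    using assms by (simp add: orthogonal_transformation_matrix orthogonal_matrix_def)
  then have aa: "(\<Sum>i\<in>UNIV. a k i * a l i) = (if k = l then 1 else 0)" for k l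
    by (simp add: vec_eq_iff matrix_matrix_mult_def transpose_def matrix_def mat_def a_def)
  have "of_real (\<Sum>i\<in>UNIV. (cmod (\<Sum>k\<in>UNIV. of_real (a k i) * g k))\<^sup>2)
      = (\<Sum>i\<in>UNIV. (\<Sum>k\<in>UNIV. of_real (a k i) * g k) * cnj (\<Sum>k\<in>UNIV. of_real (a k i) * g k))"
    by (simp only: of_real_sum complex_norm_square)
  also have "\<dots> = (\<Sum>i\<in>UNIV. \<Sum>k\<in>UNIV. \<Sum>l\<in>UNIV. of_real (a k i * a l i) * (g k * cnj (g l)))"
    by (simp add: cnj_sum sum_product mult_ac)
  also have "\<dots> = (\<Sum>k\<in>UNIV. \<Sum>i\<in>UNIV. \<Sum>l\<in>UNIV. of_real (a k i * a l i) * (g k * cnj (g l)))"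
    by (rule sum.swap)
  also have "\<dots> = (\<Sum>k\<in>UNIV. \<Sum>l\<in>UNIV. \<Sum>i\<in>UNIV. of_real (a k i * a l i) * (g k * cnj (g l)))"
    by (intro sum.cong refl sum.swap)
  also have "\<dots> = (\<Sum>k\<in>UNIV. \<Sum>l\<in>UNIV. of_real (\<Sum>i\<in>UNIV. a k i * a l i) * (g k * cnj (g l)))"
    by (simp only: of_real_sum sum_distrib_right)
  also have "\<dots> = (\<Sum>k\<in>UNIV. g k * cnj (g k))"
    by (simp add: aa if_distrib[of of_real] if_distrib[of "\<lambda>c. c * _"] cong: if_cong)
  also have "\<dots> = of_real (\<Sum>k\<in>UNIV. (cmod (g k))\<^sup>2)"
    by (simp only: of_real_sum complex_norm_square)
  finally show ?thesis unfolding a_def of_real_eq_iff .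
qed

context bounded_open
begin

lemma isometry_integral:
  fixes T :: "real^'n \<Rightarrow> real^'n" and f :: "real^'n \<Rightarrow> 'b::{banach,second_countable_topology}"
  assumes T: "\<And>x y. dist (T x) (T y) = dist x y" and [measurable]: "f \<in> borel_measurable borel"
  shows "(LINT x|lebesgue_on \<Omega>. f (T x)) = (LINT y|lborel. indicator (T ` \<Omega>) y *\<^sub>R f y)"
proof -
  have [measurable]: "T \<in> borel_measurable borel"
    by (rule isometry_borel[OF T])
  have [measurable]: "T ` \<Omega> \<in> sets borel" "\<Omega> \<in> sets borel"
    using isometry_open_image[OF T open_dom] open_dom by auto
  have "(LINT y|lborel. indicator (T ` \<Omega>) y *\<^sub>R f y)
      = (LINT y|distr lborel borel T. indicator (T ` \<Omega>) y *\<^sub>R f y)"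
    by (simp only: lborel_distr_isometry[OF T])
  also have "\<dots> = (LINT x|lborel. indicator (T ` \<Omega>) (T x) *\<^sub>R f (T x))"
    by (rule integral_distr) auto
  also have "\<dots> = (LINT x|lborel. indicator \<Omega> x *\<^sub>R f (T x))"
    using bij_is_inj[OF isometry_bij[OF T]]
    by (intro Bochner_Integration.integral_cong) (auto simp: indicator_def inj_image_mem_iff)
  also have "\<dots> = (LINT x|lebesgue. indicator \<Omega> x *\<^sub>R f (T x))"
    by (rule integral_completion[symmetric]) auto
  finally show ?thesis by (simp add: lebesgue_on_integral[OF lebesgue_dom])
qed

text \<open>Transplantation to \<open>\<Omega>\<close>: the pulled-back function is Lipschitz across
  the faces of the cube, hence in \<open>W12\<close>, while its norm and energy are integrals over
  the tile. Function spaces on the individual tiles are thus avoided.\<close>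

lemma trial_isometry:
  fixes T :: "real^'n \<Rightarrow> real^'n" and R D c
  assumes T: "\<And>x y. dist (T x) (T y) = dist x y" and R: "R > 0" and "finite D"
  defines "u \<equiv> \<lambda>x. trial R D c (T x)"
  shows "u \<in> W12 \<Omega>"
    and "L2.sq \<Omega> u = (LINT y|lborel. indicator (T ` \<Omega>) y * (cmod (trial R D c y))\<^sup>2)"
    and "dirichlet.sq u
      = (LINT y|lborel. indicator (T ` \<Omega>) y * (\<Sum>k\<in>UNIV. (cmod (dtrial R D c k y))\<^sup>2))"
proof -
  obtain A where A: "orthogonal_transformation A" "T = (\<lambda>x. T 0 + A x)"
    using isometry_orthogonal[OF T] by blast
  have linA: "bounded_linear A"
    using orthogonal_transformation_linear[OF A(1)] by (simp add: linear_conv_bounded_linear)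
  have [measurable]: "T \<in> borel_measurable borel"
    by (rule isometry_borel[OF T])
  \<comment> \<open>The chain rule: the partial derivative in direction \<open>i\<close> of the
    composition with \<open>T\<close>.\<close>
  define g where "g = (\<lambda>i x. \<Sum>k\<in>UNIV. of_real (A (axis i 1) $ k) * dtrial R D c k (T x))"
  have g_borel [measurable]: "g i \<in> borel_measurable borel" for i unfolding g_def by measurable
  have u_borel [measurable]: "u \<in> borel_measurable borel" unfolding u_def by measurable
  have u_bound: "cmod (u x) \<le> (\<Sum>m\<in>D. cmod (c m))" for x unfolding u_def by (rule trial_bound)
  define B where "B = (\<lambda>i. \<Sum>k\<in>UNIV. \<bar>A (axis i 1) $ k\<bar> * (\<Sum>m\<in>D. cmod (c m) * \<bar>pi * real (m k) / R\<bar>))"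
  have g_bound: "cmod (g i x) \<le> B i" for i x
    unfolding g_def B_def
    by (intro sum_norm_le) (simp only: norm_mult norm_of_real, intro mult_left_mono dtrial_bound abs_ge_zero)
  obtain K where K: "\<And>x y. cmod (trial R D c x - trial R D c y) \<le> K * norm (x - y)"
    using trial_lipschitz by blast
  have lip: "cmod (u x - u y) \<le> K * norm (x - y)" for x y
    using K[of "T x" "T y"] T[of x y] by (simp add: u_def dist_norm)
  have "AE y in distr lborel borel T. y \<notin> grid R"
    unfolding lborel_distr_isometry[OF T] by (rule AE_not_in[OF grid_null])
  then have "AE x in lborel. T x \<notin> grid R" by (rule AE_distrD[rotated]) simp
  then have deriv: "AE x in lborel. \<exists>D. (u has_derivative D) (at x) \<and> D (axis i 1) = g i x" for i
  proof eventually_elim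
    case (elim x)
    have "(T has_derivative A) (at x)"
      by (subst A(2)) (auto intro!: derivative_eq_intros bounded_linear_imp_has_derivative[OF linA])
    from has_derivative_compose[OF this trial_has_derivative[OF R elim, of D c]]
    have "(u has_derivative (\<lambda>v. \<Sum>k\<in>UNIV. of_real (A v $ k) * dtrial R D c k (T x))) (at x)"
      unfolding u_def .
    then show ?case by (intro exI conjI, assumption) (simp add: g_def)
  qed
  have wp: "is_weak_partial \<Omega> i u (g i)" for i
    by (rule lipschitz_is_weak_partial[OF lip u_bound g_borel g_bound deriv])
  have uL: "u \<in> L2 \<Omega>" by (rule L2_bounded_borel[OF u_borel u_bound])
  have gL: "g i \<in> L2 \<Omega>" for i by (rule L2_bounded_borel[OF g_borel g_bound])
  show uW: "u \<in> W12 \<Omega>" by (rule W12_I[OF uL gL wp])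
  show "L2.sq \<Omega> u = (LINT y|lborel. indicator (T ` \<Omega>) y * (cmod (trial R D c y))\<^sup>2)"
    using isometry_integral[OF T, of "\<lambda>y. (cmod (trial R D c y))\<^sup>2"] by (simp add: L2_inner_same u_def)
  have "dirichlet_form \<Omega> u u = (\<Sum>i\<in>UNIV. L2_inner \<Omega> (g i) (g i))"
    by (rule dirichlet_form_eqI[OF uW uW gL gL weak_partial_AE_eq[OF uW gL wp] weak_partial_AE_eq[OF uW gL wp]])
  then have "dirichlet.sq u = (\<Sum>i\<in>UNIV. LINT x|lebesgue_on \<Omega>. (cmod (g i x))\<^sup>2)"
    by (simp add: L2_inner_same)
  also have "\<dots> = (LINT x|lebesgue_on \<Omega>. (\<Sum>i\<in>UNIV. (cmod (g i x))\<^sup>2))"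
    by (rule Bochner_Integration.integral_sum[symmetric]) (rule L2_integrable[OF gL])
  also have "\<dots> = (LINT x|lebesgue_on \<Omega>. (\<Sum>k\<in>UNIV. (cmod (dtrial R D c k (T x)))\<^sup>2))"
    unfolding g_def orthogonal_transformation_sum_norm[OF A(1)] ..
  also have "\<dots> = (LINT y|lborel. indicator (T ` \<Omega>) y * (\<Sum>k\<in>UNIV. (cmod (dtrial R D c k y))\<^sup>2))"
    using isometry_integral[OF T, of "\<lambda>y. \<Sum>k\<in>UNIV. (cmod (dtrial R D c k y))\<^sup>2"] by simp
  finally show "dirichlet.sq u
      = (LINT y|lborel. indicator (T ` \<Omega>) y * (\<Sum>k\<in>UNIV. (cmod (dtrial R D c k y))\<^sup>2))" .
qed

text \<open>Orthogonality of a trial function to a given function is a homogeneous linear equation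
  in the coefficients \<open>c\<close>, with this matrix entry.\<close>

lemma L2_inner_trial:
  fixes T :: "real^'n \<Rightarrow> real^'n"
  assumes T: "\<And>x y. dist (T x) (T y) = dist x y" and e: "e \<in> L2 \<Omega>"
  shows "L2_inner \<Omega> (\<lambda>x. trial R D c (T x)) e = (\<Sum>m\<in>D. L2_inner \<Omega> (\<lambda>x. of_real (sines R m (T x))) e * c m)"
proof -
  have [measurable]: "T \<in> borel_measurable borel"
    by (rule isometry_borel[OF T])
  have sL: "(\<lambda>x. complex_of_real (sines R m (T x))) \<in> L2 \<Omega>" for m
    by (rule L2_bounded_borel[of _ 1]) (simp_all add: sines_bound)
  have "(\<lambda>x. trial R D c (T x)) = (\<Sum>m\<in>D. cscale (c m) (\<lambda>x. of_real (sines R m (T x))))"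
    by (simp add: fun_eq_iff trial_def)
  then show ?thesis
    using e sL by (simp add: L2.form_sum L2.form_scale L2_scale mult.commute)
qed

lemma cube_isometry:
  assumes "\<Omega> \<noteq> {}"
  obtains R and T :: "real^'n \<Rightarrow> real^'n" where "R > 0" "\<And>x y. dist (T x) (T y) = dist x y"
    "cbox 0 (\<chi> k. R) \<subseteq> T ` \<Omega>"
proof -
  obtain a where "a \<in> \<Omega>" using assms by blast
  then obtain r where r: "r > 0" "ball a r \<subseteq> \<Omega>" using open_dom openE by blast
  \<comment> \<open>The sum of the coordinates bounds the norm, so points of the cube have norm at
    most \<open>CARD('n) * R = r / 2\<close>.\<close>
  define R where "R = r / (2 * real CARD('n))"
  have n0: "real CARD('n) > 0" by simp
  show ?thesis
  proof (rule that[of R "\<lambda>x. x - a"])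
    show "R > 0" using r by (simp add: R_def)
    show "cbox 0 (\<chi> k. R) \<subseteq> (\<lambda>x. x - a) ` \<Omega>"
    proof
      fix x assume "x \<in> cbox (0 :: real^'n) (\<chi> k. R)"
      then have "\<bar>x $ k\<bar> \<le> R" for k by (auto simp: mem_box_cart)
      then have "norm x \<le> (\<Sum>k\<in>(UNIV::'n set). R)"
        by (intro order_trans[OF norm_le_l1_cart] sum_mono)
      also have "\<dots> < r" using r n0 by (simp add: R_def)
      finally have "x + a \<in> ball a r" by (simp add: dist_norm)
      then have "x + a \<in> \<Omega>" using r by blast
      then show "x \<in> (\<lambda>x. x - a) ` \<Omega>" by (intro image_eqI[of _ _ "x + a"]) auto
    qed
  qed (simp add: dist_norm)
qed

lemma W12_infinite_dimension:
  assumes "\<Omega> \<noteq> {}" "finite S" "S \<subseteq> W12 \<Omega>"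
  shows "\<exists>v\<in>W12 \<Omega>. L2.sq \<Omega> v \<noteq> 0 \<and> (\<forall>e\<in>S. L2_inner \<Omega> v e = 0)"
proof -
  obtain R and T :: "real^'n \<Rightarrow> real^'n" where R: "R > 0" and T: "\<And>x y. dist (T x) (T y) = dist x y"
    and cube: "cbox 0 (\<chi> k. R) \<subseteq> T ` \<Omega>"
    using cube_isometry[OF assms(1)] by blast
  \<comment> \<open>The constant multi-indices \<open>j + 1\<close> for
    \<open>j \<le> card S\<close>: one unknown more than there are conditions.\<close>
  define D where "D = (\<lambda>j (_::'n). Suc j) ` {..card S}"
  have inj: "inj_on (\<lambda>j (_::'n). Suc j) {..card S}" by (auto simp: inj_on_def fun_eq_iff)
  have D: "finite D" "card S < card D" "\<And>m k. m \<in> D \<Longrightarrow> m k \<ge> 1"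
    using card_image[OF inj] by (auto simp: D_def)
  obtain c where c: "\<exists>m\<in>D. c m \<noteq> 0"
    "\<forall>e\<in>S. (\<Sum>m\<in>D. L2_inner \<Omega> (\<lambda>x. of_real (sines R m (T x))) e * c m) = 0"
    using underdetermined_system[OF assms(2) D(1,2), of "\<lambda>e m. L2_inner \<Omega> (\<lambda>x. of_real (sines R m (T x))) e"]
    by blast
  define v where "v = (\<lambda>x. trial R D c (T x))"
  have vW: "v \<in> W12 \<Omega>" unfolding v_def by (rule trial_isometry(1)[OF T R D(1)])
  have "L2_inner \<Omega> v e = 0" if "e \<in> S" for e
    using L2_inner_trial[OF T W12_L2, of e R D c] c(2) assms(3) that by (auto simp: v_def)
  moreover have "L2.sq \<Omega> v \<noteq> 0"
  proof -
    have "L2.sq \<Omega> v = (LINT y|lborel. indicator (T ` \<Omega>) y * (cmod (trial R D c y))\<^sup>2)"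
      unfolding v_def by (rule trial_isometry(2)[OF T R D(1)])
    also have "\<dots> = (LINT y|lborel. (cmod (trial R D c y))\<^sup>2)"
    proof (rule Bochner_Integration.integral_cong)
      show "indicator (T ` \<Omega>) y * (cmod (trial R D c y))\<^sup>2 = (cmod (trial R D c y))\<^sup>2" for y
        using trial_outside(1)[OF R, of y D c] cube by (cases "y \<in> T ` \<Omega>") auto
    qed simp
    also have "\<dots> = (\<Sum>m\<in>D. (cmod (c m))\<^sup>2 * (LINT x|lborel. (sines R m x)\<^sup>2))"
      by (rule trial_norm(2)[OF R D(1)])
    also have "\<dots> > 0"
    proof -
      obtain m where m: "m \<in> D" "c m \<noteq> 0" using c(1) by blast
      have "0 < (LINT x|lborel. (sines R m x)\<^sup>2)" by (rule sines_norm_pos[OF R D(3)[OF m(1)]])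
      then show ?thesis using m(2) by (intro sum_pos2[OF D(1) m(1)]) auto
    qed
    finally show ?thesis by simp
  qed
  ultimately show ?thesis using vW by blast
qed

lemma compact_form_pair_W12:
  assumes "\<Omega> \<noteq> {}" "compact_embedding \<Omega>"
  shows "compact_form_pair cscale (W12 \<Omega>) (dirichlet_form \<Omega>) (L2_inner \<Omega>)"
proof -
  interpret b: hermitian_form cscale "W12 \<Omega>" "L2_inner \<Omega>" by (rule hermitian_form_L2_W12)
  show ?thesis
    by unfold_locales (fact W12_compact[OF assms(2)] W12_complete W12_infinite_dimension[OF assms(1)])+
qed

end

section \<open>Neumann eigenvalues\<close>

context bounded_open
begin

lemma neumann_eigenspace_iff:
  "u \<in> neumann_eigenspace \<Omega> t \<longleftrightarrow>
     u \<in> W12 \<Omega> \<and> (\<forall>v\<in>W12 \<Omega>. dirichlet_form \<Omega> u v = of_real t * L2_inner \<Omega> u v)"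
proof -
  have "L2_inner \<Omega> (cscale (of_real t) u) v = of_real t * L2_inner \<Omega> u v" if "u \<in> W12 \<Omega>" "v \<in> W12 \<Omega>" for u v
    using that by (intro L2.form_scale W12_L2)
  moreover have "(\<lambda>x. of_real t * u x) \<in> L2 \<Omega>" if "u \<in> W12 \<Omega>"
    using L2_scale[OF W12_L2[OF that]] by (simp add: cscale_def)
  ultimately show ?thesis
    by (auto simp: neumann_eigenspace_def neumann_laplacian_def L2_inner_def cscale_def)
qed

lemma L2_inner_eq_0_AE:
  assumes "u \<in> L2 \<Omega>" "v \<in> L2 \<Omega>" "AE x in lebesgue_on \<Omega>. u x = 0"
  shows "L2_inner \<Omega> u v = 0"
  using L2.form_eq_0[of u \<Omega> v] L2_inner_same_eq_0_iff[of u \<Omega>] assms by blast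

context
  assumes nonempty: "\<Omega> \<noteq> {}" and cpt: "compact_embedding \<Omega>"
begin

interpretation P: compact_form_pair cscale "W12 \<Omega>" "dirichlet_form \<Omega>" "L2_inner \<Omega>"
  by (rule compact_form_pair_W12[OF nonempty cpt])

text \<open>The eigenvectors \<open>e k\<close> with \<open>\<nu> k = t\<close> are a basis:
  orthonormality gives independence, \<open>eigenvector_expansion\<close> gives spanning up to null
  functions. The bijection \<open>h\<close> renumbers them as \<open>has_dim_AE\<close>
  demands.\<close>

lemma eigenspace_dim:
  assumes e\<nu>: "P.eigensequence e \<nu>"
  shows "has_dim_AE (lebesgue_on \<Omega>) (neumann_eigenspace \<Omega> t) (card {k. \<nu> k = t})"
proof -
  define K where "K = {k. \<nu> k = t}"
  have fK: "finite K" unfolding K_def by (rule P.finite_eigenvalue[OF e\<nu>])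
  obtain h where h: "bij_betw h {..<card K} K"
    using ex_bij_betw_nat_finite[OF fK] by (auto simp: atLeast0LessThan)
  have eW: "e k \<in> W12 \<Omega>" for k by (rule P.eV[OF e\<nu>])
  have eL: "e k \<in> L2 \<Omega>" for k by (rule W12_L2[OF eW])
  have hK: "h i \<in> K" if "i < card K" for i using h that by (auto simp: bij_betw_def)
  have reindex: "(\<Sum>i<card K. f (h i)) = sum f K" for f :: "nat \<Rightarrow> complex"
    by (rule sum.reindex_bij_betw[OF h])
  have 1: "\<forall>i<card K. e (h i) \<in> neumann_eigenspace \<Omega> t"
    using hK eW P.eigenvector[OF e\<nu>] by (auto simp: neumann_eigenspace_iff K_def)
  have 2: "\<forall>i<card K. c i = 0"
    if AE0: "AE x in lebesgue_on \<Omega>. (\<Sum>i<card K. c i * e (h i) x) = 0" for c :: "nat \<Rightarrow> complex"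
  proof (intro allI impI)
    fix j assume j: "j < card K"
    define s where "s = (\<Sum>i<card K. cscale (c i) (e (h i)))"
    have sL: "s \<in> L2 \<Omega>" unfolding s_def by (intro L2.V_sum L2_scale eL)
    have "AE x in lebesgue_on \<Omega>. s x = 0" using AE0 by (simp add: s_def)
    then have "0 = L2_inner \<Omega> s (e (h j))" using L2_inner_eq_0_AE[OF sL eL] by simp
    also have "\<dots> = (\<Sum>i<card K. c i * L2_inner \<Omega> (e (h i)) (e (h j)))"
      unfolding s_def by (subst L2.form_sum) (simp_all add: eL L2_scale L2.form_scale)
    also have "\<dots> = (\<Sum>i<card K. if i = j then c j else 0)"
      using h j by (intro sum.cong) (auto simp: P.orthonormal[OF e\<nu>] bij_betw_def inj_on_def)
    also have "\<dots> = c j" using j by simp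
    finally show "c j = 0" by simp
  qed
  have 3: "\<exists>c :: nat \<Rightarrow> complex. AE x in lebesgue_on \<Omega>. v x = (\<Sum>i<card K. c i * e (h i) x)"
    if "v \<in> neumann_eigenspace \<Omega> t" for v
  proof -
    define w where "w = v - (\<Sum>k | \<nu> k = t. cscale (L2_inner \<Omega> v (e k)) (e k))"
    have v: "v \<in> W12 \<Omega>" "\<And>v'. v' \<in> W12 \<Omega> \<Longrightarrow> dirichlet_form \<Omega> v v' = of_real t * L2_inner \<Omega> v v'"
      using that by (auto simp: neumann_eigenspace_iff)
    have "w \<in> W12 \<Omega>" "L2.sq \<Omega> w = 0"
      unfolding w_def by (rule P.eigenvector_expansion[OF e\<nu> v]; assumption)+
    then have "AE x in lebesgue_on \<Omega>. w x = 0" using L2_inner_same_eq_0_iff[OF W12_L2] by blast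
    then have "AE x in lebesgue_on \<Omega>. v x = (\<Sum>i<card K. L2_inner \<Omega> v (e (h i)) * e (h i) x)"
    proof eventually_elim
      case (elim x)
      then show ?case using reindex[of "\<lambda>k. L2_inner \<Omega> v (e k) * e k x"] by (simp add: w_def K_def)
    qed
    then show ?thesis by (intro exI[of _ "\<lambda>i. L2_inner \<Omega> v (e (h i))"])
  qed
  show ?thesis
    unfolding has_dim_AE_def K_def[symmetric]
    by (intro exI[of _ "\<lambda>i. e (h i)"] conjI ballI allI impI) (use 1 2 3 in blast)+
qed

lemma neumann_eigenvalues_exist: "enumerates_neumann_eigenvalues \<Omega> (neumann_eigenvalue \<Omega>)"
proof -
  obtain e \<nu> where e\<nu>: "P.eigensequence e \<nu>" using P.eigensequence_exists by blast
  \<comment> \<open>The eigensequence is indexed from 0, the eigenvalues from 1;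
    \<open>\<mu> 0\<close> merely repeats \<open>\<mu> 1\<close>.\<close>
  define \<mu> where "\<mu> = (\<lambda>k. \<nu> (k - 1))"
  have "enumerates_neumann_eigenvalues \<Omega> \<mu>"
    unfolding enumerates_neumann_eigenvalues_def
  proof (intro conjI allI)
    show "mono_on {1..} \<mu>"
      using P.mono_eigenvalues[OF e\<nu>] by (auto simp: mono_on_def mono_def \<mu>_def)
    fix t
    have eq: "{k. 1 \<le> k \<and> \<mu> k = t} = Suc ` {k. \<nu> k = t}"
    proof (intro set_eqI iffI)
      fix k assume "k \<in> {k. 1 \<le> k \<and> \<mu> k = t}"
      then show "k \<in> Suc ` {k. \<nu> k = t}" by (intro image_eqI[of _ _ "k - 1"]) (auto simp: \<mu>_def)
    qed (auto simp: \<mu>_def)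
    show "finite {k. 1 \<le> k \<and> \<mu> k = t}" unfolding eq using P.finite_eigenvalue[OF e\<nu>] by simp
    show "has_dim_AE (lebesgue_on \<Omega>) (neumann_eigenspace \<Omega> t) (card {k. 1 \<le> k \<and> \<mu> k = t})"
      unfolding eq using eigenspace_dim[OF e\<nu>] by (simp add: card_image)
  qed
  then show ?thesis unfolding neumann_eigenvalue_def by (rule someI[of "enumerates_neumann_eigenvalues \<Omega>"])
qed

text \<open>The enumeration is arbitrary, as the one picked by \<open>SOME\<close> is not known to
  be the constructed one. Instead of comparing two enumerations, \<open>F\<close> is assembled from
  the bases that \<open>has_dim_AE\<close> provides for \<open>\<mu>\<close>, so its size is
  controlled by the count for \<open>\<mu>\<close>, while the constructed eigensequence supplies the
  variational bound.\<close>

lemma variational_family: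
  assumes \<mu>: "enumerates_neumann_eigenvalues \<Omega> \<mu>"
  shows "finite {k. 1 \<le> k \<and> \<mu> k < lam}"
    and "\<exists>F. finite F \<and> F \<subseteq> W12 \<Omega> \<and> card F \<le> card {k. 1 \<le> k \<and> \<mu> k < lam} \<and>
      (\<forall>v\<in>W12 \<Omega>. (\<forall>f\<in>F. L2_inner \<Omega> v f = 0) \<longrightarrow>
         lam * L2.sq \<Omega> v \<le> dirichlet.sq v)"
proof -
  obtain e \<nu> where e\<nu>: "P.eigensequence e \<nu>" using P.eigensequence_exists by blast
  define A where "A = (\<lambda>t. {k. 1 \<le> k \<and> \<mu> k = t})"
  have finA: "finite (A t)" and dim: "has_dim_AE (lebesgue_on \<Omega>) (neumann_eigenspace \<Omega> t) (card (A t))" for t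
    using \<mu> by (auto simp: enumerates_neumann_eigenvalues_def A_def)
  from dim have "\<forall>t. \<exists>f :: nat \<Rightarrow> real^'n \<Rightarrow> complex. (\<forall>i<card (A t). f i \<in> neumann_eigenspace \<Omega> t) \<and>
        (\<forall>c. (AE x in lebesgue_on \<Omega>. (\<Sum>i<card (A t). c i * f i x) = 0) \<longrightarrow> (\<forall>i<card (A t). c i = 0)) \<and>
        (\<forall>v\<in>neumann_eigenspace \<Omega> t. \<exists>c. AE x in lebesgue_on \<Omega>. v x = (\<Sum>i<card (A t). c i * f i x))"
    unfolding has_dim_AE_def by blast
  then obtain f where f: "\<And>t i. i < card (A t) \<Longrightarrow> f t i \<in> neumann_eigenspace \<Omega> t"
    and indep: "\<And>t c. (AE x in lebesgue_on \<Omega>. (\<Sum>i<card (A t). c i * f t i x) = 0) \<Longrightarrow> \<forall>i<card (A t). c i = 0"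
    and span: "\<And>t v. v \<in> neumann_eigenspace \<Omega> t \<Longrightarrow> \<exists>c. AE x in lebesgue_on \<Omega>. v x = (\<Sum>i<card (A t). c i * f t i x)"
    unfolding choice_iff by blast
  define T where "T = \<nu> ` {k. \<nu> k < lam}"
  have finT: "finite T" unfolding T_def using P.finite_below[OF e\<nu>] by simp
  \<comment> \<open>A value listed by \<open>\<mu>\<close> but absent from \<open>\<nu>\<close>
    would have a nonzero eigenvector, whose expansion over an empty set shows that it vanishes
    almost everywhere.\<close>
  have noeig: "A t = {}" if "t \<notin> range \<nu>" for t
  proof (rule ccontr)
    assume "A t \<noteq> {}"
    then have pos: "0 < card (A t)" using finA by (simp add: card_gt_0_iff)
    define w where "w = f t 0 - (\<Sum>k | \<nu> k = t. cscale (L2_inner \<Omega> (f t 0) (e k)) (e k))"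
    have f0: "f t 0 \<in> W12 \<Omega>" "\<And>v. v \<in> W12 \<Omega> \<Longrightarrow> dirichlet_form \<Omega> (f t 0) v = of_real t * L2_inner \<Omega> (f t 0) v"
      using f[OF pos] by (auto simp: neumann_eigenspace_iff)
    have "w \<in> W12 \<Omega>" "L2.sq \<Omega> w = 0"
      unfolding w_def by (rule P.eigenvector_expansion[OF e\<nu> f0]; assumption)+
    moreover have "{k. \<nu> k = t} = {}" using that by auto
    then have "w = f t 0" unfolding w_def by simp
    ultimately have "AE x in lebesgue_on \<Omega>. f t 0 x = 0" using L2_inner_same_eq_0_iff[OF W12_L2] by blast
    then have "AE x in lebesgue_on \<Omega>. (\<Sum>i<card (A t). (if i = 0 then 1 else 0) * f t i x) = 0"
      by eventually_elim (auto intro!: sum.neutral)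
    from indep[OF this] pos show False by auto
  qed
  have union: "{k. 1 \<le> k \<and> \<mu> k < lam} = (\<Union>t\<in>T. A t)"
  proof (intro set_eqI iffI)
    fix k assume k: "k \<in> {k. 1 \<le> k \<and> \<mu> k < lam}"
    then have "k \<in> A (\<mu> k)" by (simp add: A_def)
    moreover from this have "\<mu> k \<in> range \<nu>" using noeig by blast
    then have "\<mu> k \<in> T" using k by (auto simp: T_def)
    ultimately show "k \<in> (\<Union>t\<in>T. A t)" by blast
  qed (auto simp: A_def T_def)
  show "finite {k. 1 \<le> k \<and> \<mu> k < lam}" unfolding union using finT finA by blast
  have card_union: "card {k. 1 \<le> k \<and> \<mu> k < lam} = (\<Sum>t\<in>T. card (A t))"
    unfolding union using finT finA by (intro card_UN_disjoint) (auto simp: A_def)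
  define F where "F = (\<Union>t\<in>T. f t ` {..<card (A t)})"
  have "finite F" unfolding F_def using finT by blast
  moreover have FW: "F \<subseteq> W12 \<Omega>" using f by (auto simp: F_def neumann_eigenspace_iff)
  moreover have "card F \<le> card {k. 1 \<le> k \<and> \<mu> k < lam}"
  proof -
    have "card F \<le> (\<Sum>t\<in>T. card (f t ` {..<card (A t)}))"
      unfolding F_def by (rule card_UN_le[OF finT])
    also have "\<dots> \<le> (\<Sum>t\<in>T. card (A t))" by (rule sum_mono) (metis card_image_le card_lessThan finite_lessThan)
    finally show ?thesis by (simp only: card_union)
  qed
  moreover have "lam * L2.sq \<Omega> v \<le> dirichlet.sq v"
    if v: "v \<in> W12 \<Omega>" "\<forall>f\<in>F. L2_inner \<Omega> v f = 0" for v
  proof (rule P.variational_bound[OF e\<nu> v(1)])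
    fix k assume k: "\<nu> k < lam"
    define t where "t = \<nu> k"
    have t: "t \<in> T" using k by (auto simp: T_def t_def)
    have ek: "e k \<in> neumann_eigenspace \<Omega> t"
      using P.eV[OF e\<nu>] P.eigenvector[OF e\<nu>] by (auto simp: neumann_eigenspace_iff t_def)
    \<comment> \<open>Each constructed eigenvector below \<open>lam\<close> is a combination of
      members of \<open>F\<close>, so orthogonality to \<open>F\<close> suffices.\<close>
    obtain c where c: "AE x in lebesgue_on \<Omega>. e k x = (\<Sum>i<card (A t). c i * f t i x)"
      using span[OF ek] by blast
    have fL: "f t i \<in> L2 \<Omega>" if "i < card (A t)" for i
      using f[OF that] by (auto simp: neumann_eigenspace_iff intro: W12_L2)
    define s where "s = (\<Sum>i<card (A t). cscale (c i) (f t i))"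
    have sL: "s \<in> L2 \<Omega>" unfolding s_def by (rule L2.V_sum) (use fL in \<open>auto intro: L2_scale\<close>)
    have vL: "v \<in> L2 \<Omega>" by (rule W12_L2[OF v(1)])
    have "L2_inner \<Omega> v (e k) = L2_inner \<Omega> v s"
      by (rule L2_inner_cong_AE[OF vL W12_L2[OF P.eV[OF e\<nu>]] vL sL]) (use c in \<open>simp_all add: s_def\<close>)
    also have "\<dots> = (\<Sum>i<card (A t). cnj (c i) * L2_inner \<Omega> v (f t i))"
      unfolding s_def by (subst L2.form_sum_right[OF vL]) (simp_all add: fL L2_scale L2.form_scale_right vL)
    also have "\<dots> = 0"
      using v(2) t by (intro sum.neutral ballI) (auto simp: F_def)
    finally show "L2_inner \<Omega> v (e k) = 0" .
  qed
  ultimately show "\<exists>F. finite F \<and> F \<subseteq> W12 \<Omega> \<and> card F \<le> card {k. 1 \<le> k \<and> \<mu> k < lam} \<and>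
      (\<forall>v\<in>W12 \<Omega>. (\<forall>f\<in>F. L2_inner \<Omega> v f = 0) \<longrightarrow>
         lam * L2.sq \<Omega> v \<le> dirichlet.sq v)"
    by blast
qed

end

end

section \<open>Counting\<close>

text \<open>The sums are the Dirichlet eigenvalues of the cube of side \<open>R\<close>; all
  frequencies are at least 1, since a zero frequency would give the zero function.\<close>

definition dirichlet_indices :: "real \<Rightarrow> real \<Rightarrow> ('n::finite \<Rightarrow> nat) set" where
  "dirichlet_indices lam R = {m. (\<forall>k. m k \<ge> 1) \<and> (\<Sum>k\<in>UNIV. (pi * real (m k) / R)\<^sup>2) < lam}"

lemma finite_dirichlet_indices:
  assumes "R > 0"
  shows "finite (dirichlet_indices lam R :: ('n::finite \<Rightarrow> nat) set)"
proof -
  define B where "B = nat \<lceil>lam * R\<^sup>2\<rceil>"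
  have "m k \<le> B" if m: "m \<in> dirichlet_indices lam R" for m :: "'n \<Rightarrow> nat" and k
  proof -
    have "(pi * real (m k) / R)\<^sup>2 \<le> (\<Sum>k\<in>UNIV. (pi * real (m k) / R)\<^sup>2)"
      by (rule member_le_sum) auto
    then have "(pi * real (m k) / R)\<^sup>2 < lam" using m by (simp add: dirichlet_indices_def)
    then have *: "pi\<^sup>2 * (real (m k))\<^sup>2 < lam * R\<^sup>2"
      using assms by (simp add: power_divide power_mult_distrib field_simps)
    have "1 * real (m k) \<le> pi\<^sup>2 * (real (m k))\<^sup>2"
    proof (rule mult_mono)
      show "1 \<le> pi\<^sup>2" using pi_gt3 by (intro one_le_power) simp
      show "real (m k) \<le> (real (m k))\<^sup>2"
        using m by (intro self_le_power) (auto simp: dirichlet_indices_def)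
    qed auto
    then have "real (m k) \<le> lam * R\<^sup>2" using * by simp
    then show ?thesis unfolding B_def by linarith
  qed
  then have "dirichlet_indices lam R \<subseteq> PiE UNIV (\<lambda>_::'n. {..B})" by (auto simp: PiE_def)
  then show ?thesis by (rule finite_subset) (intro finite_PiE; simp)
qed

section \<open>Lattice points in a ball\<close>

lemma unit_cube_measure: "measure lborel (cbox x (x + (\<chi> k. 1)) :: (real^'n) set) = 1"
proof -
  have "x \<in> cbox x (x + (\<chi> k. 1))" by (simp add: mem_box_cart)
  then have "cbox x (x + (\<chi> k. 1)) \<noteq> {}" by blast
  then show ?thesis by (subst content_cbox_cart) auto
qed

text \<open>Every point of the ball lies in a unit cube with integer corners, and \<open>2 ^ n\<close> such cubes,
  one for each orthant, correspond to the same index.\<close>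

lemma dirichlet_indices_card:
  assumes R: "R > 0" and lam: "lam > 0" and pos: "0 \<le> R * sqrt lam / pi - sqrt (real CARD('n))"
  shows "measure lborel (ball (0::real^'n) 1) * (R * sqrt lam / pi - sqrt (real CARD('n))) ^ CARD('n)
    \<le> 2 ^ CARD('n) * real (card (dirichlet_indices lam R :: ('n::finite \<Rightarrow> nat) set))"
proof -
  \<comment> \<open>The loss \<open>sqrt (real CARD('n))\<close> is the diagonal of a unit cube:
    replacing a point by the farthest corner of its cube raises the norm by at most this.\<close>
  define \<rho> where "\<rho> = R * sqrt lam / pi - sqrt (real CARD('n))"
  \<comment> \<open>The absolute coordinates of the corner farthest from the origin in the unit cube
    with lower corner \<open>z\<close>; they are always at least 1.\<close>
  define idx where "idx = (\<lambda>(z :: 'n \<Rightarrow> int) k. nat (if z k \<ge> 0 then z k + 1 else - z k))"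
  define D where "D = (dirichlet_indices lam R :: ('n \<Rightarrow> nat) set)"
  have finD: "finite D" unfolding D_def by (rule finite_dirichlet_indices[OF R])
  define Z where "Z = {z. idx z \<in> D}"
  \<comment> \<open>The sign pattern and the index determine \<open>z\<close>, which yields the
    factor \<open>2 ^ CARD('n)\<close>.\<close>
  define code where "code = (\<lambda>z :: 'n \<Rightarrow> int. ({k. z k \<ge> 0}, idx z))"
  have inj: "inj_on code Z"
  proof (rule inj_onI)
    fix y z assume eq: "code y = code z"
    show "y = z"
    proof
      fix k
      have "y k \<ge> 0 \<longleftrightarrow> z k \<ge> 0" "idx y k = idx z k" using eq by (auto simp: code_def)
      then show "y k = z k" by (auto simp: idx_def split: if_splits)
    qed
  qed
  have sub: "code ` Z \<subseteq> UNIV \<times> D" by (auto simp: code_def Z_def)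
  have fin: "finite (UNIV \<times> D :: ('n set \<times> ('n \<Rightarrow> nat)) set)" using finD by simp
  have finZ: "finite Z" using finite_imageD[OF finite_subset[OF sub fin] inj] .
  have "card Z \<le> card (UNIV \<times> D :: ('n set \<times> ('n \<Rightarrow> nat)) set)"
    using card_mono[OF fin sub] by (simp add: card_image[OF inj])
  also have "\<dots> = 2 ^ CARD('n) * card D" by (simp add: card_cartesian_product card_UNIV_set)
  finally have cardZ: "card Z \<le> 2 ^ CARD('n) * card D" .
  define Q where "Q = (\<lambda>z :: 'n \<Rightarrow> int. cbox (\<chi> k. of_int (z k)) ((\<chi> k. of_int (z k)) + (\<chi> k. 1)) :: (real^'n) set)"
  have cover: "ball (0::real^'n) \<rho> \<subseteq> (\<Union>z\<in>Z. Q z)"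
  proof
    fix x :: "real^'n" assume x: "x \<in> ball 0 \<rho>"
    define z where "z = (\<lambda>k. \<lfloor>x $ k\<rfloor>)"
    have "x \<in> Q z" by (auto simp: Q_def mem_box_cart z_def intro: less_imp_le)
    moreover have "z \<in> Z"
    proof -
      have ge1: "idx z k \<ge> 1" for k by (auto simp: idx_def)
      have le: "real (idx z k) \<le> \<bar>x $ k\<bar> + 1" for k
        unfolding idx_def z_def by (auto split: if_splits) linarith+
      define y :: "real^'n" where "y = (\<chi> k. real (idx z k))"
      have "norm y \<le> norm ((\<chi> k. \<bar>x $ k\<bar>) + (\<chi> k. 1) :: real^'n)"
        by (rule norm_le_componentwise_cart) (use le in \<open>simp add: y_def\<close>)
      also have "\<dots> \<le> norm (\<chi> k. \<bar>x $ k\<bar> :: real^'n) + norm (\<chi> k. 1 :: real^'n)" by (rule norm_triangle_ineq)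
      also have "norm (\<chi> k. \<bar>x $ k\<bar> :: real^'n) = norm x" by (simp add: norm_vec_def L2_set_def)
      also have "norm (\<chi> k. 1 :: real^'n) = sqrt (real CARD('n))" by (simp add: norm_vec_def L2_set_def)
      finally have "norm y < R * sqrt lam / pi" using x by (simp add: \<rho>_def)
      then have "(norm y)\<^sup>2 < (R * sqrt lam / pi)\<^sup>2" by (rule power_strict_mono) auto
      then have "(pi / R)\<^sup>2 * (norm y)\<^sup>2 < lam"
        using R lam by (simp add: power_mult_distrib power_divide field_simps)
      moreover have "(norm y)\<^sup>2 = (\<Sum>k\<in>UNIV. (real (idx z k))\<^sup>2)"
        by (simp add: norm_vec_def L2_set_def y_def sum_nonneg)
      ultimately have "(\<Sum>k\<in>UNIV. (pi * real (idx z k) / R)\<^sup>2) < lam"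
        by (simp add: sum_distrib_left power_mult_distrib power_divide)
      then show ?thesis using ge1 by (simp add: Z_def D_def dirichlet_indices_def)
    qed
    ultimately show "x \<in> (\<Union>z\<in>Z. Q z)" by blast
  qed
  have "measure lborel (ball (0::real^'n) \<rho>) \<le> measure lborel (\<Union>z\<in>Z. Q z)"
  proof (rule measure_mono_fmeasurable[OF cover])
    show "(\<Union>z\<in>Z. Q z) \<in> fmeasurable lborel"
      by (rule fmeasurable.finite_UN[OF finZ]) (simp add: Q_def fmeasurable_cbox)
  qed auto
  also have "\<dots> \<le> (\<Sum>z\<in>Z. measure lborel (Q z))"
    by (rule measure_UNION_le[OF finZ]) (simp add: Q_def)
  also have "\<dots> = real (card Z)" by (simp add: Q_def unit_cube_measure)
  also have "\<dots> \<le> 2 ^ CARD('n) * real (card D)"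
    using cardZ by (metis of_nat_le_iff of_nat_mult of_nat_numeral of_nat_power)
  finally have "measure lborel (ball (0::real^'n) \<rho>) \<le> 2 ^ CARD('n) * real (card D)" .
  moreover have "measure lborel (ball (0::real^'n) \<rho>) = measure lborel (ball (0::real^'n) 1) * \<rho> ^ CARD('n)"
    using pos by (simp add: content_ball \<rho>_def)
  ultimately show ?thesis by (simp add: \<rho>_def D_def)
qed

section \<open>Tiles meeting the cube\<close>

lemma isometry_measure:
  fixes T :: "'a::euclidean_space \<Rightarrow> 'a"
  assumes T: "\<And>x y. dist (T x) (T y) = dist x y" and "open S"
  shows "emeasure lborel (T ` S) = emeasure lborel S"
proof -
  have "emeasure lborel (T ` S) = emeasure (distr lborel borel T) (T ` S)"
    by (simp only: lborel_distr_isometry[OF T])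
  also have "\<dots> = emeasure lborel (T -` (T ` S))"
    using isometry_borel[OF T] isometry_open_image[OF T \<open>open S\<close>]
    by (subst emeasure_distr) auto
  also have "T -` (T ` S) = S" using isometry_bij[OF T] by (simp add: inj_vimage_image_eq bij_is_inj)
  finally show ?thesis .
qed

text \<open>A tile meeting the cube \<open>[0, R]\<^sup>n\<close> stays within the diameter of \<open>\<Omega>\<close> of it.\<close>

lemma tiles_meeting_cube:
  fixes \<Omega> :: "(real^'n) set" and T :: "nat \<Rightarrow> real^'n \<Rightarrow> real^'n"
  assumes "open \<Omega>" "\<Omega> \<noteq> {}" and \<delta>: "\<And>x y. x \<in> \<Omega> \<Longrightarrow> y \<in> \<Omega> \<Longrightarrow> dist x y \<le> \<delta>"
    and T: "\<And>j x y. dist (T j x) (T j y) = dist x y"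
    and disj: "\<And>j k. j \<noteq> k \<Longrightarrow> T j ` \<Omega> \<inter> T k ` \<Omega> = {}" and R: "R > 0"
  defines "J \<equiv> {j. T j ` \<Omega> \<inter> cbox 0 (\<chi> k. R) \<noteq> {}}"
  shows "finite J" "real (card J) * measure lborel \<Omega> \<le> (R + 2 * \<delta>) ^ CARD('n)"
proof -
  define C :: "(real^'n) set" where "C = cbox (\<chi> k. - \<delta>) (\<chi> k. R + \<delta>)"
  obtain x0 where "x0 \<in> \<Omega>" using assms(2) by blast
  then have \<delta>0: "\<delta> \<ge> 0" using \<delta>[of x0 x0] by simp
  have C: "measure lborel C = (R + 2 * \<delta>) ^ CARD('n)"
  proof -
    have "0 \<in> C" using R \<delta>0 by (auto simp: C_def mem_box_cart)
    then have "C \<noteq> {}" by blast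
    then show ?thesis unfolding C_def by (subst content_cbox_cart) (auto simp: add.commute)
  qed
  have tile_sub: "T j ` \<Omega> \<subseteq> C" if "j \<in> J" for j
  proof
    fix p assume "p \<in> T j ` \<Omega>"
    then obtain x where x: "x \<in> \<Omega>" "p = T j x" by blast
    have "T j ` \<Omega> \<inter> cbox 0 (\<chi> k. R) \<noteq> {}" using that unfolding J_def by blast
    then obtain y where y: "y \<in> \<Omega>" "T j y \<in> cbox 0 (\<chi> k. R)" by blast
    have d: "norm (p - T j y) \<le> \<delta>" using T[of j x y] \<delta>[OF x(1) y(1)] x by (simp add: dist_norm)
    have "- \<delta> \<le> p $ k \<and> p $ k \<le> R + \<delta>" for k
    proof -
      have "\<bar>p $ k - T j y $ k\<bar> \<le> \<delta>" using component_le_norm_cart[of "p - T j y" k] d by simp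
      moreover have "0 \<le> T j y $ k" "T j y $ k \<le> R" using y(2) by (auto simp: mem_box_cart)
      ultimately show ?thesis by linarith
    qed
    then show "p \<in> C" by (simp add: C_def mem_box_cart)
  qed
  have \<Omega>_sub: "bounded \<Omega>" using \<delta> unfolding bounded_def by blast
  have tile_op: "open (T j ` \<Omega>)" for j by (rule isometry_open_image[OF T assms(1)])
  have tile_fm: "T j ` \<Omega> \<in> fmeasurable lborel" if "j \<in> J" for j
    by (rule fmeasurableI2[OF _ tile_sub[OF that]]) (use tile_op in \<open>auto simp: C_def fmeasurable_cbox\<close>)
  have tile_m: "measure lborel (T j ` \<Omega>) = measure lborel \<Omega>" for j
    by (simp add: measure_def isometry_measure[OF T assms(1)])
  have pos: "measure lborel \<Omega> > 0"
  proof -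
    obtain r where r: "r > 0" "ball x0 r \<subseteq> \<Omega>" using assms(1) \<open>x0 \<in> \<Omega>\<close> openE by blast
    have "0 < measure lborel (ball x0 r)" using r by simp
    also have "\<dots> \<le> measure lborel \<Omega>"
      by (intro measure_mono_fmeasurable[OF r(2)])
         (use emeasure_bounded_finite[OF \<Omega>_sub] in \<open>auto simp: fmeasurable_def assms(1)\<close>)
    finally show ?thesis .
  qed
  \<comment> \<open>Proved first for finite subfamilies, as finiteness of \<open>J\<close> is itself
    deduced from this volume bound.\<close>
  have bound: "real (card J') * measure lborel \<Omega> \<le> (R + 2 * \<delta>) ^ CARD('n)" if "finite J'" "J' \<subseteq> J" for J'
  proof -
    have "real (card J') * measure lborel \<Omega> = (\<Sum>j\<in>J'. measure lborel (T j ` \<Omega>))" by (simp add: tile_m)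
    also have "\<dots> = measure lborel (\<Union>j\<in>J'. T j ` \<Omega>)"
      using that tile_fm disj
      by (intro measure_finite_Union[symmetric])
         (auto simp: disjoint_family_on_def fmeasurable_def tile_op less_top[symmetric])
    also have "\<dots> \<le> measure lborel C"
    proof (rule measure_mono_fmeasurable)
      show "(\<Union>j\<in>J'. T j ` \<Omega>) \<subseteq> C" using tile_sub that by blast
    qed (use tile_op in \<open>auto simp: C_def fmeasurable_cbox\<close>)
    finally show ?thesis by (simp add: C)
  qed
  show "finite J"
  proof (rule ccontr)
    assume "infinite J"
    \<comment> \<open>One more tile than the volume comparison permits.\<close>
    define n where "n = nat \<lceil>(R + 2 * \<delta>) ^ CARD('n) / measure lborel \<Omega>\<rceil> + 1"
    obtain J' where J': "finite J'" "card J' = n" "J' \<subseteq> J" using infinite_arbitrarily_large[OF \<open>infinite J\<close>] by blast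
    have "real n * measure lborel \<Omega> \<le> (R + 2 * \<delta>) ^ CARD('n)" using bound[OF J'(1,3)] J'(2) by simp
    then have "real n \<le> (R + 2 * \<delta>) ^ CARD('n) / measure lborel \<Omega>" using pos by (simp add: field_simps)
    then show False unfolding n_def by linarith
  qed
  then show "real (card J) * measure lborel \<Omega> \<le> (R + 2 * \<delta>) ^ CARD('n)" by (rule bound) simp
qed

lemma (in bounded_open) dirichlet_neumann_bracketing:
  fixes T :: "nat \<Rightarrow> real^'n \<Rightarrow> real^'n"
  assumes nonempty: "\<Omega> \<noteq> {}" and cpt: "compact_embedding \<Omega>"
    and \<mu>: "enumerates_neumann_eigenvalues \<Omega> \<mu>"
    and T: "\<And>j x y. dist (T j x) (T j y) = dist x y"
    and disj: "\<And>j k. j \<noteq> k \<Longrightarrow> T j ` \<Omega> \<inter> T k ` \<Omega> = {}"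
    and full: "UNIV - (\<Union>j. T j ` \<Omega>) \<in> null_sets lebesgue" and R: "R > 0"
    and J: "J = {j :: nat. T j ` \<Omega> \<inter> cbox 0 (\<chi> k. R) \<noteq> {}}" "finite J"
  shows "card (dirichlet_indices lam R :: ('n \<Rightarrow> nat) set) \<le> card J * card {k. 1 \<le> k \<and> \<mu> k < lam}"
proof (rule ccontr)
  define D where "D = (dirichlet_indices lam R :: ('n \<Rightarrow> nat) set)"
  have finD: "finite D" unfolding D_def by (rule finite_dirichlet_indices[OF R])
  have D: "m k \<ge> 1" "(\<Sum>k\<in>UNIV. (pi * real (m k) / R)\<^sup>2) < lam" if "m \<in> D" for m k
    using that by (auto simp: D_def dirichlet_indices_def)
  obtain F where F: "finite F" "F \<subseteq> W12 \<Omega>" "card F \<le> card {k. 1 \<le> k \<and> \<mu> k < lam}"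
    and var: "\<And>v. v \<in> W12 \<Omega> \<Longrightarrow> (\<forall>f\<in>F. L2_inner \<Omega> v f = 0) \<Longrightarrow>
         lam * L2.sq \<Omega> v \<le> dirichlet.sq v"
    using variational_family(2)[OF nonempty cpt \<mu>, of lam] by blast
  assume "\<not> card (dirichlet_indices lam R :: ('n \<Rightarrow> nat) set) \<le> card J * card {k. 1 \<le> k \<and> \<mu> k < lam}"
  then have "card J * card {k. 1 \<le> k \<and> \<mu> k < lam} < card D" by (simp add: D_def)
  then have "card (J \<times> F) < card D"
    unfolding card_cartesian_product by (rule order.strict_trans1[OF mult_le_mono2[OF F(3)]])
  \<comment> \<open>One equation for each tile and each member of \<open>F\<close>, one unknown for
    each Dirichlet index.\<close>
  then obtain c where c: "\<exists>m\<in>D. c m \<noteq> 0"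
    "\<forall>i\<in>J \<times> F. (\<Sum>m\<in>D. (case i of (j, f) \<Rightarrow> L2_inner \<Omega> (\<lambda>x. of_real (sines R m (T j x))) f) * c m) = 0"
    using underdetermined_system[of "J \<times> F" D "\<lambda>(j, f) m. L2_inner \<Omega> (\<lambda>x. of_real (sines R m (T j x))) f"]
      finD J(2) F(1) by (auto simp: split_def)
  define p where "p = (\<lambda>y. (cmod (trial R D c y))\<^sup>2)"
  define q where "q = (\<lambda>y. \<Sum>k\<in>UNIV. (cmod (dtrial R D c k y))\<^sup>2)"
  have p: "integrable lborel p" unfolding p_def by (rule trial_norm(1)[OF R finD])
  have q: "integrable lborel q" unfolding q_def by (rule dtrial_norm(1)[OF R finD])
  have tile: "T j ` \<Omega> \<in> sets lborel" for j using isometry_open_image[OF T open_dom] by simp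
  have on_tile: "lam * (LINT y|lborel. indicator (T j ` \<Omega>) y * p y) \<le> (LINT y|lborel. indicator (T j ` \<Omega>) y * q y)"
    if j: "j \<in> J" for j
  proof -
    define v where "v = (\<lambda>x. trial R D c (T j x))"
    note tr = trial_isometry[OF T[of j] R finD, of c, folded v_def]
    have "L2_inner \<Omega> v f = 0" if "f \<in> F" for f
    proof -
      have "f \<in> L2 \<Omega>" using F(2) that by (auto intro: W12_L2)
      then show ?thesis
        unfolding v_def using bspec[OF c(2), of "(j, f)"] j that by (simp add: L2_inner_trial[OF T])
    qed
    then show ?thesis using var[OF tr(1)] by (simp add: tr(2,3) p_def q_def)
  qed
  \<comment> \<open>A function vanishing off the cube sees only the tiles in \<open>J\<close>, and
    almost every point of the cube lies in exactly one of them.\<close>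
  have cover: "(LINT y|lborel. h y) = (\<Sum>j\<in>J. LINT y|lborel. indicator (T j ` \<Omega>) y * h y)"
    if h: "integrable lborel h" and out: "\<And>y. y \<notin> cbox 0 (\<chi> k. R) \<Longrightarrow> h y = 0" for h :: "real^'n \<Rightarrow> real"
  proof -
    have int: "integrable lborel (\<lambda>y. indicator (T j ` \<Omega>) y * h y)" for j
      using integrable_mult_indicator[OF tile h] by simp
    have meas: "(\<Union>j. T j ` \<Omega>) \<in> sets lborel" using tile by blast
    have "UNIV - (\<Union>j. T j ` \<Omega>) \<in> null_sets lborel"
      using full meas by (auto simp: null_sets_def emeasure_completion)
    then have "AE y in lborel. y \<notin> UNIV - (\<Union>j. T j ` \<Omega>)" by (rule AE_not_in)
    then have "AE y in lborel. h y = (\<Sum>j\<in>J. indicator (T j ` \<Omega>) y * h y)"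
    proof eventually_elim
      case (elim y)
      then obtain i where i: "y \<in> T i ` \<Omega>" by blast
      show ?case
      proof (cases "y \<in> cbox 0 (\<chi> k. R)")
        case True
        then have "i \<in> J" using i by (auto simp: J(1))
        have "(\<Sum>j\<in>J. indicator (T j ` \<Omega>) y * h y) = (\<Sum>j\<in>J. if j = i then h y else 0)"
          using disj i by (intro sum.cong) (auto simp: indicator_def)
        then show ?thesis using \<open>i \<in> J\<close> J(2) by simp
      qed (simp add: out)
    qed
    then have "(LINT y|lborel. h y) = (LINT y|lborel. (\<Sum>j\<in>J. indicator (T j ` \<Omega>) y * h y))"
      using h int by (intro integral_cong_AE) auto
    also have "\<dots> = (\<Sum>j\<in>J. LINT y|lborel. indicator (T j ` \<Omega>) y * h y)"
      using int by (rule Bochner_Integration.integral_sum)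
    finally show ?thesis .
  qed
  have "lam * (LINT y|lborel. p y) \<le> (LINT y|lborel. q y)"
  proof -
    have "(LINT y|lborel. p y) = (\<Sum>j\<in>J. LINT y|lborel. indicator (T j ` \<Omega>) y * p y)"
      by (rule cover[OF p]) (simp add: p_def trial_outside[OF R])
    moreover have "(LINT y|lborel. q y) = (\<Sum>j\<in>J. LINT y|lborel. indicator (T j ` \<Omega>) y * q y)"
      by (rule cover[OF q]) (simp add: q_def trial_outside[OF R])
    ultimately show ?thesis using on_tile by (simp add: sum_distrib_left sum_mono)
  qed
  \<comment> \<open>Strict, because all indices in \<open>D\<close> have eigenvalue strictly below
    \<open>lam\<close> and some coefficient is nonzero.\<close>
  moreover have "(LINT y|lborel. q y) < lam * (LINT y|lborel. p y)"
  proof -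
    define s where "s = (\<lambda>m :: 'n \<Rightarrow> nat. LINT x|lborel. (sines R m x)\<^sup>2)"
    define l where "l = (\<lambda>m :: 'n \<Rightarrow> nat. \<Sum>k\<in>UNIV. (pi * real (m k) / R)\<^sup>2)"
    have s: "s m > 0" if "m \<in> D" for m unfolding s_def using D(1)[OF that] by (rule sines_norm_pos[OF R])
    have "(\<Sum>m\<in>D. (cmod (c m))\<^sup>2 * (l m * s m)) < (\<Sum>m\<in>D. (cmod (c m))\<^sup>2 * (lam * s m))"
    proof (rule sum_strict_mono_ex1[OF finD])
      show "\<forall>m\<in>D. (cmod (c m))\<^sup>2 * (l m * s m) \<le> (cmod (c m))\<^sup>2 * (lam * s m)"
        using D(2) s unfolding l_def by (intro ballI mult_left_mono mult_right_mono) (auto intro: less_imp_le)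
      obtain m where m: "m \<in> D" "c m \<noteq> 0" using c(1) by blast
      then have "(cmod (c m))\<^sup>2 * (l m * s m) < (cmod (c m))\<^sup>2 * (lam * s m)"
        using D(2)[OF m(1)] s[OF m(1)] unfolding l_def
        by (intro mult_strict_left_mono mult_strict_right_mono) auto
      then show "\<exists>m\<in>D. (cmod (c m))\<^sup>2 * (l m * s m) < (cmod (c m))\<^sup>2 * (lam * s m)" using m(1) by blast
    qed
    moreover have "(LINT y|lborel. q y) = (\<Sum>m\<in>D. (cmod (c m))\<^sup>2 * (l m * s m))"
      unfolding q_def l_def s_def by (rule dtrial_norm(2)[OF R finD])
    moreover have "lam * (LINT y|lborel. p y) = (\<Sum>m\<in>D. (cmod (c m))\<^sup>2 * (lam * s m))"
      unfolding p_def s_def by (simp add: trial_norm(2)[OF R finD] sum_distrib_left mult_ac)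
    ultimately show ?thesis by simp
  qed
  ultimately show False by simp
qed

section \<open>The limit of large cubes\<close>

lemma tiling_nonempty:
  fixes \<Omega> :: "(real^'n) set"
  assumes "tiling \<Omega>"
  shows "\<Omega> \<noteq> {}"
proof
  assume "\<Omega> = {}"
  then have "(UNIV :: (real^'n) set) \<in> null_sets lebesgue"
    using assms by (auto simp: tiling_def isometric_copy_def)
  then have "negligible (UNIV :: (real^'n) set)" by (simp add: negligible_iff_null_sets)
  then show False using open_not_negligible[of "UNIV :: (real^'n) set"] by simp
qed

lemma neumann_counting_lower_bound:
  fixes \<Omega> :: "(real^'n) set"
  assumes "open \<Omega>" "bounded \<Omega>" and tile: "tiling \<Omega>" and cpt: "compact_embedding \<Omega>"
    and \<mu>: "enumerates_neumann_eigenvalues \<Omega> \<mu>" and lam: "lam > 0"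
  shows "measure lborel (ball (0 :: real^'n) 1) * measure lborel \<Omega> / (2 * pi) ^ CARD('n)
      * lam powr (real CARD('n) / 2) \<le> real (card {k. 1 \<le> k \<and> \<mu> k < lam})"
proof -
  interpret bounded_open \<Omega> by unfold_locales (rule assms)+
  define N where "N = real (card {k. 1 \<le> k \<and> \<mu> k < lam})"
  define d where "d = CARD('n)"
  define \<omega> where "\<omega> = measure lborel (ball (0 :: real^'n) 1)"
  obtain P where P: "\<And>j :: nat. isometric_copy \<Omega> (P j)" and full: "UNIV - (\<Union>j. P j) \<in> null_sets lebesgue"
    and disj: "\<And>j k. j \<noteq> k \<Longrightarrow> P j \<inter> P k = {}"
    using tile unfolding tiling_def by blast
  from P have "\<forall>j. \<exists>T. (\<forall>x y. dist (T x) (T y) = dist x y) \<and> P j = T ` \<Omega>"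
    by (simp add: isometric_copy_def)
  then obtain T where T: "\<And>j x y. dist (T j x) (T j y) = dist x y" and PT: "\<And>j. P j = T j ` \<Omega>"
    unfolding choice_iff by blast
  have nonempty: "\<Omega> \<noteq> {}" using assms(3) by (rule tiling_nonempty)
  obtain \<delta> where \<delta>: "\<And>x y. x \<in> \<Omega> \<Longrightarrow> y \<in> \<Omega> \<Longrightarrow> dist x y \<le> \<delta>"
    using assms(2) by (auto simp: bounded_two_points)
  \<comment> \<open>Lattice points, bracketing and the tile count combined; multiplying by
    \<open>|\<Omega>|\<close> lets the tile bound replace \<open>card J\<close>.\<close>
  have main: "\<omega> * (R * sqrt lam / pi - sqrt (real d)) ^ d * measure lborel \<Omega> \<le> 2 ^ d * N * (R + 2 * \<delta>) ^ d"
    if R: "R > 0" and pos: "0 \<le> R * sqrt lam / pi - sqrt (real d)" for R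
  proof -
    define J where "J = {j. T j ` \<Omega> \<inter> cbox 0 (\<chi> k. R) \<noteq> {}}"
    have J: "finite J" "real (card J) * measure lborel \<Omega> \<le> (R + 2 * \<delta>) ^ d"
      using tiles_meeting_cube[OF open_dom nonempty \<delta> T _ R] disj by (simp_all add: PT J_def d_def)
    have "card (dirichlet_indices lam R :: ('n \<Rightarrow> nat) set) \<le> card J * card {k. 1 \<le> k \<and> \<mu> k < lam}"
      by (rule dirichlet_neumann_bracketing[OF nonempty cpt \<mu> T _ _ R J_def J(1)])
         (use disj full in \<open>simp_all add: PT\<close>)
    then have D: "real (card (dirichlet_indices lam R :: ('n \<Rightarrow> nat) set)) \<le> real (card J) * N"
      unfolding N_def of_nat_mult[symmetric] of_nat_le_iff .
    have "\<omega> * (R * sqrt lam / pi - sqrt (real d)) ^ d \<le> 2 ^ d * real (card (dirichlet_indices lam R :: ('n \<Rightarrow> nat) set))"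
      using dirichlet_indices_card[OF R lam, where 'n = 'n] pos by (simp add: \<omega>_def d_def)
    also have "\<dots> \<le> 2 ^ d * (real (card J) * N)" using D by (intro mult_left_mono) auto
    finally have "\<omega> * (R * sqrt lam / pi - sqrt (real d)) ^ d * measure lborel \<Omega>
        \<le> 2 ^ d * (real (card J) * N) * measure lborel \<Omega>"
      by (rule mult_right_mono) simp
    also have "\<dots> = 2 ^ d * N * (real (card J) * measure lborel \<Omega>)" by (simp add: mult_ac)
    also have "\<dots> \<le> 2 ^ d * N * (R + 2 * \<delta>) ^ d" using J(2) by (intro mult_left_mono) (auto simp: N_def)
    finally show ?thesis .
  qed
  \<comment> \<open>After division by \<open>R^d\<close> the lattice loss \<open>sqrt d\<close> and
    the boundary layer \<open>2 * \<delta>\<close> carry a factor \<open>1 / R\<close> and disappear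
    in the limit.\<close>
  have lim1: "((\<lambda>R. \<omega> * (sqrt lam / pi - sqrt (real d) * inverse R) ^ d * measure lborel \<Omega>)
      \<longlongrightarrow> \<omega> * (sqrt lam / pi - sqrt (real d) * 0) ^ d * measure lborel \<Omega>) at_top"
    by (intro tendsto_intros tendsto_inverse_0_at_top filterlim_ident)
  have lim2: "((\<lambda>R. 2 ^ d * N * (1 + 2 * \<delta> * inverse R) ^ d) \<longlongrightarrow> 2 ^ d * N * (1 + 2 * \<delta> * 0) ^ d) at_top"
    by (intro tendsto_intros tendsto_inverse_0_at_top filterlim_ident)
  have ev: "\<forall>\<^sub>F R in at_top. \<omega> * (sqrt lam / pi - sqrt (real d) * inverse R) ^ d * measure lborel \<Omega>
      \<le> 2 ^ d * N * (1 + 2 * \<delta> * inverse R) ^ d"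
    using eventually_ge_at_top[of "max 1 (sqrt (real d) * pi / sqrt lam)"]
  proof eventually_elim
    case (elim R)
    then have R: "R > 0" "sqrt (real d) * pi / sqrt lam \<le> R" by auto
    then have "sqrt (real d) \<le> R * sqrt lam / pi" using lam by (simp add: field_simps)
    then have "\<omega> * (R * sqrt lam / pi - sqrt (real d)) ^ d * measure lborel \<Omega> \<le> 2 ^ d * N * (R + 2 * \<delta>) ^ d"
      using main R by simp
    moreover have "R * sqrt lam / pi - sqrt (real d) = R * (sqrt lam / pi - sqrt (real d) * inverse R)"
      "R + 2 * \<delta> = R * (1 + 2 * \<delta> * inverse R)"
      using R by (simp_all add: algebra_simps)
    ultimately have "R ^ d * (\<omega> * (sqrt lam / pi - sqrt (real d) * inverse R) ^ d * measure lborel \<Omega>)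
        \<le> R ^ d * (2 ^ d * N * (1 + 2 * \<delta> * inverse R) ^ d)"
      by (simp only: power_mult_distrib mult_ac)
    then show ?case using R by simp
  qed
  have "\<omega> * (sqrt lam / pi - sqrt (real d) * 0) ^ d * measure lborel \<Omega> \<le> 2 ^ d * N * (1 + 2 * \<delta> * 0) ^ d"
    by (rule tendsto_le[OF _ lim2 lim1 ev]) simp
  then have "\<omega> * measure lborel \<Omega> * (sqrt lam) ^ d \<le> (2 * pi) ^ d * N"
    by (simp add: power_divide power_mult_distrib field_simps)
  then have "\<omega> * measure lborel \<Omega> / (2 * pi) ^ d * (sqrt lam) ^ d \<le> N"
    by (simp add: field_simps)
  moreover have "(sqrt lam) ^ d = lam powr (real d / 2)"
    using lam by (simp add: powr_half_sqrt[symmetric] powr_powr powr_realpow[symmetric])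
  ultimately show ?thesis by (simp add: \<omega>_def d_def N_def)
qed

theorem theorem1p8:
  fixes \<Omega> :: "(real^'n) set"
  assumes "open \<Omega>" and "bounded \<Omega>" and "tiling \<Omega>"
    and "compact_embedding \<Omega>"
  shows "(\<forall>k\<ge>1. neumann_eigenvalue \<Omega> (k + 1)
            \<le> 4 * pi\<^sup>2 / (measure lebesgue (ball (0 :: real^'n) 1) * measure lebesgue \<Omega>)
                             powr (2 / real CARD('n))
              * real k powr (2 / real CARD('n))) \<and>
         (\<forall>lam>0. real (neumann_counting lam \<Omega>)
            \<ge> measure lebesgue (ball (0 :: real^'n) 1) * measure lebesgue \<Omega>
                / (2 * pi) ^ CARD('n) * lam powr (real CARD('n) / 2))"
proof -
  interpret bounded_open \<Omega> by unfold_locales (rule assms)+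
  define W where "W = measure lebesgue (ball (0 :: real^'n) 1) * measure lebesgue \<Omega>"
  define d where "d = real CARD('n)"
  have d: "d > 0" by (simp add: d_def)
  have leb: "measure lebesgue S = measure lborel S" if "open S" for S :: "(real^'n) set"
    using that by (intro measure_completion) auto
  have nonempty: "\<Omega> \<noteq> {}" using assms(3) by (rule tiling_nonempty)
  have \<mu>: "enumerates_neumann_eigenvalues \<Omega> (neumann_eigenvalue \<Omega>)"
    by (rule neumann_eigenvalues_exist[OF nonempty assms(4)])
  have count: "W / (2 * pi) powr d * lam powr (d / 2) \<le> real (neumann_counting lam \<Omega>)" if "lam > 0" for lam
    using neumann_counting_lower_bound[OF assms \<mu> that]
    by (simp add: neumann_counting_def W_def d_def leb assms(1) powr_realpow)
  have W: "W > 0"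
  proof -
    have "\<not> negligible \<Omega>" using open_not_negligible[OF assms(1) nonempty] .
    then have "measure lebesgue \<Omega> \<noteq> 0" using lmeasurable_dom by (simp add: negligible_iff_measure)
    then have "measure lebesgue \<Omega> > 0" using measure_nonneg[of lebesgue \<Omega>] by linarith
    moreover have "measure lebesgue (ball (0 :: real^'n) 1) > 0" by (simp add: leb)
    ultimately show ?thesis by (simp add: W_def)
  qed
  have "neumann_eigenvalue \<Omega> (k + 1) \<le> 4 * pi\<^sup>2 / W powr (2 / d) * real k powr (2 / d)" if k: "k \<ge> 1" for k
  \<comment> \<open>The counting bound is stated for positive \<open>lam\<close>; an eigenvalue that
    is not positive satisfies the claim trivially.\<close>
  proof (cases "neumann_eigenvalue \<Omega> (k + 1) > 0")
    case True
    \<comment> \<open>At this level the strict inequality in the counting function leaves only the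
      indices up to \<open>k\<close>, so the count is at most \<open>k\<close> even for multiple
      eigenvalues; the Weyl bound is then solved for \<open>lam\<close>.\<close>
    define lam where "lam = neumann_eigenvalue \<Omega> (k + 1)"
    have mono: "mono_on {1..} (neumann_eigenvalue \<Omega>)"
      using \<mu> by (simp add: enumerates_neumann_eigenvalues_def)
    have "{j. 1 \<le> j \<and> neumann_eigenvalue \<Omega> j < lam} \<subseteq> {1..k}"
    proof
      fix j assume j: "j \<in> {j. 1 \<le> j \<and> neumann_eigenvalue \<Omega> j < lam}"
      have "j \<le> k"
      proof (rule ccontr)
        assume "\<not> j \<le> k"
        then have "lam \<le> neumann_eigenvalue \<Omega> j" unfolding lam_def by (intro mono_onD[OF mono]) auto
        then show False using j by simp
      qed
      then show "j \<in> {1..k}" using j by simp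
    qed
    then have "neumann_counting lam \<Omega> \<le> card {1..k}"
      unfolding neumann_counting_def by (intro card_mono) auto
    then have "W / (2 * pi) powr d * lam powr (d / 2) \<le> real k"
      using count[of lam] True by (simp add: lam_def)
    then have "lam powr (d / 2) \<le> (2 * pi) powr d * real k / W"
      using W by (simp add: field_simps)
    then have "(lam powr (d / 2)) powr (2 / d) \<le> ((2 * pi) powr d * real k / W) powr (2 / d)"
      using d by (intro powr_mono2) auto
    moreover have "(lam powr (d / 2)) powr (2 / d) = lam" using True d by (simp add: powr_powr lam_def)
    moreover have "((2 * pi) powr d * real k / W) powr (2 / d) = 4 * pi\<^sup>2 / W powr (2 / d) * real k powr (2 / d)"
    proof -
      have "((2 * pi) powr d) powr (2 / d) = (2 * pi) powr 2" using d by (simp add: powr_powr)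
      also have "\<dots> = 4 * pi\<^sup>2" by (simp add: powr_numeral power_mult_distrib)
      finally show ?thesis using W by (simp add: powr_divide powr_mult)
    qed
    ultimately show ?thesis by (simp add: lam_def)
  next
    case False
    moreover have "0 \<le> 4 * pi\<^sup>2 / W powr (2 / d) * real k powr (2 / d)" by simp
    ultimately show ?thesis by linarith
  qed
  then show ?thesis using count by (simp add: W_def d_def powr_realpow)
qed

end
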